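(* For every $n\in\mathbb{N}$ there exists a bounded planar domain $\Omega^n\subset\mathbb{R}^2$ whose first Dirichlet eigenfunction $u_1(\Omega^n)$ extends real-analytically to an open neighbourhood of $\overline{\Omega^n}$ (so that its Neumann domains are defined) and such that $u_1(\Omega^n)$ has at least $n$ Neumann domains.
   Context: For a bounded domain $\Omega\subset\mathbb{R}^2$ with boundary $\Gamma^D=\partial\Omega$, consider the Dirichlet problem $-\Delta u=\lambda u$ in $\Omega$, $u|_{\Gamma^D}=0$, with eigenvalues $\lambda_1(\Omega)\le\lambda_2(\Omega)\le\dots$ counted with multiplicity; $u_k(\Omega)$ denotes a (nonzero, real-valued) eigenfunction for $\lambda_k(\Omega)$. The first eigenvalue is simple, so $u_1(\Omega)$ is unique up to scaling. Neumann domains. Let $u$ be a Dirichlet eigenfunction in $\Omega$ that extends real-analytically to an open set $\Omega'\supset\overline\Omega$. Local maxima/minima are understood in the non-strict sense; for points of $\partial\Omega$ they are understood for the extension of $u$. Put $\mathcal{C}=\{x\in\overline\Omega:\operatorname{grad}u(x)=0\}$; let $\mathcal{M}_+$, $\mathcal{M}_-$ be the sets of points of $\mathcal{C}$ that are local maxima, resp. local minima, of $u$, and let $\mathcal{S}=\mathcal{C}\setminus(\mathcal{M}_+\cup\mathcal{M}_-)$ be the set of saddle points (possibly degenerate). For $x\in\overline\Omega$ let $\gamma_x(t)$ be the integral curve of the vector field $-\operatorname{grad}u$ with $\gamma_x(0)=x$, followed forward and backward as long as it stays in $\overline\Omega$. It is known that in each time direction, for $x\in\Omega$, the curve either reaches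 $\Gamma^D$ in finite time or tends to a point of $\mathcal{C}$ as $t\to\pm\infty$; in the latter case the limit is denoted $\gamma_x(\pm\infty)$. For $x_0\in\mathcal{C}$ put $W^s(x_0)=\{x\in\overline\Omega:\gamma_x(+\infty)=x_0\}$, $W^u(x_0)=\{x\in\overline\Omega:\gamma_x(-\infty)=x_0\}$, and for $r\in\mathcal{S}$ put $L(r)=W^s(r)\cup W^u(r)$. The Neumann line set is $$\mathcal{N}(u)=\overline{\bigcup_{r\in\mathcal{S}}\partial L(r)\setminus\Gamma^D}\,\cup\,\mathcal{C},$$ with boundary and closure taken in $\mathbb{R}^2$. The Neumann domains of $u$ are the connected components of $\Omega\setminus\mathcal{N}(u)$. *)

theory Defs
  imports "HOL-Analysis.Analysis"
begin

definition grad :: "(real^2 \<Rightarrow> real) \<Rightarrow> real^2 \<Rightarrow> real^2" where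
  "grad f x = (THE D. GDERIV f x :> D)"

definition bounded_domain :: "(real^2) set \<Rightarrow> bool" where
  "bounded_domain \<Omega> \<longleftrightarrow> open \<Omega> \<and> connected \<Omega> \<and> \<Omega> \<noteq> {} \<and> bounded \<Omega>"

primrec C_k :: "nat \<Rightarrow> (real^2 \<Rightarrow> real) \<Rightarrow> bool" where
  "C_k 0 f \<longleftrightarrow> continuous_on UNIV f"
| "C_k (Suc k) f \<longleftrightarrow> (\<forall>x. f differentiable (at x)) \<and> (\<forall>i. C_k k (\<lambda>x. grad f x $ i))"

definition test_function :: "(real^2) set \<Rightarrow> (real^2 \<Rightarrow> real) \<Rightarrow> bool" where
  "test_function \<Omega> \<phi> \<longleftrightarrow>
     (\<forall>k. C_k k \<phi>) \<and> compact (closure {x. \<phi> x \<noteq> 0}) \<and> closure {x. \<phi> x \<noteq> 0} \<subseteq> \<Omega>"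

definition L2_on :: "(real^2) set \<Rightarrow> (real^2 \<Rightarrow> 'b::euclidean_space) \<Rightarrow> bool" where
  "L2_on \<Omega> f \<longleftrightarrow>
     set_borel_measurable lborel \<Omega> f \<and> set_integrable lborel \<Omega> (\<lambda>x. (norm (f x))\<^sup>2)"

text \<open>
  The restriction of \<open>u\<close> to \<open>\<Omega>\<close> lies in $H^1_0(\Omega)$, the closure of
  $C_c^\infty(\Omega)$ in the $H^1$ norm, and \<open>g\<close> is its (a.e. unique) weak gradient.
\<close>

definition H10_with_gradient ::
    "(real^2) set \<Rightarrow> (real^2 \<Rightarrow> real) \<Rightarrow> (real^2 \<Rightarrow> real^2) \<Rightarrow> bool" where
  "H10_with_gradient \<Omega> u g \<longleftrightarrow>
     L2_on \<Omega> u \<and> L2_on \<Omega> g \<and>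
     (\<exists>\<phi>. (\<forall>n. test_function \<Omega> (\<phi> n)) \<and>
        (\<lambda>n. LINT x:\<Omega>|lborel. (\<phi> n x - u x)\<^sup>2) \<longlonglongrightarrow> 0 \<and>
        (\<lambda>n. LINT x:\<Omega>|lborel. (norm (grad (\<phi> n) x - g x))\<^sup>2) \<longlonglongrightarrow> 0)"

text \<open>
  No regularity of the boundary is assumed, so $-\Delta u = \mu u$, $u|_{\partial\Omega} = 0$
  is understood in the usual weak sense. Only the values of \<open>u\<close> on \<open>\<Omega>\<close> matter here.
\<close>

definition dirichlet_eigenfunction ::
    "(real^2) set \<Rightarrow> real \<Rightarrow> (real^2 \<Rightarrow> real) \<Rightarrow> bool" where
  "dirichlet_eigenfunction \<Omega> \<mu> u \<longleftrightarrow>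
     \<not> (AE x\<in>\<Omega> in lborel. u x = 0) \<and>
     (\<exists>g. H10_with_gradient \<Omega> u g \<and>
        (\<forall>\<phi>. test_function \<Omega> \<phi> \<longrightarrow>
           (LINT x:\<Omega>|lborel. g x \<bullet> grad \<phi> x) = \<mu> * (LINT x:\<Omega>|lborel. u x * \<phi> x)))"

definition first_dirichlet_eigenfunction ::
    "(real^2) set \<Rightarrow> (real^2 \<Rightarrow> real) \<Rightarrow> bool" where
  "first_dirichlet_eigenfunction \<Omega> u \<longleftrightarrow>
     (\<exists>\<mu>. dirichlet_eigenfunction \<Omega> \<mu> u \<and>
        (\<forall>\<nu> v. dirichlet_eigenfunction \<Omega> \<nu> v \<longrightarrow> \<mu> \<le> \<nu>))"

definition real_analytic_on :: "(real^2 \<Rightarrow> real) \<Rightarrow> (real^2) set \<Rightarrow> bool" where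
  "real_analytic_on f S \<longleftrightarrow>
     (\<forall>p\<in>S. \<exists>r>0. \<exists>a :: nat \<Rightarrow> nat \<Rightarrow> real. \<forall>x\<in>ball p r.
        ((\<lambda>(i, j). a i j * (x$1 - p$1) ^ i * (x$2 - p$2) ^ j) has_sum f x) UNIV)"

text \<open>
  Below, \<open>u\<close> stands for the extension of the eigenfunction, which is real-analytic on a
  neighbourhood of \<open>closure \<Omega>\<close>; gradients and extrema at boundary points refer to it.
\<close>

definition critical_points :: "(real^2) set \<Rightarrow> (real^2 \<Rightarrow> real) \<Rightarrow> (real^2) set" where
  "critical_points \<Omega> u = {x \<in> closure \<Omega>. grad u x = 0}"

definition maxima :: "(real^2) set \<Rightarrow> (real^2 \<Rightarrow> real) \<Rightarrow> (real^2) set" where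
  "maxima \<Omega> u = {x \<in> critical_points \<Omega> u. \<forall>\<^sub>F y in nhds x. u y \<le> u x}"

definition minima :: "(real^2) set \<Rightarrow> (real^2 \<Rightarrow> real) \<Rightarrow> (real^2) set" where
  "minima \<Omega> u = {x \<in> critical_points \<Omega> u. \<forall>\<^sub>F y in nhds x. u x \<le> u y}"

definition saddles :: "(real^2) set \<Rightarrow> (real^2 \<Rightarrow> real) \<Rightarrow> (real^2) set" where
  "saddles \<Omega> u = critical_points \<Omega> u - (maxima \<Omega> u \<union> minima \<Omega> u)"

definition gradient_curve ::
    "(real^2) set \<Rightarrow> (real^2 \<Rightarrow> real) \<Rightarrow> real set \<Rightarrow> (real \<Rightarrow> real^2) \<Rightarrow> bool" where
  "gradient_curve \<Omega> u T \<gamma> \<longleftrightarrow>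
     (\<forall>t\<in>T. \<gamma> t \<in> closure \<Omega> \<and> (\<gamma> has_vector_derivative - grad u (\<gamma> t)) (at t within T))"

text \<open>
  As \<open>grad u\<close> is locally Lipschitz near \<open>closure \<Omega>\<close>, the curve through \<open>x\<close> is unique, so
  the existential quantifiers say that the integral curve $\gamma_x$ stays in \<open>closure \<Omega>\<close>
  for all forward (backward) times and tends to \<open>p\<close>.
\<close>

definition stable_set ::
    "(real^2) set \<Rightarrow> (real^2 \<Rightarrow> real) \<Rightarrow> real^2 \<Rightarrow> (real^2) set" where
  "stable_set \<Omega> u p =
     {x \<in> closure \<Omega>. \<exists>\<gamma>. \<gamma> 0 = x \<and> gradient_curve \<Omega> u {0..} \<gamma> \<and> (\<gamma> \<longlongrightarrow> p) at_top}"

definition unstable_set ::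
    "(real^2) set \<Rightarrow> (real^2 \<Rightarrow> real) \<Rightarrow> real^2 \<Rightarrow> (real^2) set" where
  "unstable_set \<Omega> u p =
     {x \<in> closure \<Omega>. \<exists>\<gamma>. \<gamma> 0 = x \<and> gradient_curve \<Omega> u {..0} \<gamma> \<and> (\<gamma> \<longlongrightarrow> p) at_bot}"

definition neumann_line_set :: "(real^2) set \<Rightarrow> (real^2 \<Rightarrow> real) \<Rightarrow> (real^2) set" where
  "neumann_line_set \<Omega> u =
     closure ((\<Union>r\<in>saddles \<Omega> u. frontier (stable_set \<Omega> u r \<union> unstable_set \<Omega> u r)) - frontier \<Omega>)
       \<union> critical_points \<Omega> u"

definition neumann_domains :: "(real^2) set \<Rightarrow> (real^2 \<Rightarrow> real) \<Rightarrow> (real^2) set set" where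
  "neumann_domains \<Omega> u = components (\<Omega> - neumann_line_set \<Omega> u)"

end

theory Submission
  imports Defs "HOL-Computational_Algebra.Polynomial" "HOL-Real_Asymp.Real_Asymp"
begin

text \<open>
  Let \<open>r\<close>, \<open>\<theta>\<close> be polar coordinates and \<open>N\<close> even. The function
  \<open>u = c J\<^sub>N(2 r) cos (N \<theta>) - J\<^sub>0(2 r)\<close> solves \<open>\<Delta> u = - 4 u\<close>, and for small
  \<open>c > 0\<close> the set \<open>{u > 0}\<close> has a component \<open>\<Omega>\<close> close to the annulus between the first two
  zeros of \<open>J\<^sub>0(2 r)\<close>. A positive solution is a
  first eigenfunction. As \<open>cos (N \<theta>)\<close> is monotone along gradient curves, the only saddles are the
  radial maxima on the \<open>N\<close> rays \<open>cos (N \<theta>) = - 1\<close>, each ray is contained in the unstable set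
  of its saddle, and the rest of the set \<open>L(r)\<close> of a saddle \<open>r\<close> lies where \<open>u \<ge> u(r)\<close>.
  Hence the rays belong to the Neumann line set and cut \<open>\<Omega>\<close> into \<open>N\<close> sectors.
\<close>

section \<open>Smooth functions\<close>

text \<open>Between the first two zeros of \<open>J_0(2 r)\<close> the function
  \<open>- J_0(2 r)\<close> is a positive bump with a whole circle of maxima. The small angular term
  splits that circle into \<open>N\<close> maxima and \<open>N\<close> saddles without costing
  positivity, which is how a first eigenfunction can have arbitrarily many Neumann domains. On a
  ray, \<open>u\<close> is a function of s = r^2 that depends on the direction only through k = c
  cos(N \<theta>). Hence all conditions on these profiles are imposed uniformly for |k| \<le> c. An
  even \<open>N\<close> makes r^N a polynomial in s, and \<open>N\<close> + 1 is taken above the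
  outer value of s so that \<open>J_N(2 r)\<close> keeps one sign on the annulus. The line set is
  built from frontiers of the sets L(r), whose stable parts are never computed. Two facts suffice:
  below the saddle level L(r) is contained in rays, which have empty interior, so ray points there
  are frontier points; and each sector has a noncritical point below that level, away from all L(r).
  This yields a lower bound for the number of components. That the eigenvalue 4 is the lowest needs
  no spectral theorem: a Poincare inequality with constant 4 bounds every weak eigenvalue from
  below.\<close>

lemma grad_eqI:
  assumes "GDERIV f x :> D"
  shows "grad f x = D"
proof -
  have "D' = D" if "GDERIV f x :> D'" for D'
  proof -
    have "(\<lambda>h. h \<bullet> D') = (\<lambda>h. h \<bullet> D)"
      using that assms unfolding gderiv_def by (rule has_derivative_unique)
    then have "(D' - D) \<bullet> (D' - D) = 0"
      by (metis inner_diff_right right_minus_eq)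
    then show ?thesis by simp
  qed
  then show ?thesis unfolding grad_def using assms by blast
qed

lemma gderiv_grad:
  assumes "f differentiable (at x)"
  shows "GDERIV f x :> grad f x"
proof -
  obtain f' where f': "(f has_derivative f') (at x)"
    using assms differentiable_def by blast
  have "bounded_linear f'" using f' by (rule has_derivative_bounded_linear)
  then have lin: "linear f'" by (rule bounded_linear.linear)
  have "f' h = h \<bullet> (\<Sum>b\<in>Basis. f' b *\<^sub>R b)" for h
  proof -
    have "f' h = f' (\<Sum>b\<in>Basis. (h \<bullet> b) *\<^sub>R b)" by (simp add: euclidean_representation)
    also have "\<dots> = (\<Sum>b\<in>Basis. (h \<bullet> b) * f' b)"
      using lin by (simp add: linear_sum linear_scale)
    also have "\<dots> = h \<bullet> (\<Sum>b\<in>Basis. f' b *\<^sub>R b)"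
      by (simp add: inner_sum_right mult.commute)
    finally show ?thesis .
  qed
  then have "f' = (\<lambda>h. h \<bullet> (\<Sum>b\<in>Basis. f' b *\<^sub>R b))" by blast
  then have "GDERIV f x :> (\<Sum>b\<in>Basis. f' b *\<^sub>R b)" using f' unfolding gderiv_def by metis
  then show ?thesis using grad_eqI by metis
qed

text \<open>Gradient fields are computed explicitly below; uniqueness of the gradient identifies
  such a field with the \<open>grad f\<close> of which \<open>C_k\<close> speaks.\<close>

lemma C_k_SucI:
  assumes "\<And>x. GDERIV f x :> D x" "\<And>i. C_k k (\<lambda>x. D x $ i)"
  shows "C_k (Suc k) f"
proof -
  have "grad f = D" using assms(1) grad_eqI by blast
  moreover have "f differentiable (at x)" for x
    using assms(1) unfolding gderiv_def differentiable_def by blast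
  ultimately show ?thesis using assms(2) by simp
qed

lemma C_k_SucD:
  assumes "C_k (Suc k) f"
  shows "GDERIV f x :> grad f x" "C_k k (\<lambda>x. grad f x $ i)"
  using assms gderiv_grad by auto

lemma C_k_Suc_imp: "C_k (Suc k) f \<Longrightarrow> C_k k f"
proof (induction k arbitrary: f)
  case 0
  then show ?case
    by (auto intro!: differentiable_imp_continuous_on simp: differentiable_on_def
        intro: differentiable_at_withinI)
next
  case (Suc k)
  then show ?case by simp
qed

lemma C_k_continuous: "C_k k f \<Longrightarrow> continuous_on S f"
  by (induction k) (use continuous_on_subset C_k_Suc_imp in \<open>auto simp del: C_k.simps(2)\<close>)

lemma C_k_const: "C_k k (\<lambda>x. c)"
proof (induction k arbitrary: c)
  case (Suc k)
  show ?case by (rule C_k_SucI[OF GDERIV_const]) (use Suc in simp)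
qed simp

lemma C_k_coord: "C_k k (\<lambda>x. x $ i)"
proof (cases k)
  case (Suc j)
  have "GDERIV (\<lambda>x. x $ i) x :> axis i 1" for x :: "real^2"
    unfolding gderiv_def by (simp add: inner_axis bounded_linear_imp_has_derivative bounded_linear_vec_nth)
  then show ?thesis unfolding Suc by (rule C_k_SucI) (rule C_k_const)
qed (auto intro!: continuous_intros)

lemma C_k_add: "C_k k f \<Longrightarrow> C_k k g \<Longrightarrow> C_k k (\<lambda>x. f x + g x)"
proof (induction k arbitrary: f g)
  case (Suc k)
  show ?case
    by (rule C_k_SucI[OF GDERIV_add[OF C_k_SucD(1)[OF Suc.prems(1)] C_k_SucD(1)[OF Suc.prems(2)]]])
      (simp add: Suc.IH C_k_SucD(2)[OF Suc.prems(1)] C_k_SucD(2)[OF Suc.prems(2)])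
qed (auto intro: continuous_intros)

lemma C_k_mult: "C_k k f \<Longrightarrow> C_k k g \<Longrightarrow> C_k k (\<lambda>x. f x * g x)"
proof (induction k arbitrary: f g)
  case (Suc k)
  show ?case
    by (rule C_k_SucI[OF GDERIV_mult[OF C_k_SucD(1)[OF Suc.prems(1)] C_k_SucD(1)[OF Suc.prems(2)]]])
      (auto intro!: C_k_add Suc.IH C_k_SucD(2)[OF Suc.prems(1)] C_k_SucD(2)[OF Suc.prems(2)]
        C_k_Suc_imp[OF Suc.prems(1)] C_k_Suc_imp[OF Suc.prems(2)])
qed (auto intro: continuous_intros)

text \<open>\<psi> lists the successive derivatives of one real function. Differentiating moves from
  index j to j + 1, so the induction on k has to treat all indices at once.\<close>

lemma C_k_compose:
  assumes "\<And>j t. (\<psi> j has_real_derivative \<psi> (Suc j) t) (at t)"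
  shows "C_k k f \<Longrightarrow> C_k k (\<lambda>x. \<psi> j (f x))"
proof (induction k arbitrary: j f)
  case 0
  have "continuous_on UNIV (\<psi> j)"
    using assms by (meson DERIV_continuous continuous_at_imp_continuous_on)
  then show ?case using 0 continuous_on_compose2[of UNIV "\<psi> j" UNIV f] by simp
next
  case (Suc k)
  show ?case
    by (rule C_k_SucI[OF GDERIV_DERIV_compose[OF C_k_SucD(1)[OF Suc.prems] assms]])
      (auto intro!: C_k_mult Suc.IH C_k_SucD(2)[OF Suc.prems] C_k_Suc_imp[OF Suc.prems])
qed

lemma GDERIV_transfer:
  assumes "GDERIV g x :> D" "\<forall>\<^sub>F y in nhds x. f y = g y"
  shows "GDERIV f x :> D"
proof -
  obtain S where "open S" "x \<in> S" "\<And>y. y \<in> S \<Longrightarrow> g y = f y"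
    using assms(2) unfolding eventually_nhds by metis
  then show ?thesis
    using assms(1) unfolding gderiv_def by (blast intro: has_derivative_transform_within_open)
qed

text \<open>\<open>C_k\<close> is a condition on the whole plane. This lemma glues local pieces, as
  is needed for a cutoff of \<open>u\<close> inside a domain continued by zero outside.\<close>

lemma C_k_local:
  assumes "\<And>x. \<exists>g. C_k k g \<and> (\<forall>\<^sub>F y in nhds x. f y = g y)"
  shows "C_k k f"
  using assms
proof (induction k arbitrary: f)
  case 0
  have "isCont f x" for x
    using 0[of x] isCont_cong[of f _ x] by (auto simp: continuous_on_eq_continuous_at)
  then show ?case by (simp add: continuous_at_imp_continuous_on)
next
  case (Suc k)
  have *: "\<exists>D. GDERIV f x :> D \<and> (\<exists>g. C_k (Suc k) g \<and> (\<forall>\<^sub>F y in nhds x. grad f y = grad g y))" for x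
  proof -
    obtain g where g: "C_k (Suc k) g" and ev: "\<forall>\<^sub>F y in nhds x. f y = g y"
      using Suc.prems by blast
    have *: "GDERIV f y :> grad g y" if "\<forall>\<^sub>F z in nhds y. f z = g z" for y
      using GDERIV_transfer[OF C_k_SucD(1)[OF g] that] .
    have "\<forall>\<^sub>F y in nhds x. \<forall>\<^sub>F z in nhds y. f z = g z"
      using ev by (simp add: eventually_eventually)
    then have "\<forall>\<^sub>F y in nhds x. grad f y = grad g y"
      by (rule eventually_mono) (use * grad_eqI in blast)
    then show ?thesis using * ev g by blast
  qed
  show ?case
  proof (rule C_k_SucI)
    show "GDERIV f x :> grad f x" for x using * grad_eqI by blast
    show "C_k k (\<lambda>x. grad f x $ i)" for i
    proof (rule Suc.IH)
      fix x
      obtain g where "C_k (Suc k) g" "\<forall>\<^sub>F y in nhds x. grad f y = grad g y" using * by blast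
      then show "\<exists>g. C_k k g \<and> (\<forall>\<^sub>F y in nhds x. grad f y $ i = g y)"
        using C_k_SucD(2) by (intro exI[of _ "\<lambda>y. grad g y $ i"]) (auto elim: eventually_mono)
    qed
  qed
qed

section \<open>Smooth cutoff functions\<close>

text \<open>The polynomial factor makes the family closed under differentiation: with v = 1/t, the
  derivative of p(v) exp(-v) in t is v^2 (p(v) - p'(v)) exp(-v). The case p = 1 is the standard flat
  function.\<close>

definition flat :: "real poly \<Rightarrow> real \<Rightarrow> real" where
  "flat p t = (if t > 0 then poly p (1 / t) * exp (- (1 / t)) else 0)"

lemma poly_exp_tendsto_0: "((\<lambda>v. v ^ k * poly p v * exp (- v)) \<longlongrightarrow> (0::real)) at_top"
proof (induction p arbitrary: k)
  case 0
  then show ?case by simp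
next
  case (pCons a p)
  have "((\<lambda>v. a * (v ^ k / exp v) + v ^ Suc k * poly p v * exp (- v)) \<longlongrightarrow> a * 0 + 0) at_top"
    by (intro tendsto_intros pCons.IH tendsto_power_div_exp_0)
  then show ?case by (simp add: algebra_simps exp_minus divide_inverse)
qed

lemma flat_deriv:
  "(flat p has_real_derivative flat ([:0, 0, 1:] * (p - pderiv p)) t) (at t)"
proof -
  consider "t > 0" | "t < 0" | "t = 0" by linarith
  then show ?thesis
  proof cases
    case 1
    have ev: "\<forall>\<^sub>F y in nhds t. flat p y = poly p (1 / y) * exp (- (1 / y))"
      using eventually_nhds_in_open[of "{0<..}" t] 1
      by (auto simp: flat_def elim!: eventually_mono)
    have "((\<lambda>y. poly p (1 / y) * exp (- (1 / y))) has_real_derivative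
       flat ([:0, 0, 1:] * (p - pderiv p)) t) (at t)"
      using 1 by (auto intro!: derivative_eq_intros poly_DERIV[THEN DERIV_chain2]
        simp: flat_def field_simps power2_eq_square)
    then show ?thesis using DERIV_cong_ev[OF refl ev refl] by blast
  next
    case 2
    have ev: "\<forall>\<^sub>F y in nhds t. flat p y = 0"
      using eventually_nhds_in_open[of "{..<0}" t] 2
      by (auto simp: flat_def elim!: eventually_mono)
    have "((\<lambda>y. 0) has_real_derivative flat ([:0, 0, 1:] * (p - pderiv p)) t) (at t)"
      using 2 by (simp add: flat_def)
    then show ?thesis using DERIV_cong_ev[OF refl ev refl] by blast
  next
    case 3
    \<comment> \<open>The difference quotient at 0 from the right is v p(v) exp(-v) with v = 1/y,
      and v tends to infinity.\<close>
    have "((\<lambda>y. (1 / y) ^ 1 * poly p (1 / y) * exp (- (1 / y))) \<longlongrightarrow> 0) (at_right 0)"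
      using filterlim_compose[OF poly_exp_tendsto_0 filterlim_inverse_at_top_right, of 1 p]
      by (simp add: inverse_eq_divide)
    then have R: "((\<lambda>y. flat p y / y) \<longlongrightarrow> 0) (at_right 0)"
      by (rule Lim_transform_eventually)
        (use eventually_at_right_less[of "0::real"] in \<open>auto simp: flat_def elim!: eventually_mono\<close>)
    have L: "((\<lambda>y. flat p y / y) \<longlongrightarrow> 0) (at_left 0)"
      by (rule tendsto_eventually) (auto simp: flat_def eventually_at_filter)
    have "((\<lambda>y. flat p y / y) \<longlongrightarrow> 0) (at 0)" using L R filterlim_split_at by blast
    then show ?thesis unfolding 3 has_field_derivative_iff by (simp add: flat_def)
  qed
qed

lemma C_k_flat:
  assumes "C_k k f"
  shows "C_k k (\<lambda>x. flat 1 (f x))"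
proof -
  define q where "q j = ((\<lambda>p. [:0, 0, 1:] * (p - pderiv p)) ^^ j) (1 :: real poly)" for j
  have "(flat (q j) has_real_derivative flat (q (Suc j)) t) (at t)" for j t
    unfolding q_def funpow.simps comp_def by (rule flat_deriv)
  then have "C_k k (\<lambda>x. flat (q 0) (f x))"
    using assms by (rule C_k_compose[where \<psi> = "\<lambda>j. flat (q j)"])
  then show ?thesis by (simp add: q_def)
qed

text \<open>Vanishes for t \<le> d and tends to t as d tends to 0 when t > 0. Applied to a positive
  function with zero boundary values it produces compactly supported approximations.\<close>

definition cutoff :: "real \<Rightarrow> real \<Rightarrow> real" where
  "cutoff d t = t * flat 1 (t / d - 1)"

text \<open>The derivative of \<open>cutoff d\<close>. With \<tau> = t/d - 1 and v = 1/\<tau>, the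
  factor of exp(-v) is 1 + (1 + 1/v) v^2 = 1 + v + v^2.\<close>

definition cutoff' :: "real \<Rightarrow> real \<Rightarrow> real" where
  "cutoff' d t = flat [:1, 1, 1:] (t / d - 1)"

lemma C_k_cutoff: "C_k k f \<Longrightarrow> C_k k (\<lambda>x. cutoff d (f x))"
  unfolding cutoff_def
  using C_k_add[OF C_k_mult[OF _ C_k_const[of k "1 / d"]] C_k_const[of k "-1"]]
  by (intro C_k_mult C_k_flat) (auto simp: divide_inverse)

lemma cutoff_deriv:
  assumes "d > 0"
  shows "(cutoff d has_real_derivative cutoff' d t) (at t)"
proof -
  have "((\<lambda>t. t / d - 1) has_real_derivative 1 / d) (at t)"
    using assms by (auto intro!: derivative_eq_intros)
  from DERIV_mult[OF DERIV_ident DERIV_chain2[OF flat_deriv this]]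
  have "(cutoff d has_real_derivative
      flat 1 (t / d - 1) + t * (flat ([:0, 0, 1:] * (1 - pderiv 1)) (t / d - 1) * (1 / d))) (at t)"
    unfolding cutoff_def by (rule back_subst[of "\<lambda>D. (_ has_real_derivative D) (at t)"]) simp
  also have "flat 1 (t / d - 1) + t * (flat ([:0, 0, 1:] * (1 - pderiv 1)) (t / d - 1) * (1 / d))
      = cutoff' d t"
  proof -
    define \<tau> where "\<tau> = t / d - 1"
    have t: "t = d * (\<tau> + 1)" using assms by (simp add: \<tau>_def field_simps)
    have "flat 1 \<tau> + (\<tau> + 1) * flat [:0, 0, 1:] \<tau> = flat [:1, 1, 1:] \<tau>"
      by (auto simp: flat_def field_simps power2_eq_square)
    then show ?thesis
      unfolding cutoff'_def using assms by (simp add: \<tau>_def[symmetric]) (simp add: t)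
  qed
  finally show ?thesis .
qed

text \<open>From exp v \<ge> 1 + v + v^2/2. The bounds do not depend on d, and they say that
  \<open>cutoff'\<close> differs from 1 by at most 1; this is what dominates the gradients of the
  approximations by the gradient of the limit.\<close>

lemma cutoff'_bounds: "0 \<le> cutoff' d t" "cutoff' d t \<le> 2"
proof -
  have "(1 + (v + v * v)) * exp (- v) \<le> 2" if "v > 0" for v :: real
    using exp_lower_Taylor_quadratic[of v] that
    by (simp add: exp_minus field_simps power2_eq_square)
  from this[of "1 / (t / d - 1)"] show "cutoff' d t \<le> 2"
    by (simp add: cutoff'_def flat_def distrib_left)
  show "0 \<le> cutoff' d t" by (auto simp: cutoff'_def flat_def intro!: mult_nonneg_nonneg add_nonneg_nonneg)
qed

lemma cutoff_bounds:
  assumes "0 \<le> t"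
  shows "0 \<le> cutoff d t" "cutoff d t \<le> t"
proof -
  have "0 \<le> flat 1 \<tau>" "flat 1 \<tau> \<le> 1" for \<tau> by (auto simp: flat_def)
  then show "0 \<le> cutoff d t" "cutoff d t \<le> t"
    unfolding cutoff_def using assms by (auto intro: mult_left_le)
qed

lemma cutoff_eq_0: "d > 0 \<Longrightarrow> t \<le> d \<Longrightarrow> cutoff d t = 0"
  by (simp add: cutoff_def flat_def field_simps)

lemma flat_tendsto: "filterlim \<tau> at_top F \<Longrightarrow> ((\<lambda>n. flat p (\<tau> n)) \<longlongrightarrow> poly p 0) F"
proof -
  assume \<tau>: "filterlim \<tau> at_top F"
  then have "((\<lambda>n. 1 / \<tau> n) \<longlongrightarrow> 0) F"
    using tendsto_inverse_0_at_top by (simp add: divide_inverse)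
  then have "((\<lambda>n. poly p (1 / \<tau> n) * exp (- (1 / \<tau> n))) \<longlongrightarrow> poly p 0 * exp (- 0)) F"
    by (intro tendsto_intros)
  then have "((\<lambda>n. poly p (1 / \<tau> n) * exp (- (1 / \<tau> n))) \<longlongrightarrow> poly p 0) F" by simp
  then show "((\<lambda>n. flat p (\<tau> n)) \<longlongrightarrow> poly p 0) F"
  proof (rule Lim_transform_eventually)
    have "\<forall>\<^sub>F n in F. \<tau> n > 0" using \<tau> filterlim_at_top_dense by blast
    then show "\<forall>\<^sub>F n in F. poly p (1 / \<tau> n) * exp (- (1 / \<tau> n)) = flat p (\<tau> n)"
      by (rule eventually_mono) (simp add: flat_def)
  qed
qed

lemma cutoff_tendsto:
  assumes "0 < t"
  shows "(\<lambda>n. cutoff (inverse (real (Suc n))) t) \<longlonglongrightarrow> t"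
    and "(\<lambda>n. cutoff' (inverse (real (Suc n))) t) \<longlonglongrightarrow> 1"
proof -
  have lim: "filterlim (\<lambda>n. t / inverse (real (Suc n)) - 1) at_top sequentially"
    using assms by real_asymp
  show "(\<lambda>n. cutoff (inverse (real (Suc n))) t) \<longlonglongrightarrow> t"
    unfolding cutoff_def using tendsto_mult[OF tendsto_const flat_tendsto[OF lim, of 1], of t] by simp
  show "(\<lambda>n. cutoff' (inverse (real (Suc n))) t) \<longlonglongrightarrow> 1"
    unfolding cutoff'_def using flat_tendsto[OF lim, of "[:1, 1, 1:]"] by simp
qed

section \<open>Integration by parts\<close>

lemma lborel_integral_translation:
  fixes F :: "'a::euclidean_space \<Rightarrow> 'b::{banach, second_countable_topology}"
  assumes [measurable]: "F \<in> borel_measurable borel"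
  shows "(\<integral>x. F (c + x) \<partial>lborel) = (\<integral>x. F x \<partial>lborel)"
proof -
  have "(\<integral>x. F x \<partial>lborel) = (\<integral>x. F x \<partial>distr lborel borel ((+) c))"
    by (simp add: lborel_distr_plus)
  also have "\<dots> = (\<integral>x. F (c + x) \<partial>lborel)"
    by (rule integral_distr) auto
  finally show ?thesis ..
qed

lemma integrable_compact_support:
  fixes F :: "'a::euclidean_space \<Rightarrow> 'b::euclidean_space"
  assumes "continuous_on UNIV F" "compact K" "\<And>x. x \<notin> K \<Longrightarrow> F x = 0"
  shows "integrable lborel F"
proof -
  have "integrable lborel (\<lambda>x. indicator K x *\<^sub>R F x)"
    using borel_integrable_compact[OF assms(2) continuous_on_subset[OF assms(1)]] by (simp add: indicator_def)
  moreover have "(\<lambda>x. indicator K x *\<^sub>R F x) = F"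
    using assms(3) by (auto simp: indicator_def)
  ultimately show ?thesis by simp
qed

text \<open>
  By translation invariance the integrals of all difference quotients of \<open>F\<close> vanish.
\<close>

lemma integral_partial_derivative_eq_0:
  fixes F :: "real^2 \<Rightarrow> real"
  assumes D: "\<And>x. GDERIV F x :> D x"
    and cont: "continuous_on UNIV (\<lambda>x. D x $ i)"
    and K: "compact K" "\<And>x. x \<notin> K \<Longrightarrow> F x = 0"
  shows "integrable lborel (\<lambda>x. D x $ i)" "(\<integral>x. D x $ i \<partial>lborel) = 0"
proof -
  define e :: "real^2" where "e = axis i 1"
  have De: "D x $ i = e \<bullet> D x" for x by (simp add: e_def inner_axis')
  obtain R where R: "\<And>x. x \<in> K \<Longrightarrow> norm x \<le> R"
    using compact_imp_bounded[OF K(1)] bounded_iff by blast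
  have F0: "F x = 0" if "norm x > R" for x using R K(2) that by force
  have contF: "continuous_on UNIV F"
    using D has_derivative_continuous unfolding gderiv_def
    by (blast intro: continuous_at_imp_continuous_on)
  have D0: "D x = 0" if "norm x > R" for x
  proof -
    have "open {x::real^2. norm x > R}" by (intro open_Collect_less continuous_intros)
    then have "\<forall>\<^sub>F y in nhds x. y \<in> {x. norm x > R}"
      using that by (intro eventually_nhds_in_open) auto
    then have "\<forall>\<^sub>F y in nhds x. F y = 0"
      by (rule eventually_mono) (use F0 in auto)
    then have "GDERIV F x :> 0" by (rule GDERIV_transfer[OF GDERIV_const])
    then show ?thesis using D grad_eqI by metis
  qed
  have intF: "integrable lborel F"
    by (rule integrable_compact_support[OF contF compact_cball[of 0 R]]) (auto intro: F0)
  show intD: "integrable lborel (\<lambda>x. D x $ i)"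
    by (rule integrable_compact_support[OF cont compact_cball[of 0 R]]) (auto simp: D0)
  have "bounded ((\<lambda>x. D x $ i) ` cball 0 R)"
    by (intro compact_imp_bounded compact_continuous_image continuous_on_subset[OF cont]) auto
  then obtain B where B: "\<And>x. x \<in> cball 0 R \<Longrightarrow> \<bar>D x $ i\<bar> \<le> B"
    unfolding bounded_iff real_norm_def by blast
  \<comment> \<open>If the ball is empty, \<open>B\<close> may be negative; the maximum makes the
    bound valid everywhere.\<close>
  define C where "C = max B 0"
  have C: "\<bar>D x $ i\<bar> \<le> C" for x
    using B[of x] D0[of x] unfolding C_def by (cases "norm x > R") (auto simp: le_max_iff_disj)
  define h where "h n = inverse (real (Suc n))" for n
  have h: "h n > 0" "h n \<le> 1" for n by (auto simp: h_def field_simps)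
  have h0: "h \<longlonglongrightarrow> 0" unfolding h_def by (rule LIMSEQ_inverse_real_of_nat)
  define s where "s n x = (F (h n *\<^sub>R e + x) - F x) / h n" for n x
  have line: "((\<lambda>t. F (t *\<^sub>R e + x)) has_real_derivative D (t *\<^sub>R e + x) $ i) (at t)" for t x
  proof -
    have "((\<lambda>t. F (t *\<^sub>R e + x)) has_derivative (\<lambda>k. (k *\<^sub>R e) \<bullet> D (t *\<^sub>R e + x))) (at t)"
      using D[of "t *\<^sub>R e + x", unfolded gderiv_def]
      by (rule has_derivative_compose[rotated]) (auto intro!: derivative_eq_intros)
    then show ?thesis unfolding has_field_derivative_def De by (simp add: mult.commute[of _ "e \<bullet> _"])
  qed
  have s_lim: "(\<lambda>n. s n x) \<longlonglongrightarrow> D x $ i" for x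
  proof -
    have "((\<lambda>k. (F (k *\<^sub>R e + x) - F x) / k) \<longlongrightarrow> D x $ i) (at 0)"
      using line[of x 0] by (simp add: DERIV_def)
    moreover have "filterlim h (at 0) sequentially"
      using h h0 by (auto simp: filterlim_at intro!: eventuallyI) (metis less_irrefl)
    ultimately show ?thesis unfolding s_def by (rule filterlim_compose)
  qed
  \<comment> \<open>Inside the larger ball the mean value theorem bounds the quotient. Outside it
    both points lie off the support, because the step length \<open>h n\<close> is at most
    1.\<close>
  have s_bd: "norm (s n x) \<le> C * indicator (cball 0 (R + norm e)) x" for n x
  proof (cases "x \<in> cball 0 (R + norm e)")
    case True
    obtain z where z: "F (h n *\<^sub>R e + x) - F (0 *\<^sub>R e + x) = (h n - 0) * (D (z *\<^sub>R e + x) $ i)"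
      using MVT2[OF h(1)[of n], of "\<lambda>t. F (t *\<^sub>R e + x)" "\<lambda>t. D (t *\<^sub>R e + x) $ i"] line by blast
    then have "s n x = D (z *\<^sub>R e + x) $ i" using h(1)[of n] by (simp add: s_def)
    then show ?thesis using True C by simp
  next
    case False
    have "norm (h n *\<^sub>R e) \<le> norm e" using h[of n] by (simp add: mult_left_le_one_le)
    moreover have "norm x - norm (h n *\<^sub>R e) \<le> norm (h n *\<^sub>R e + x)"
      by (metis add.commute add_diff_cancel_right' diff_le_eq norm_triangle_ineq2 norm_triangle_sub norm_diff_ineq)
    ultimately have "norm (h n *\<^sub>R e + x) > R" "norm x > R"
      using False norm_ge_zero[of e] by (auto simp: not_le simp del: norm_scaleR norm_ge_zero)
    then show ?thesis using F0 False by (simp add: s_def)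
  qed
  have "(\<lambda>n. \<integral>x. s n x \<partial>lborel) \<longlonglongrightarrow> (\<integral>x. D x $ i \<partial>lborel)"
  proof (rule integral_dominated_convergence[where w = "\<lambda>x. C * indicator (cball 0 (R + norm e)) x"])
    show "integrable lborel (\<lambda>x. C * indicator (cball 0 (R + norm e)) x :: real)"
      by (intro integrable_mult_right integrable_real_indicator) (use emeasure_bounded_finite[OF bounded_cball] in auto)
    show "s n \<in> borel_measurable lborel" for n
      unfolding s_def using borel_measurable_continuous_onI[OF contF] by measurable
  qed (use s_lim s_bd borel_measurable_integrable[OF intD] in auto)
  moreover have "(\<integral>x. s n x \<partial>lborel) = 0" for n
  proof -
    have m: "F \<in> borel_measurable borel" using contF by (rule borel_measurable_continuous_onI)
    have "integrable lborel (\<lambda>x. F (h n *\<^sub>R e + x))"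
      using intF integrable_distr_eq[of "(+) (h n *\<^sub>R e)" lborel borel F] m
      by (simp add: lborel_distr_plus)
    then show ?thesis
      using intF lborel_integral_translation[OF m] by (simp add: s_def)
  qed
  ultimately show "(\<integral>x. D x $ i \<partial>lborel) = 0" by (simp add: LIMSEQ_const_iff)
qed

section \<open>Limits of pairings and norms under L2 convergence\<close>

lemma L2_inner_integrable:
  fixes h f :: "'a \<Rightarrow> 'b::euclidean_space"
  assumes [measurable]: "h \<in> borel_measurable M" "f \<in> borel_measurable M"
    and "integrable M (\<lambda>x. (norm (h x))\<^sup>2)" "integrable M (\<lambda>x. (norm (f x))\<^sup>2)"
  shows "integrable M (\<lambda>x. h x \<bullet> f x)"
proof (rule Bochner_Integration.integrable_bound)
  show "integrable M (\<lambda>x. (norm (h x))\<^sup>2 + (norm (f x))\<^sup>2)" using assms by auto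
  show "AE x in M. norm (h x \<bullet> f x) \<le> norm ((norm (h x))\<^sup>2 + (norm (f x))\<^sup>2)"
  proof (rule AE_I2)
    fix x
    have "\<bar>h x \<bullet> f x\<bar> \<le> norm (h x) * norm (f x)" by (rule Cauchy_Schwarz_ineq2)
    also have "\<dots> \<le> (norm (h x))\<^sup>2 + (norm (f x))\<^sup>2"
      using sum_squares_bound[of "norm (h x)" "norm (f x)"] mult_nonneg_nonneg[of "norm (h x)" "norm (f x)"]
      unfolding mult.assoc by (simp del: mult_nonneg_nonneg)
    finally show "norm (h x \<bullet> f x) \<le> norm ((norm (h x))\<^sup>2 + (norm (f x))\<^sup>2)" by simp
  qed
qed measurable

lemma L2_diff_integrable:
  fixes h f :: "'a \<Rightarrow> 'b::euclidean_space"
  assumes [measurable]: "h \<in> borel_measurable M" "f \<in> borel_measurable M"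
    and "integrable M (\<lambda>x. (norm (h x))\<^sup>2)" "integrable M (\<lambda>x. (norm (f x))\<^sup>2)"
  shows "integrable M (\<lambda>x. (norm (h x - f x))\<^sup>2)"
proof -
  have "(norm (h x - f x))\<^sup>2 = (norm (h x))\<^sup>2 + (norm (f x))\<^sup>2 - 2 * (h x \<bullet> f x)" for x
    by (simp add: power2_norm_eq_inner inner_diff inner_commute)
  then show ?thesis using L2_inner_integrable[OF assms] assms by simp
qed

text \<open>Cauchy-Schwarz for integrals in the form with a free parameter: 2ab \<le> r a^2 + b^2/r
  pointwise, so only integrals of squares occur and r is optimised at the end.\<close>

lemma L2_inner_tendsto:
  fixes h f :: "'a \<Rightarrow> 'b::euclidean_space"
  assumes [measurable]: "h \<in> borel_measurable M" "f \<in> borel_measurable M"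
    "\<And>n. F n \<in> borel_measurable M"
    and int: "integrable M (\<lambda>x. (norm (h x))\<^sup>2)" "integrable M (\<lambda>x. (norm (f x))\<^sup>2)"
    "\<And>n. integrable M (\<lambda>x. (norm (F n x))\<^sup>2)"
    and lim: "(\<lambda>n. \<integral>x. (norm (F n x - f x))\<^sup>2 \<partial>M) \<longlonglongrightarrow> 0"
  shows "(\<lambda>n. \<integral>x. h x \<bullet> F n x \<partial>M) \<longlonglongrightarrow> (\<integral>x. h x \<bullet> f x \<partial>M)"
proof -
  define A where "A = (\<integral>x. (norm (h x))\<^sup>2 \<partial>M)"
  define e where "e n = (\<integral>x. (norm (F n x - f x))\<^sup>2 \<partial>M)" for n
  have "A \<ge> 0" by (simp add: A_def)
  have intd: "integrable M (\<lambda>x. (norm (F n x - f x))\<^sup>2)" for n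
    by (rule L2_diff_integrable) (use int in auto)
  have bound: "\<bar>(\<integral>x. h x \<bullet> F n x \<partial>M) - (\<integral>x. h x \<bullet> f x \<partial>M)\<bar> \<le> r * A + e n / r" if "r > 0" for n r
  proof -
    have "(\<integral>x. h x \<bullet> F n x \<partial>M) - (\<integral>x. h x \<bullet> f x \<partial>M) = (\<integral>x. h x \<bullet> (F n x - f x) \<partial>M)"
      using L2_inner_integrable[of h M "F n"] L2_inner_integrable[of h M f] int by (simp add: inner_diff_right)
    also have "\<bar>\<dots>\<bar> \<le> (\<integral>x. r * (norm (h x))\<^sup>2 + (norm (F n x - f x))\<^sup>2 / r \<partial>M)"
    proof (rule integral_abs_bound[THEN order_trans], rule integral_mono)
      show "integrable M (\<lambda>x. \<bar>h x \<bullet> (F n x - f x)\<bar>)"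
        using L2_inner_integrable[of h M "\<lambda>x. F n x - f x"] int intd by auto
      show "integrable M (\<lambda>x. r * (norm (h x))\<^sup>2 + (norm (F n x - f x))\<^sup>2 / r)"
        using int intd by auto
      fix x
      define a b where "a = norm (h x)" and "b = norm (F n x - f x)"
      have "a \<ge> 0" "b \<ge> 0" by (auto simp: a_def b_def)
      have "\<bar>h x \<bullet> (F n x - f x)\<bar> \<le> a * b" unfolding a_def b_def by (rule Cauchy_Schwarz_ineq2)
      also have "\<dots> \<le> 2 * (a * b)" using \<open>a \<ge> 0\<close> \<open>b \<ge> 0\<close> by simp
      also have "\<dots> \<le> r * a\<^sup>2 + b\<^sup>2 / r"
      proof -
        have "0 \<le> (r * a - b)\<^sup>2 / r" using that by simp
        also have "\<dots> = r * a\<^sup>2 + b\<^sup>2 / r - 2 * (a * b)"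
          using that by (simp add: field_simps power2_eq_square)
        finally show ?thesis by simp
      qed
      finally show "\<bar>h x \<bullet> (F n x - f x)\<bar> \<le> r * (norm (h x))\<^sup>2 + (norm (F n x - f x))\<^sup>2 / r"
        by (simp add: a_def b_def)
    qed
    also have "\<dots> = r * A + e n / r" using int intd by (simp add: A_def e_def)
    finally show ?thesis .
  qed
  show ?thesis
  proof (rule LIMSEQ_I)
    fix \<epsilon> :: real assume "\<epsilon> > 0"
    \<comment> \<open>As soon as e n < r^2, the bound r A + e n / r is at most r (A + 1), which this
      choice makes equal to half of \<epsilon>.\<close>
    define r where "r = \<epsilon> / (2 * (A + 1))"
    have "r > 0" using \<open>\<epsilon> > 0\<close> \<open>A \<ge> 0\<close> by (simp add: r_def)
    have "\<forall>\<^sub>F n in sequentially. e n < r\<^sup>2"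
      using order_tendstoD(2)[OF lim] \<open>r > 0\<close> by (simp add: e_def)
    then obtain n0 where "\<And>n. n \<ge> n0 \<Longrightarrow> e n < r\<^sup>2" unfolding eventually_sequentially by blast
    then have "norm ((\<integral>x. h x \<bullet> F n x \<partial>M) - (\<integral>x. h x \<bullet> f x \<partial>M)) < \<epsilon>" if "n \<ge> n0" for n
    proof -
      have "e n / r \<le> r" using \<open>\<And>n. n \<ge> n0 \<Longrightarrow> e n < r\<^sup>2\<close>[OF that] \<open>r > 0\<close>
        by (simp add: field_simps power2_eq_square)
      then have "r * A + e n / r \<le> r * (A + 1)" by (simp add: algebra_simps)
      also have "\<dots> < \<epsilon>" using \<open>\<epsilon> > 0\<close> \<open>A \<ge> 0\<close> by (simp add: r_def field_simps add_pos_nonneg)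
      finally show ?thesis using bound[OF \<open>r > 0\<close>, of n] by simp
    qed
    then show "\<exists>no. \<forall>n\<ge>no. norm ((\<integral>x. h x \<bullet> F n x \<partial>M) - (\<integral>x. h x \<bullet> f x \<partial>M)) < \<epsilon>" by blast
  qed
qed

text \<open>Expanding the square gives |F|^2 = 2 f . F - |f|^2 + |F - f|^2, which reduces the claim
  to convergence of the pairing with f.\<close>

lemma L2_norm_tendsto:
  fixes f :: "'a \<Rightarrow> 'b::euclidean_space"
  assumes [measurable]: "f \<in> borel_measurable M" "\<And>n. F n \<in> borel_measurable M"
    and int: "integrable M (\<lambda>x. (norm (f x))\<^sup>2)" "\<And>n. integrable M (\<lambda>x. (norm (F n x))\<^sup>2)"
    and lim: "(\<lambda>n. \<integral>x. (norm (F n x - f x))\<^sup>2 \<partial>M) \<longlonglongrightarrow> 0"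
  shows "(\<lambda>n. \<integral>x. (norm (F n x))\<^sup>2 \<partial>M) \<longlonglongrightarrow> (\<integral>x. (norm (f x))\<^sup>2 \<partial>M)"
proof -
  have eq: "(\<integral>x. (norm (F n x))\<^sup>2 \<partial>M) =
      2 * (\<integral>x. f x \<bullet> F n x \<partial>M) - (\<integral>x. (norm (f x))\<^sup>2 \<partial>M) + (\<integral>x. (norm (F n x - f x))\<^sup>2 \<partial>M)" for n
  proof -
    have *: "(norm (F n x))\<^sup>2 = 2 * (f x \<bullet> F n x) - (norm (f x))\<^sup>2 + (norm (F n x - f x))\<^sup>2" for x
      by (simp add: power2_norm_eq_inner inner_diff inner_commute)
    have "integrable M (\<lambda>x. f x \<bullet> F n x)" "integrable M (\<lambda>x. (norm (F n x - f x))\<^sup>2)"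
      by (auto intro!: L2_inner_integrable L2_diff_integrable int)
    then show ?thesis unfolding * using int(1) by simp
  qed
  have "(\<lambda>n. \<integral>x. (norm (F n x))\<^sup>2 \<partial>M) \<longlonglongrightarrow>
      2 * (\<integral>x. f x \<bullet> f x \<partial>M) - (\<integral>x. (norm (f x))\<^sup>2 \<partial>M) + 0"
    unfolding eq by (intro tendsto_intros L2_inner_tendsto lim) (use int in auto)
  then show ?thesis by (simp add: power2_norm_eq_inner)
qed

lemma C_k_grad_continuous:
  assumes "C_k (Suc k) f"
  shows "continuous_on S (grad f)"
proof -
  have "continuous_on S (\<lambda>x. \<chi> i. grad f x $ i)"
    by (rule continuous_on_vec_lambda) (rule C_k_continuous[OF C_k_SucD(2)[OF assms]])
  then show ?thesis by simp
qed

lemma grad_eq_0_outside: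
  assumes "closed K" "\<And>x. x \<notin> K \<Longrightarrow> f x = 0" "x \<notin> K"
  shows "grad f x = 0"
proof -
  have "\<forall>\<^sub>F y in nhds x. y \<in> - K"
    using assms by (intro eventually_nhds_in_open) auto
  then have "\<forall>\<^sub>F y in nhds x. f y = 0"
    by (rule eventually_mono) (use assms in auto)
  then show ?thesis by (intro grad_eqI GDERIV_transfer[OF GDERIV_const])
qed

lemma test_functionD:
  assumes "test_function \<Omega> \<phi>"
  obtains K where "compact K" "K \<subseteq> \<Omega>" "\<And>x. x \<notin> K \<Longrightarrow> \<phi> x = 0" "\<And>x. x \<notin> K \<Longrightarrow> grad \<phi> x = 0"
proof -
  let ?K = "closure {x. \<phi> x \<noteq> 0}"
  have K: "compact ?K" "?K \<subseteq> \<Omega>" "\<And>x. x \<notin> ?K \<Longrightarrow> \<phi> x = 0"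
    using assms closure_subset[of "{x. \<phi> x \<noteq> 0}"] unfolding test_function_def by auto
  have "grad \<phi> x = 0" if "x \<notin> ?K" for x
    by (rule grad_eq_0_outside[OF compact_imp_closed[OF K(1)] K(3) that])
  with K show thesis by (rule that)
qed

lemma test_function_C_k: "test_function \<Omega> \<phi> \<Longrightarrow> C_k k \<phi>"
  by (simp add: test_function_def)

text \<open>The divergence of f grad u is f times the Laplacian of u plus grad u . grad f, and each
  f times a partial derivative of u is a compactly supported C^1 function, whose partial derivatives
  integrate to zero. Asking only C^1 of \<open>f\<close>, with gradient \<open>Df\<close>, lets the
  identity serve both for test functions and for Picone's quotient.\<close>

lemma lborel_weak_identity:
  fixes u :: "real^2 \<Rightarrow> real"
  assumes u: "C_k 2 u"
    and pde: "\<And>x. x \<in> \<Omega> \<Longrightarrow> (\<Sum>i\<in>UNIV. grad (\<lambda>y. grad u y $ i) x $ i) = - \<mu> * u x"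
    and f: "\<And>x. GDERIV f x :> Df x" "\<And>i. continuous_on UNIV (\<lambda>x. Df x $ i)"
    and K: "compact K" "K \<subseteq> \<Omega>" "\<And>x. x \<notin> K \<Longrightarrow> f x = 0"
  shows "integrable lborel (\<lambda>x. grad u x \<bullet> Df x)"
    "(\<integral>x. grad u x \<bullet> Df x \<partial>lborel) = \<mu> * (\<integral>x. u x * f x \<partial>lborel)"
proof -
  have u: "C_k (Suc (Suc 0)) u" using u by (simp add: numeral_2_eq_2)
  note u1 = C_k_SucD(2)[OF u] and u2 = C_k_SucD(2)[OF C_k_SucD(2)[OF u]]
  have contf: "continuous_on UNIV f"
    using f(1) has_derivative_continuous unfolding gderiv_def
    by (blast intro: continuous_at_imp_continuous_on)
  define V where "V i x = f x *\<^sub>R grad (\<lambda>y. grad u y $ i) x + grad u x $ i *\<^sub>R Df x" for i x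
  have V: "GDERIV (\<lambda>x. f x * grad u x $ i) x :> V i x" for i x
    unfolding V_def by (rule GDERIV_mult[OF f(1) C_k_SucD(1)[OF u1]])
  have Vi: "V i x $ i = f x * grad (\<lambda>y. grad u y $ i) x $ i + grad u x $ i * Df x $ i" for i x
    by (simp add: V_def)
  have cont: "continuous_on UNIV (\<lambda>x. V i x $ i)" for i
    unfolding Vi by (intro continuous_intros contf f(2) C_k_continuous[OF u1] C_k_continuous[OF u2])
  have int: "integrable lborel (\<lambda>x. V i x $ i)" "(\<integral>x. V i x $ i \<partial>lborel) = 0" for i
    using integral_partial_derivative_eq_0[OF V cont K(1)] K(3) by auto
  have int_uf: "integrable lborel (\<lambda>x. u x * f x)"
    by (rule integrable_compact_support[OF _ K(1)])
      (auto intro!: continuous_intros contf C_k_continuous[OF u] simp: K(3))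
  have eq: "grad u x \<bullet> Df x = (\<Sum>i\<in>UNIV. V i x $ i) + \<mu> * (u x * f x)" for x
  proof -
    have "f x * (\<Sum>i\<in>UNIV. grad (\<lambda>y. grad u y $ i) x $ i) = - \<mu> * (u x * f x)"
      proof (cases "x \<in> K")
      case True
      then show ?thesis using pde[of x] K(2) by auto
    qed (simp add: K(3))
    then show ?thesis
      unfolding Vi by (simp add: inner_vec_def sum.distrib sum_distrib_left)
  qed
  show "integrable lborel (\<lambda>x. grad u x \<bullet> Df x)"
    unfolding eq using int(1) int_uf by auto
  show "(\<integral>x. grad u x \<bullet> Df x \<partial>lborel) = \<mu> * (\<integral>x. u x * f x \<partial>lborel)"
    unfolding eq using int int_uf by simp
qed

text \<open>
  Picone's argument: the weak equation is tested with \<open>\<phi>\<^sup>2 / u\<close>.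
\<close>

lemma positive_solution_Poincare:
  fixes u :: "real^2 \<Rightarrow> real"
  assumes "open \<Omega>" and u: "C_k 2 u"
    and pos: "\<And>x. x \<in> \<Omega> \<Longrightarrow> u x > 0"
    and pde: "\<And>x. x \<in> \<Omega> \<Longrightarrow> (\<Sum>i\<in>UNIV. grad (\<lambda>y. grad u y $ i) x $ i) = - \<mu> * u x"
    and \<phi>: "test_function \<Omega> \<phi>"
  shows "\<mu> * (\<integral>x. (\<phi> x)\<^sup>2 \<partial>lborel) \<le> (\<integral>x. (norm (grad \<phi> x))\<^sup>2 \<partial>lborel)"
proof -
  obtain K where K: "compact K" "K \<subseteq> \<Omega>" "\<And>x. x \<notin> K \<Longrightarrow> \<phi> x = 0" "\<And>x. x \<notin> K \<Longrightarrow> grad \<phi> x = 0"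
    using test_functionD[OF \<phi>] by blast
  have u1: "C_k (Suc 0) u" using u by (auto simp: numeral_2_eq_2 intro!: C_k_Suc_imp simp del: C_k.simps)
  have \<phi>1: "C_k (Suc 0) \<phi>" using \<phi> by (rule test_function_C_k)
  have cont: "isCont u x" "isCont \<phi> x" "isCont (grad u) x" "isCont (grad \<phi>) x" for x
    using C_k_continuous[OF u1] C_k_continuous[OF \<phi>1] C_k_grad_continuous[OF u1] C_k_grad_continuous[OF \<phi>1]
    by (meson UNIV_I continuous_on_eq_continuous_at open_UNIV)+
  have off: "\<forall>\<^sub>F y in nhds x. y \<notin> K" if "x \<notin> K" for x
    using eventually_nhds_in_open[of "- K" x] that K(1) by (auto dest: compact_imp_closed)
  \<comment> \<open>Outside \<open>K\<close> the numerator is 0, so w is 0 there whatever the value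
    or sign of \<open>u\<close>; inside \<open>K\<close> the denominator is positive.\<close>
  define w where "w x = \<phi> x / u x" for x
  define f where "f x = w x * \<phi> x" for x
  define Df where "Df x = (2 * w x) *\<^sub>R grad \<phi> x - (w x)\<^sup>2 *\<^sub>R grad u x" for x
  have f: "GDERIV f x :> Df x" for x
  proof (cases "x \<in> \<Omega>")
    case True
    then have "u x \<noteq> 0" using pos[of x] by simp
    have inv: "GDERIV (\<lambda>x. inverse (u x)) x :> (- (inverse (u x))\<^sup>2) *\<^sub>R grad u x"
      by (rule GDERIV_inverse[OF C_k_SucD(1)[OF u1] \<open>u x \<noteq> 0\<close>])
    have G: "GDERIV (\<lambda>x. inverse (u x) * (\<phi> x * \<phi> x)) x :>
       inverse (u x) *\<^sub>R (\<phi> x *\<^sub>R grad \<phi> x + \<phi> x *\<^sub>R grad \<phi> x)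
        + (\<phi> x * \<phi> x) *\<^sub>R ((- (inverse (u x))\<^sup>2) *\<^sub>R grad u x)"
      by (intro GDERIV_mult inv C_k_SucD(1)[OF \<phi>1])
    have e1: "(\<lambda>x. inverse (u x) * (\<phi> x * \<phi> x)) = f"
      by (simp add: fun_eq_iff f_def w_def divide_inverse)
    have e2: "inverse (u x) *\<^sub>R (\<phi> x *\<^sub>R grad \<phi> x + \<phi> x *\<^sub>R grad \<phi> x)
        + (\<phi> x * \<phi> x) *\<^sub>R ((- (inverse (u x))\<^sup>2) *\<^sub>R grad u x) = Df x"
      by (simp add: vec_eq_iff w_def Df_def divide_inverse power2_eq_square algebra_simps)
    show ?thesis using G unfolding e1 e2 .
  next
    case False
    then have "x \<notin> K" using K(2) by blast
    from off[OF this] have "\<forall>\<^sub>F y in nhds x. f y = 0"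
      by (rule eventually_mono) (simp add: f_def K(3))
    moreover have "Df x = 0" using \<open>x \<notin> K\<close> K(3,4) by (simp add: Df_def w_def)
    ultimately show ?thesis using GDERIV_transfer[OF GDERIV_const] by metis
  qed
  have contDf: "isCont Df x" for x
  proof (cases "x \<in> \<Omega>")
    case True
    then have "u x \<noteq> 0" using pos[of x] by simp
    then show ?thesis unfolding Df_def w_def by (intro continuous_intros cont) auto
  next
    case False
    then have "x \<notin> K" using K(2) by blast
    from off[OF this] have "\<forall>\<^sub>F y in nhds x. Df y = 0"
      by (rule eventually_mono) (simp add: Df_def w_def K(3,4))
    then show ?thesis using isCont_cong[of Df "\<lambda>_. 0"] by simp
  qed
  have contDfi: "continuous_on UNIV (\<lambda>x. Df x $ i)" for i
    using contDf by (intro continuous_intros) (simp add: continuous_at_imp_continuous_on)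
  have f0: "f x = 0" if "x \<notin> K" for x using that K by (simp add: f_def)
  note weak = lborel_weak_identity[OF u pde f contDfi K(1,2) f0]
  have "u x * f x = (\<phi> x)\<^sup>2" for x
    using pos[of x] K(2) K(3)[of x] by (cases "x \<in> K") (auto simp: f_def w_def power2_eq_square)
  then have "\<mu> * (\<integral>x. (\<phi> x)\<^sup>2 \<partial>lborel) = (\<integral>x. grad u x \<bullet> Df x \<partial>lborel)"
    using weak(2) by simp
  also have "\<dots> \<le> (\<integral>x. (norm (grad \<phi> x))\<^sup>2 \<partial>lborel)"
  proof (rule integral_mono[OF weak(1)])
    show "integrable lborel (\<lambda>x. (norm (grad \<phi> x))\<^sup>2)"
      by (rule integrable_compact_support[OF _ K(1)])
        (auto intro!: continuous_intros C_k_grad_continuous[OF \<phi>1] simp: K(4))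
    fix x
    \<comment> \<open>Picone's identity: the deficit is a perfect square.\<close>
    have "(norm (grad \<phi> x))\<^sup>2 - grad u x \<bullet> Df x = (norm (grad \<phi> x - w x *\<^sub>R grad u x))\<^sup>2"
      unfolding Df_def power2_norm_eq_inner
      by (simp add: inner_diff_left inner_diff_right inner_commute algebra_simps power2_eq_square)
    then show "grad u x \<bullet> Df x \<le> (norm (grad \<phi> x))\<^sup>2"
      using zero_le_power2[of "norm (grad \<phi> x - w x *\<^sub>R grad u x)"] by linarith
  qed
  finally show ?thesis .
qed

section \<open>Positive solutions are first eigenfunctions\<close>

text \<open>Near a boundary point \<open>u\<close> stays below d, where the cutoff vanishes; this
  makes the extension by zero smooth. The restriction to \<open>\<Omega>\<close> is explicit because
  \<open>u\<close> may be positive elsewhere in the plane.\<close>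

lemma cutoff_test_function:
  fixes u :: "real^2 \<Rightarrow> real"
  assumes "open \<Omega>" "bounded \<Omega>" and u: "\<And>k. C_k k u"
    and bdry: "\<And>x. x \<in> frontier \<Omega> \<Longrightarrow> u x = 0" and "d > 0"
  defines "\<phi> \<equiv> (\<lambda>x. if x \<in> \<Omega> then cutoff d (u x) else 0)"
  shows "test_function \<Omega> \<phi>" "\<And>x. x \<in> \<Omega> \<Longrightarrow> grad \<phi> x = cutoff' d (u x) *\<^sub>R grad u x"
proof -
  have fr: "x \<in> frontier \<Omega>" if "x \<in> closure \<Omega>" "x \<notin> \<Omega>" for x
    using that assms(1) by (simp add: frontier_def interior_open)
  have inside: "\<forall>\<^sub>F y in nhds x. \<phi> y = cutoff d (u y)" if "x \<in> \<Omega>" for x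
    using eventually_nhds_in_open[OF assms(1) that] by (rule eventually_mono) (simp add: \<phi>_def)
  have outside: "\<forall>\<^sub>F y in nhds x. \<phi> y = 0" if "x \<notin> \<Omega>" for x
  proof (cases "x \<in> closure \<Omega>")
    case True
    have "isCont u x" using C_k_continuous[OF u[of 0], of UNIV] by (simp add: continuous_on_eq_continuous_at)
    moreover have "u x < d" using bdry[OF fr[OF True that]] \<open>d > 0\<close> by simp
    ultimately have "\<forall>\<^sub>F y in nhds x. u y < d"
      unfolding isCont_def tendsto_at_iff_tendsto_nhds by (rule order_tendstoD(2))
    then show ?thesis
      by (rule eventually_mono) (use cutoff_eq_0 \<open>d > 0\<close> in \<open>auto simp: \<phi>_def\<close>)
  next
    case False
    then have "\<forall>\<^sub>F y in nhds x. y \<in> - closure \<Omega>"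
      by (intro eventually_nhds_in_open) auto
    then show ?thesis
      by (rule eventually_mono) (use closure_subset in \<open>auto simp: \<phi>_def\<close>)
  qed
  have C: "C_k k \<phi>" for k
  proof (rule C_k_local)
    fix x
    show "\<exists>g. C_k k g \<and> (\<forall>\<^sub>F y in nhds x. \<phi> y = g y)"
      using inside[of x] outside[of x] C_k_cutoff[OF u[of k], of d] C_k_const[of k 0]
      by (cases "x \<in> \<Omega>") blast+
  qed
  \<comment> \<open>Since \<open>u\<close> is 0 on the frontier, the part of the closure where
    \<open>u\<close> is at least d > 0 is a compact subset of the open set.\<close>
  define S where "S = closure \<Omega> \<inter> {x. d \<le> u x}"
  have "closed S" unfolding S_def
    by (intro closed_Int closed_closure closed_Collect_le continuous_on_const C_k_continuous[OF u[of 0]])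
  moreover have "bounded S" unfolding S_def using assms(2) by (intro bounded_Int) (simp add: bounded_closure)
  ultimately have "compact S" by (simp add: compact_eq_bounded_closed)
  have "{x. \<phi> x \<noteq> 0} \<subseteq> S"
  proof
    fix x assume "x \<in> {x. \<phi> x \<noteq> 0}"
    then have "x \<in> \<Omega>" "cutoff d (u x) \<noteq> 0" by (auto simp: \<phi>_def split: if_splits)
    then show "x \<in> S"
      using cutoff_eq_0[OF \<open>d > 0\<close>, of "u x"] closure_subset[of \<Omega>] by (cases "u x \<le> d") (auto simp: S_def)
  qed
  then have "closure {x. \<phi> x \<noteq> 0} \<subseteq> S" using \<open>closed S\<close> by (rule closure_minimal)
  moreover from this have "compact (closure {x. \<phi> x \<noteq> 0})"
    using \<open>compact S\<close> compact_closure bounded_subset[OF compact_imp_bounded] closure_subset by blast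
  moreover have "S \<subseteq> \<Omega>"
  proof
    fix x assume "x \<in> S"
    then show "x \<in> \<Omega>" using fr[of x] bdry[of x] \<open>d > 0\<close> by (auto simp: S_def)
  qed
  ultimately show "test_function \<Omega> \<phi>" using C unfolding test_function_def by auto
  fix x assume "x \<in> \<Omega>"
  have "GDERIV (\<lambda>y. cutoff d (u y)) x :> cutoff' d (u x) *\<^sub>R grad u x"
    by (rule GDERIV_DERIV_compose[OF C_k_SucD(1)[OF u] cutoff_deriv[OF \<open>d > 0\<close>]])
  then show "grad \<phi> x = cutoff' d (u x) *\<^sub>R grad u x"
    using GDERIV_transfer[OF _ inside[OF \<open>x \<in> \<Omega>\<close>]] grad_eqI by blast
qed

lemma norm_indicator_power2: "(norm (indicator A x *\<^sub>R f x))\<^sup>2 = indicator A x *\<^sub>R (norm (f x))\<^sup>2"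
  by (simp add: indicator_def)

lemma L2_onD:
  assumes "L2_on \<Omega> f"
  shows "(\<lambda>x. indicator \<Omega> x *\<^sub>R f x) \<in> borel_measurable lborel"
    "integrable lborel (\<lambda>x. (norm (indicator \<Omega> x *\<^sub>R f x))\<^sup>2)"
  using assms unfolding L2_on_def set_borel_measurable_def set_integrable_def norm_indicator_power2 by auto

lemma L2_on_continuous:
  fixes f :: "real^2 \<Rightarrow> 'b::euclidean_space"
  assumes "open \<Omega>" "bounded \<Omega>" "continuous_on UNIV f"
  shows "L2_on \<Omega> f"
proof -
  have m: "f \<in> borel_measurable borel" using assms(3) by (rule borel_measurable_continuous_onI)
  have "set_integrable lborel (closure \<Omega>) (\<lambda>x. (norm (f x))\<^sup>2)"
    unfolding set_integrable_def
    by (rule borel_integrable_compact) (use assms continuous_on_subset in \<open>auto intro!: continuous_intros\<close>)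
  then have "set_integrable lborel \<Omega> (\<lambda>x. (norm (f x))\<^sup>2)"
    by (rule set_integrable_subset) (use assms(1) closure_subset in auto)
  then show ?thesis
    unfolding L2_on_def set_borel_measurable_def using m assms(1) by auto
qed

lemma test_function_L2:
  assumes "test_function \<Omega> \<phi>"
  shows "(\<lambda>x. indicator \<Omega> x *\<^sub>R \<phi> x) = \<phi>" "(\<lambda>x. indicator \<Omega> x *\<^sub>R grad \<phi> x) = grad \<phi>"
    "\<phi> \<in> borel_measurable lborel" "grad \<phi> \<in> borel_measurable lborel"
    "integrable lborel (\<lambda>x. (norm (\<phi> x))\<^sup>2)" "integrable lborel (\<lambda>x. (norm (grad \<phi> x))\<^sup>2)"
proof -
  obtain K where K: "compact K" "K \<subseteq> \<Omega>" "\<And>x. x \<notin> K \<Longrightarrow> \<phi> x = 0" "\<And>x. x \<notin> K \<Longrightarrow> grad \<phi> x = 0"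
    using test_functionD[OF assms] by blast
  show "(\<lambda>x. indicator \<Omega> x *\<^sub>R \<phi> x) = \<phi>" "(\<lambda>x. indicator \<Omega> x *\<^sub>R grad \<phi> x) = grad \<phi>"
    using K by (auto simp: fun_eq_iff indicator_def)
  have c: "continuous_on UNIV \<phi>" "continuous_on UNIV (grad \<phi>)"
    using test_function_C_k[OF assms] C_k_continuous C_k_grad_continuous by blast+
  then show "\<phi> \<in> borel_measurable lborel" "grad \<phi> \<in> borel_measurable lborel"
    by (auto intro: borel_measurable_continuous_onI)
  show "integrable lborel (\<lambda>x. (norm (\<phi> x))\<^sup>2)" "integrable lborel (\<lambda>x. (norm (grad \<phi> x))\<^sup>2)"
    by (rule integrable_compact_support[OF _ K(1)]; use c K in \<open>auto intro!: continuous_intros\<close>)+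
qed

text \<open>The approximants are the cutoffs of \<open>u\<close> at level 1/(n+1). Dominated
  convergence applies because the errors of value and gradient are bounded by \<open>u\<close> and
  by the norm of \<open>grad u\<close>.\<close>

lemma positive_solution_H10:
  fixes u :: "real^2 \<Rightarrow> real"
  assumes \<Omega>: "open \<Omega>" "bounded \<Omega>" and u: "\<And>k. C_k k u"
    and pos: "\<And>x. x \<in> \<Omega> \<Longrightarrow> u x > 0"
    and bdry: "\<And>x. x \<in> frontier \<Omega> \<Longrightarrow> u x = 0"
  shows "H10_with_gradient \<Omega> u (grad u)"
proof -
  define d where "d n = inverse (real (Suc n))" for n
  define \<phi> where "\<phi> n x = (if x \<in> \<Omega> then cutoff (d n) (u x) else 0)" for n x
  have "d n > 0" for n by (simp add: d_def)
  then have test: "test_function \<Omega> (\<phi> n)"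
    and grad\<phi>: "\<And>x. x \<in> \<Omega> \<Longrightarrow> grad (\<phi> n) x = cutoff' (d n) (u x) *\<^sub>R grad u x" for n
    using cutoff_test_function[OF \<Omega> u bdry, of "d n"] unfolding \<phi>_def[abs_def] by auto
  have cont: "continuous_on UNIV u" "continuous_on UNIV (grad u)"
    using u C_k_continuous C_k_grad_continuous by blast+
  have L2: "L2_on \<Omega> u" "L2_on \<Omega> (grad u)" using L2_on_continuous[OF \<Omega>] cont by auto
  have [measurable]: "u \<in> borel_measurable borel" "grad u \<in> borel_measurable borel"
    "\<phi> n \<in> borel_measurable borel" "grad (\<phi> n) \<in> borel_measurable borel" "\<Omega> \<in> sets borel" for n
    using cont test_function_L2(3,4)[OF test] \<Omega> by (auto intro: borel_measurable_continuous_onI)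
  have "(\<lambda>n. \<integral>x. indicator \<Omega> x *\<^sub>R (\<phi> n x - u x)\<^sup>2 \<partial>lborel) \<longlonglongrightarrow> (\<integral>x. (0::real) \<partial>(lborel :: (real^2) measure))"
  proof (rule integral_dominated_convergence[where w = "\<lambda>x. indicator \<Omega> x *\<^sub>R (norm (u x))\<^sup>2"])
    show "integrable lborel (\<lambda>x. indicator \<Omega> x *\<^sub>R (norm (u x))\<^sup>2)"
      using L2(1) by (simp add: L2_on_def set_integrable_def)
    show "AE x in lborel. (\<lambda>n. indicator \<Omega> x *\<^sub>R (\<phi> n x - u x)\<^sup>2) \<longlonglongrightarrow> 0"
    proof (rule AE_I2)
      fix x
      show "(\<lambda>n. indicator \<Omega> x *\<^sub>R (\<phi> n x - u x)\<^sup>2) \<longlonglongrightarrow> 0"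
      proof (cases "x \<in> \<Omega>")
        case True
        have "(\<lambda>n. (cutoff (d n) (u x) - u x)\<^sup>2) \<longlonglongrightarrow> (u x - u x)\<^sup>2"
          unfolding d_def by (intro tendsto_intros cutoff_tendsto(1) pos True)
        then show ?thesis using True by (simp add: \<phi>_def)
      qed simp
    qed
    show "AE x in lborel. norm (indicator \<Omega> x *\<^sub>R (\<phi> n x - u x)\<^sup>2) \<le> indicator \<Omega> x *\<^sub>R (norm (u x))\<^sup>2" for n
    proof (rule AE_I2)
      fix x
      have "(\<phi> n x - u x)\<^sup>2 \<le> (u x)\<^sup>2" if "x \<in> \<Omega>"
        using cutoff_bounds[of "u x" "d n"] pos[OF that] that by (intro abs_le_square_iff[THEN iffD1]) (simp add: \<phi>_def)
      then show "norm (indicator \<Omega> x *\<^sub>R (\<phi> n x - u x)\<^sup>2) \<le> indicator \<Omega> x *\<^sub>R (norm (u x))\<^sup>2"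
        by (simp add: indicator_def)
    qed
  qed measurable
  then have lim1: "(\<lambda>n. LINT x:\<Omega>|lborel. (\<phi> n x - u x)\<^sup>2) \<longlonglongrightarrow> 0"
    unfolding set_lebesgue_integral_def by simp
  have "(\<lambda>n. \<integral>x. indicator \<Omega> x *\<^sub>R (norm (grad (\<phi> n) x - grad u x))\<^sup>2 \<partial>lborel) \<longlonglongrightarrow> (\<integral>x. (0::real) \<partial>(lborel :: (real^2) measure))"
  proof (rule integral_dominated_convergence[where w = "\<lambda>x. indicator \<Omega> x *\<^sub>R (norm (grad u x))\<^sup>2"])
    have eq: "(norm (grad (\<phi> n) x - grad u x))\<^sup>2 = (cutoff' (d n) (u x) - 1)\<^sup>2 * (norm (grad u x))\<^sup>2" if "x \<in> \<Omega>" for n x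
    proof -
      have "grad (\<phi> n) x - grad u x = (cutoff' (d n) (u x) - 1) *\<^sub>R grad u x"
        by (simp add: grad\<phi>[OF that] scaleR_left_diff_distrib)
      then show ?thesis by (simp add: power_mult_distrib)
    qed
    show "integrable lborel (\<lambda>x. indicator \<Omega> x *\<^sub>R (norm (grad u x))\<^sup>2)"
      using L2(2) by (simp add: L2_on_def set_integrable_def)
    show "AE x in lborel. (\<lambda>n. indicator \<Omega> x *\<^sub>R (norm (grad (\<phi> n) x - grad u x))\<^sup>2) \<longlonglongrightarrow> 0"
    proof (rule AE_I2)
      fix x
      show "(\<lambda>n. indicator \<Omega> x *\<^sub>R (norm (grad (\<phi> n) x - grad u x))\<^sup>2) \<longlonglongrightarrow> 0"
      proof (cases "x \<in> \<Omega>")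
        case True
        have "(\<lambda>n. (cutoff' (d n) (u x) - 1)\<^sup>2 * (norm (grad u x))\<^sup>2) \<longlonglongrightarrow> (1 - 1)\<^sup>2 * (norm (grad u x))\<^sup>2"
          unfolding d_def by (intro tendsto_intros cutoff_tendsto(2) pos True)
        then show ?thesis using True by (simp add: eq)
      qed simp
    qed
    show "AE x in lborel. norm (indicator \<Omega> x *\<^sub>R (norm (grad (\<phi> n) x - grad u x))\<^sup>2)
        \<le> indicator \<Omega> x *\<^sub>R (norm (grad u x))\<^sup>2" for n
    proof (rule AE_I2)
      fix x
      have "(cutoff' (d n) (u x) - 1)\<^sup>2 \<le> 1"
        using cutoff'_bounds[of "d n" "u x"] by (simp add: abs_square_le_1)
      then have "(norm (grad (\<phi> n) x - grad u x))\<^sup>2 \<le> (norm (grad u x))\<^sup>2" if "x \<in> \<Omega>"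
        unfolding eq[OF that] by (intro mult_left_le_one_le) auto
      then show "norm (indicator \<Omega> x *\<^sub>R (norm (grad (\<phi> n) x - grad u x))\<^sup>2)
        \<le> indicator \<Omega> x *\<^sub>R (norm (grad u x))\<^sup>2"
        by (simp add: indicator_def)
    qed
  qed measurable
  then have lim2: "(\<lambda>n. LINT x:\<Omega>|lborel. (norm (grad (\<phi> n) x - grad u x))\<^sup>2) \<longlonglongrightarrow> 0"
    unfolding set_lebesgue_integral_def by simp
  show ?thesis
    unfolding H10_with_gradient_def using L2 test lim1 lim2 by (intro conjI exI[of _ \<phi>]) auto
qed

text \<open>Testing the equation of \<open>v\<close> with the test functions that approximate
  \<open>v\<close> gives in the limit that the energy of \<open>v\<close> is \<nu> times its squared
  L2 norm. The Poincare inequality passes to the same limit, and the two are compared after division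
  by the nonzero norm.\<close>

lemma dirichlet_eigenvalue_ge:
  assumes Poincare: "\<And>\<phi>. test_function \<Omega> \<phi> \<Longrightarrow>
      \<mu> * (\<integral>x. (\<phi> x)\<^sup>2 \<partial>lborel) \<le> (\<integral>x. (norm (grad \<phi> x))\<^sup>2 \<partial>lborel)"
    and v: "dirichlet_eigenfunction \<Omega> \<nu> v"
  shows "\<mu> \<le> \<nu>"
proof -
  obtain g where H: "H10_with_gradient \<Omega> v g"
    and weak: "\<And>\<phi>. test_function \<Omega> \<phi> \<Longrightarrow>
           (LINT x:\<Omega>|lborel. g x \<bullet> grad \<phi> x) = \<nu> * (LINT x:\<Omega>|lborel. v x * \<phi> x)"
    and nz: "\<not> (AE x\<in>\<Omega> in lborel. v x = 0)"
    using v unfolding dirichlet_eigenfunction_def by blast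
  obtain \<phi> where test: "\<And>n. test_function \<Omega> (\<phi> n)"
    and lim: "(\<lambda>n. LINT x:\<Omega>|lborel. (\<phi> n x - v x)\<^sup>2) \<longlonglongrightarrow> 0"
      "(\<lambda>n. LINT x:\<Omega>|lborel. (norm (grad (\<phi> n) x - g x))\<^sup>2) \<longlonglongrightarrow> 0"
    and L2: "L2_on \<Omega> v" "L2_on \<Omega> g"
    using H unfolding H10_with_gradient_def by blast
  \<comment> \<open>Extending by zero turns integrals over the domain into integrals over the plane,
    where the L2 limit lemmas apply.\<close>
  define V where "V x = indicator \<Omega> x *\<^sub>R v x" for x
  define G where "G x = indicator \<Omega> x *\<^sub>R g x" for x
  note V = L2_onD[OF L2(1), folded V_def] and G = L2_onD[OF L2(2), folded G_def]
  note T = test_function_L2[OF test]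
  have T1: "indicator \<Omega> x *\<^sub>R \<phi> n x = \<phi> n x" "indicator \<Omega> x *\<^sub>R grad (\<phi> n) x = grad (\<phi> n) x" for n x
    using fun_cong[OF T(1)[of n], of x] fun_cong[OF T(2)[of n], of x] by auto
  have eq: "indicator \<Omega> x *\<^sub>R (\<phi> n x - v x)\<^sup>2 = (norm (\<phi> n x - V x))\<^sup>2"
    "indicator \<Omega> x *\<^sub>R (norm (grad (\<phi> n) x - g x))\<^sup>2 = (norm (grad (\<phi> n) x - G x))\<^sup>2"
    "indicator \<Omega> x *\<^sub>R (g x \<bullet> grad (\<phi> n) x) = G x \<bullet> grad (\<phi> n) x"
    "indicator \<Omega> x *\<^sub>R (v x * \<phi> n x) = V x \<bullet> \<phi> n x" for n x
    using T1[of x n] by (auto simp: V_def G_def indicator_def split: if_splits)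
  have lim1: "(\<lambda>n. \<integral>x. (norm (\<phi> n x - V x))\<^sup>2 \<partial>lborel) \<longlonglongrightarrow> 0"
    and lim2: "(\<lambda>n. \<integral>x. (norm (grad (\<phi> n) x - G x))\<^sup>2 \<partial>lborel) \<longlonglongrightarrow> 0"
    using lim unfolding set_lebesgue_integral_def eq by auto
  have weak': "(\<integral>x. G x \<bullet> grad (\<phi> n) x \<partial>lborel) = \<nu> * (\<integral>x. V x \<bullet> \<phi> n x \<partial>lborel)" for n
    using weak[OF test[of n]] unfolding set_lebesgue_integral_def eq .
  have "(\<lambda>n. \<integral>x. G x \<bullet> grad (\<phi> n) x \<partial>lborel) \<longlonglongrightarrow> (\<integral>x. G x \<bullet> G x \<partial>lborel)"
    using G T lim2 by (intro L2_inner_tendsto) auto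
  moreover have "(\<lambda>n. \<nu> * (\<integral>x. V x \<bullet> \<phi> n x \<partial>lborel)) \<longlonglongrightarrow> \<nu> * (\<integral>x. V x \<bullet> V x \<partial>lborel)"
    using V T lim1 by (intro tendsto_mult_left L2_inner_tendsto) auto
  ultimately have energy: "(\<integral>x. (norm (G x))\<^sup>2 \<partial>lborel) = \<nu> * (\<integral>x. (norm (V x))\<^sup>2 \<partial>lborel)"
    unfolding weak' power2_norm_eq_inner by (rule LIMSEQ_unique)
  have "(\<lambda>n. \<mu> * (\<integral>x. (norm (\<phi> n x))\<^sup>2 \<partial>lborel)) \<longlonglongrightarrow> \<mu> * (\<integral>x. (norm (V x))\<^sup>2 \<partial>lborel)"
    using V T lim1 by (intro tendsto_mult_left L2_norm_tendsto) auto
  moreover have "(\<lambda>n. \<integral>x. (norm (grad (\<phi> n) x))\<^sup>2 \<partial>lborel) \<longlonglongrightarrow> (\<integral>x. (norm (G x))\<^sup>2 \<partial>lborel)"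
    using G T lim2 by (intro L2_norm_tendsto) auto
  ultimately have le: "\<mu> * (\<integral>x. (norm (V x))\<^sup>2 \<partial>lborel) \<le> (\<integral>x. (norm (G x))\<^sup>2 \<partial>lborel)"
    by (rule LIMSEQ_le) (use Poincare[OF test] in simp)
  have "(\<integral>x. (norm (V x))\<^sup>2 \<partial>lborel) \<noteq> 0"
  proof
    assume "(\<integral>x. (norm (V x))\<^sup>2 \<partial>lborel) = 0"
    then have "AE x in lborel. (norm (V x))\<^sup>2 = 0"
      using integral_nonneg_eq_0_iff_AE[OF V(2)] by simp
    then have "AE x\<in>\<Omega> in lborel. v x = 0"
      by (rule AE_mp) (auto simp: V_def)
    then show False using nz by contradiction
  qed
  moreover have "(\<integral>x. (norm (V x))\<^sup>2 \<partial>lborel) \<ge> 0" by simp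
  ultimately have "(\<integral>x. (norm (V x))\<^sup>2 \<partial>lborel) > 0" by linarith
  with le[unfolded energy] show ?thesis by (rule mult_right_le_imp_le)
qed

text \<open>Positivity yields the Poincare inequality with constant \<mu>, hence \<mu> bounds every
  eigenvalue from below; \<open>u\<close> itself shows that this bound is attained.\<close>

theorem positive_solution_is_first_eigenfunction:
  fixes u :: "real^2 \<Rightarrow> real"
  assumes \<Omega>: "open \<Omega>" "bounded \<Omega>" "\<Omega> \<noteq> {}" and u: "\<And>k. C_k k u"
    and pos: "\<And>x. x \<in> \<Omega> \<Longrightarrow> u x > 0"
    and bdry: "\<And>x. x \<in> frontier \<Omega> \<Longrightarrow> u x = 0"
    and pde: "\<And>x. x \<in> \<Omega> \<Longrightarrow> (\<Sum>i\<in>UNIV. grad (\<lambda>y. grad u y $ i) x $ i) = - \<mu> * u x"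
  shows "first_dirichlet_eigenfunction \<Omega> u"
proof -
  have "\<not> (AE x\<in>\<Omega> in lborel. u x = 0)"
  proof
    assume "AE x\<in>\<Omega> in lborel. u x = 0"
    then have "AE x in lborel. x \<notin> \<Omega>" by (rule AE_mp) (use pos in force)
    then have "\<Omega> \<in> null_sets lborel" using \<Omega>(1) by (simp add: AE_iff_null_sets)
    then show False
      using open_not_negligible[OF \<Omega>(1,3)] by (simp add: negligible_iff_null_sets null_sets_completionI)
  qed
  moreover have "(LINT x:\<Omega>|lborel. grad u x \<bullet> grad \<phi> x) = \<mu> * (LINT x:\<Omega>|lborel. u x * \<phi> x)"
    if \<phi>: "test_function \<Omega> \<phi>" for \<phi>
  proof -
    obtain K where K: "compact K" "K \<subseteq> \<Omega>" "\<And>x. x \<notin> K \<Longrightarrow> \<phi> x = 0" "\<And>x. x \<notin> K \<Longrightarrow> grad \<phi> x = 0"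
      using test_functionD[OF \<phi>] by blast
    note \<phi>1 = test_function_C_k[OF \<phi>, of "Suc 0"]
    have e: "indicator \<Omega> x *\<^sub>R (grad u x \<bullet> grad \<phi> x) = grad u x \<bullet> grad \<phi> x"
      "indicator \<Omega> x *\<^sub>R (u x * \<phi> x) = u x * \<phi> x" for x
      using fun_cong[OF test_function_L2(1)[OF \<phi>], of x] fun_cong[OF test_function_L2(2)[OF \<phi>], of x]
      by (auto simp: indicator_def split: if_splits)
    show ?thesis
      unfolding set_lebesgue_integral_def e
      using lborel_weak_identity(2)[OF u pde C_k_SucD(1)[OF \<phi>1] C_k_continuous[OF C_k_SucD(2)[OF \<phi>1]] K(1-3)] by simp
  qed
  ultimately have "dirichlet_eigenfunction \<Omega> \<mu> u"
    using positive_solution_H10[OF \<Omega>(1,2) u pos bdry] unfolding dirichlet_eigenfunction_def by blast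
  moreover have "\<mu> \<le> \<nu>" if "dirichlet_eigenfunction \<Omega> \<nu> v" for \<nu> v
    using dirichlet_eigenvalue_ge[OF positive_solution_Poincare[OF \<Omega>(1) u pos pde] that] by simp
  ultimately show ?thesis unfolding first_dirichlet_eigenfunction_def by blast
qed

section \<open>Bessel series\<close>

text \<open>\<open>s\<^sup>N\<^sup>/\<^sup>2\<close> times this function is \<open>J\<^sub>N(2 \<surd>s)\<close>; the normalisation makes it entire in \<open>s\<close>.\<close>

definition bessel :: "nat \<Rightarrow> real \<Rightarrow> real" where
  "bessel N s = (\<Sum>k. (- 1) ^ k / (fact k * fact (N + k)) * s ^ k)"

lemma bessel_coeff_bound: "\<bar>(- 1) ^ k / (fact k * fact (N + k)) :: real\<bar> \<le> 1 / fact k"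
  by (simp add: abs_mult divide_simps fact_ge_1)

lemma summable_bessel: "summable (\<lambda>k. (- 1) ^ k / (fact k * fact (N + k)) * (s :: real) ^ k)"
proof (rule summable_comparison_test')
  show "summable (\<lambda>k. \<bar>s\<bar> ^ k / fact k)"
    using summable_exp[of "\<bar>s\<bar>"] by (simp add: divide_inverse mult.commute)
  show "norm ((- 1) ^ k / (fact k * fact (N + k)) * s ^ k) \<le> \<bar>s\<bar> ^ k / fact k" for k
    using mult_right_mono[OF bessel_coeff_bound[of k N], of "\<bar>s\<bar> ^ k"]
    by (simp add: abs_mult power_abs)
qed

lemma bessel_deriv: "(bessel N has_real_derivative - bessel (Suc N) s) (at s)"
proof -
  have "(bessel N has_real_derivative
      (\<Sum>k. diffs (\<lambda>k. (- 1) ^ k / (fact k * fact (N + k))) k * s ^ k)) (at s)"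
    unfolding bessel_def[abs_def] by (rule termdiffs_strong_converges_everywhere[OF summable_bessel])
  also have "(\<lambda>k. diffs (\<lambda>k. (- 1) ^ k / (fact k * fact (N + k))) k * s ^ k)
      = (\<lambda>k. - ((- 1) ^ k / (fact k * fact (Suc N + k)) * s ^ k))"
    by (rule ext) (simp add: diffs_def fact_Suc[of k for k] fact_Suc[of "N + k" for k] del: of_nat_Suc)
  also have "(\<Sum>k. - ((- 1) ^ k / (fact k * fact (Suc N + k)) * s ^ k)) = - bessel (Suc N) s"
    unfolding bessel_def by (rule suminf_minus[OF summable_bessel])
  finally show ?thesis .
qed

lemmas bessel_deriv' [derivative_intros] = bessel_deriv[THEN DERIV_chain2]

text \<open>Differentiation shifts the order with a sign, so for f = \<open>bessel N\<close> this is
  s f'' + (N + 1) f' + f = 0, Bessel's equation in the variable s.\<close>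

lemma bessel_ode: "s * bessel (Suc (Suc N)) s - real (Suc N) * bessel (Suc N) s + bessel N s = 0"
proof -
  define a where "a N k = (- 1) ^ k / (fact k * fact (N + k)) * s ^ k" for N k
  have s_saddle: "summable (a N)" for N unfolding a_def by (rule summable_bessel)
  have bessel: "bessel N s = suminf (a N)" for N unfolding a_def bessel_def ..
  have split: "suminf (a N) = a N 0 + (\<Sum>k. a N (Suc k))" for N
    using suminf_split_head[OF s_saddle] by simp
  have sms: "summable (\<lambda>k. a N (Suc k))" for N using s_saddle summable_Suc_iff by blast
  \<comment> \<open>The extra factor s raises the power by one, so term k of the first series is
    matched with term k + 1 of the other two; their terms of index 0 cancel separately.\<close>
  have "(\<Sum>k. s * a (Suc (Suc N)) k - real (Suc N) * a (Suc N) (Suc k) + a N (Suc k))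
     = s * suminf (a (Suc (Suc N))) - real (Suc N) * (\<Sum>k. a (Suc N) (Suc k)) + (\<Sum>k. a N (Suc k))"
    by (simp only: suminf_add[symmetric] suminf_diff[symmetric] suminf_mult s_saddle sms
        summable_diff summable_mult)
  moreover have "s * a (Suc (Suc N)) k - real (Suc N) * a (Suc N) (Suc k) + a N (Suc k) = 0" for k
  proof -
    define F G p where "F = (fact k :: real)" and "G = (fact (N + k) :: real)" and "p = (- 1 :: real) ^ k * s ^ k * s"
    have "F > 0" "G > 0" by (simp_all add: F_def G_def)
    have f1: "fact (Suc (Suc N) + k) = (real N + real k + 2) * (real N + real k + 1) * G"
      "fact (Suc N + Suc k) = (real N + real k + 2) * (real N + real k + 1) * G"
      "fact (N + Suc k) = (real N + real k + 1) * G" "fact (Suc k) = (real k + 1) * F"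
      by (simp_all add: F_def G_def algebra_simps)
    have eqs: "s * a (Suc (Suc N)) k = p / (F * ((real N + real k + 2) * (real N + real k + 1) * G))"
      "a (Suc N) (Suc k) = - p / ((real k + 1) * F * ((real N + real k + 2) * (real N + real k + 1) * G))"
      "a N (Suc k) = - p / ((real k + 1) * F * ((real N + real k + 1) * G))"
      unfolding a_def f1 F_def[symmetric] by (simp_all add: p_def)
    have *: "p / (F * ((n + m + 2) * (n + m + 1) * G))
       - (n + 1) * (- p / ((m + 1) * F * ((n + m + 2) * (n + m + 1) * G)))
       + - p / ((m + 1) * F * ((n + m + 1) * G)) = 0" if "n \<ge> 0" "m \<ge> 0" for n m :: real
    proof -
      have "n + m + 2 \<noteq> 0" "n + m + 1 \<noteq> 0" "m + 1 \<noteq> 0" using that by auto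
      then show ?thesis using \<open>F > 0\<close> \<open>G > 0\<close> by (simp add: divide_simps) (simp add: algebra_simps)
    qed
    have "real (Suc N) = real N + 1" by simp
    then show ?thesis unfolding eqs by (simp only: *[OF of_nat_0_le_iff of_nat_0_le_iff])
  qed
  ultimately have "s * suminf (a (Suc (Suc N))) - real (Suc N) * (\<Sum>k. a (Suc N) (Suc k)) + (\<Sum>k. a N (Suc k)) = 0"
    by simp
  moreover have "real (Suc N) * a (Suc N) 0 = a N 0" by (simp add: a_def del: of_nat_Suc)
  ultimately show ?thesis unfolding bessel split[of N] split[of "Suc N"] by (simp add: algebra_simps)
qed

lemma bessel_0: "bessel N 0 = 1 / fact N"
  unfolding bessel_def by (subst powser_zero) simp

text \<open>Below \<open>N + 1\<close> the terms of the alternating series decrease in absolute value.\<close>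

lemma bessel_pos:
  assumes "0 \<le> s" "s < real (Suc N)"
  shows "bessel N s > 0"
proof -
  define b where "b k = s ^ k / (fact k * fact (N + k))" for k
  have s_saddle: "summable (\<lambda>k. (- 1) ^ k * b k)" using summable_bessel[of N s] by (simp add: b_def)
  have dec: "b (Suc k) \<le> b k" for k
  proof -
    have "b (Suc k) = b k * (s / (real (Suc k) * real (Suc (N + k))))"
      by (simp add: b_def field_simps)
    moreover have "1 * real (Suc N) \<le> real (Suc k) * real (Suc (N + k))"
      by (intro mult_mono) auto
    ultimately show ?thesis using assms
      by (simp only:) (rule mult_right_le_one_le, auto simp: b_def divide_le_eq_1)
  qed
  have "(\<lambda>n. sum (\<lambda>k. (- 1) ^ k * b k) {..<2 * n}) \<longlonglongrightarrow> (\<Sum>k. (- 1) ^ k * b k)"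
    using filterlim_compose[OF summable_LIMSEQ[OF s_saddle] mult_nat_left_at_top[of 2]] by simp
  \<comment> \<open>Partial sums of even length group into pairs b(2j) - b(2j+1), all nonnegative,
    so the first pair is a lower bound.\<close>
  moreover have "b 0 - b 1 \<le> sum (\<lambda>k. (- 1) ^ k * b k) {..<2 * Suc n}" for n
  proof (induction n)
    case (Suc n)
    have "2 * Suc (Suc n) = Suc (Suc (2 * Suc n))" by simp
    then show ?case using Suc dec[of "2 * Suc n"] by simp
  qed (simp add: eval_nat_numeral)
  ultimately have "b 0 - b 1 \<le> bessel N s"
    unfolding bessel_def b_def by (intro LIMSEQ_le_const) (auto intro!: exI[of _ 1] simp: Suc_le_eq gr0_conv_Suc simp del: mult_Suc_right)
  moreover have "b 1 < b 0"
  proof -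
    have "b 1 = s / real (Suc N) * b 0" by (simp add: b_def del: of_nat_Suc)
    also have "\<dots> < 1 * b 0" using assms by (intro mult_strict_right_mono) (auto simp: b_def)
    finally show ?thesis by simp
  qed
  ultimately show ?thesis by simp
qed

text \<open>An oscillation argument: a positive f makes s f' nonincreasing. If s f' ever reaches a
  negative value -k, then f falls at least like -k ln s and becomes negative. Otherwise f is
  nondecreasing, so s f' falls at least linearly and becomes negative after all.\<close>

lemma no_positive_solution:
  fixes f f' :: "real \<Rightarrow> real"
  assumes "t0 \<ge> 0"
    and f: "\<And>s. s > t0 \<Longrightarrow> (f has_real_derivative f' s) (at s)"
    and f': "\<And>s. s > t0 \<Longrightarrow> ((\<lambda>s. s * f' s) has_real_derivative - f s) (at s)"
    and pos: "\<And>s. s > t0 \<Longrightarrow> f s > 0"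
  shows False
proof -
  have dec: "s * f' s \<le> t * f' t" if "t0 < t" "t \<le> s" for s t
  proof (rule DERIV_nonpos_imp_nonincreasing[OF that(2)])
    fix x assume "t \<le> x" "x \<le> s"
    then show "\<exists>y. ((\<lambda>s. s * f' s) has_real_derivative y) (at x) \<and> y \<le> 0"
      using f'[of x] pos[of x] that by (intro exI[of _ "- f x"]) auto
  qed
  show False
  proof (cases "\<exists>t>t0. f' t < 0")
    case True
    then obtain t where t: "t > t0" "f' t < 0" by blast
    define k where "k = - (t * f' t)"
    have "k > 0" using t assms(1) by (simp add: k_def mult_pos_neg)
    \<comment> \<open>Chosen so that k (ln T - ln t) = f t + k, which forces f T \<le> -k.\<close>
    define T where "T = t * exp (f t / k + 1)"
    have "f t / k > 0" using pos[OF t(1)] \<open>k > 0\<close> by simp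
    have "1 * t \<le> exp (f t / k + 1) * t" using t assms(1) \<open>f t / k > 0\<close> by (intro mult_right_mono) auto
    then have "t \<le> T" by (simp add: T_def mult.commute)
    then have "f T + k * ln T \<le> f t + k * ln t"
    proof (rule DERIV_nonpos_imp_nonincreasing)
      fix x assume x: "t \<le> x" "x \<le> T"
      have "x * f' x \<le> - k" using dec[of t x] t x by (simp add: k_def)
      then have "f' x + k / x \<le> 0" using x t assms(1) by (simp add: field_simps)
      then show "\<exists>y. ((\<lambda>s. f s + k * ln s) has_real_derivative y) (at x) \<and> y \<le> 0"
        using f[of x] x t assms(1) by (intro exI[of _ "f' x + k / x"]) (auto intro!: derivative_eq_intros)
    qed
    moreover have "ln T = ln t + (f t / k + 1)" using t assms(1) by (simp add: T_def ln_mult)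
    ultimately have "f T + k * (f t / k + 1) \<le> f t" by (simp add: algebra_simps)
    then have "f T < 0" using \<open>k > 0\<close> by (simp add: distrib_left)
    moreover have "f T > 0" using pos \<open>t \<le> T\<close> t by simp
    ultimately show False by simp
  next
    case False
    define t where "t = t0 + 1"
    have f'0: "f' s \<ge> 0" if "s > t0" for s using False that by force
    have ge: "f t \<le> f s" if "t \<le> s" for s
    proof (rule DERIV_nonneg_imp_nondecreasing[OF that])
      fix x assume "t \<le> x" "x \<le> s"
      then show "\<exists>y. (f has_real_derivative y) (at x) \<and> y \<ge> 0"
        using f[of x] f'0[of x] by (auto simp: t_def)
    qed
    have ft: "f t > 0" using pos by (simp add: t_def)
    \<comment> \<open>Chosen so that f t (T - t) = t f' t + f t, which forces T f' T \<le> - f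
      t.\<close>
    define T where "T = t + (t * f' t / f t + 1)"
    have "t * f' t / f t \<ge> 0" using f'0[of t] ft assms(1) by (simp add: t_def)
    then have "t \<le> T" by (simp add: T_def)
    then have "T * f' T + f t * T \<le> t * f' t + f t * t"
    proof (rule DERIV_nonpos_imp_nonincreasing)
      fix x assume x: "t \<le> x" "x \<le> T"
      then show "\<exists>y. ((\<lambda>s. s * f' s + f t * s) has_real_derivative y) (at x) \<and> y \<le> 0"
        using DERIV_add[OF f'[of x] DERIV_cmult_Id[of "f t"]] ge[of x]
        by (intro exI[of _ "- f x + f t"]) (auto simp: t_def)
    qed
    moreover have "f t * T = f t * t + t * f' t + f t" using ft by (simp add: T_def distrib_left)
    ultimately have "T * f' T + f t \<le> 0" by simp
    moreover have "T * f' T \<ge> 0" using f'0[of T] \<open>t \<le> T\<close> assms(1) by (simp add: t_def)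
    ultimately show False using ft by simp
  qed
qed

lemma bessel_0_second_ode: "((\<lambda>s. s * - bessel 1 s) has_real_derivative - bessel 0 s) (at s)"
  using bessel_ode[of s 0] by (auto intro!: derivative_eq_intros simp: algebra_simps)

section \<open>Radial profiles\<close>

text \<open>The constant keeps the perturbation below half the minimum of g; the summand in B + 1
  covers the case B = 0.\<close>

lemma compact_pos_perturbation:
  fixes g h :: "real \<Rightarrow> real"
  assumes "compact S" "continuous_on S g" "continuous_on S h" "\<And>s. s \<in> S \<Longrightarrow> g s > 0"
  shows "\<exists>c>0. \<forall>k. \<bar>k\<bar> \<le> c \<longrightarrow> (\<forall>s\<in>S. g s + k * h s > 0)"
proof (cases "S = {}")
  case True
  then show ?thesis by (intro exI[of _ 1]) auto
next
  case False
  obtain s0 where s0: "s0 \<in> S" "\<And>s. s \<in> S \<Longrightarrow> g s0 \<le> g s"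
    using continuous_attains_inf[OF assms(1) False assms(2)] by blast
  obtain B where B: "\<And>s. s \<in> S \<Longrightarrow> \<bar>h s\<bar> \<le> B"
    using compact_imp_bounded[OF compact_continuous_image[OF assms(3,1)]]
    unfolding bounded_iff real_norm_def by blast
  have "B \<ge> 0" using B[OF s0(1)] by simp
  define c where "c = g s0 / (2 * (B + 1))"
  have "c > 0" using assms(4)[OF s0(1)] \<open>B \<ge> 0\<close> by (simp add: c_def)
  moreover have "g s + k * h s > 0" if "\<bar>k\<bar> \<le> c" "s \<in> S" for k s
  proof -
    have "\<bar>k * h s\<bar> \<le> c * (B + 1)"
      unfolding abs_mult using that B[OF that(2)] \<open>c > 0\<close> by (intro mult_mono) auto
    also have "\<dots> = g s0 / 2" using \<open>B \<ge> 0\<close> by (simp add: c_def divide_simps) (simp add: algebra_simps)?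
    finally show ?thesis using s0(2)[OF that(2)] assms(4)[OF s0(1)] by linarith
  qed
  ultimately show ?thesis by blast
qed

text \<open>A condition on the derivative, with strict signs up to both endpoints: it describes a
  profile that rises to s0 and then falls.\<close>

definition peaked :: "real \<Rightarrow> real \<Rightarrow> real \<Rightarrow> (real \<Rightarrow> real) \<Rightarrow> bool" where
  "peaked a b s0 f' \<longleftrightarrow> a < s0 \<and> s0 < b \<and> f' s0 = 0 \<and>
     (\<forall>s. a \<le> s \<and> s < s0 \<longrightarrow> f' s > 0) \<and> (\<forall>s. s0 < s \<and> s \<le> b \<longrightarrow> f' s < 0)"

text \<open>Away from the peak the sign of f' survives small perturbations by compactness. Near the
  peak, where f' has no definite sign, the quantity with a definite sign is the derivative F of s
  f': its negativity survives as well, so s times the perturbed derivative is strictly decreasing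
  there and has exactly one zero.\<close>

lemma peaked_perturbation:
  fixes f f' F e e' E :: "real \<Rightarrow> real"
  assumes order: "0 < a" "a < m1" "m1 < m" "m < m2" "m2 < b"
    and F: "\<And>s. ((\<lambda>s. s * f' s) has_real_derivative F s) (at s)"
    and E: "\<And>s. ((\<lambda>s. s * e' s) has_real_derivative E s) (at s)"
    and cont: "continuous_on {a..b} f'" "continuous_on {a..b} e'"
      "continuous_on {a..b} F" "continuous_on {a..b} E"
    and f: "f a < 0" "f b < 0" "f m > 0"
    and f': "\<And>s. a \<le> s \<Longrightarrow> s \<le> m1 \<Longrightarrow> f' s > 0" "\<And>s. m2 \<le> s \<Longrightarrow> s \<le> b \<Longrightarrow> f' s < 0"
    and Fneg: "\<And>s. m1 \<le> s \<Longrightarrow> s \<le> m2 \<Longrightarrow> F s < 0"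
  shows "\<exists>c>0. \<forall>k. \<bar>k\<bar> \<le> c \<longrightarrow> f a + k * e a < 0 \<and> f b + k * e b < 0 \<and> f m + k * e m > 0 \<and>
           (\<exists>s0. peaked a b s0 (\<lambda>s. f' s + k * e' s))"
proof -
  note sub = continuous_on_subset[OF cont(1)] continuous_on_subset[OF cont(2)]
    continuous_on_subset[OF cont(3)] continuous_on_subset[OF cont(4)]
  \<comment> \<open>Conditions at the single points a, b and m are treated as conditions on
    one-point compact sets.\<close>
  have "\<exists>c>0. \<forall>k. \<bar>k\<bar> \<le> c \<longrightarrow> (\<forall>s\<in>{a}. - f s + k * (- e s) > 0)"
    by (rule compact_pos_perturbation) (use f in \<open>auto intro!: continuous_on_minus sub\<close>)
  then obtain c1 where c1: "c1 > 0"
    and P1: "\<And>k s. \<bar>k\<bar> \<le> c1 \<Longrightarrow> s \<in> {a} \<Longrightarrow> - f s + k * (- e s) > 0" by auto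
  have "\<exists>c>0. \<forall>k. \<bar>k\<bar> \<le> c \<longrightarrow> (\<forall>s\<in>{b}. - f s + k * (- e s) > 0)"
    by (rule compact_pos_perturbation) (use f in \<open>auto intro!: continuous_on_minus sub\<close>)
  then obtain c2 where c2: "c2 > 0"
    and P2: "\<And>k s. \<bar>k\<bar> \<le> c2 \<Longrightarrow> s \<in> {b} \<Longrightarrow> - f s + k * (- e s) > 0" by auto
  have "\<exists>c>0. \<forall>k. \<bar>k\<bar> \<le> c \<longrightarrow> (\<forall>s\<in>{m}. f s + k * (e s) > 0)"
    by (rule compact_pos_perturbation) (use f in \<open>auto intro!: continuous_on_minus sub\<close>)
  then obtain c3 where c3: "c3 > 0"
    and P3: "\<And>k s. \<bar>k\<bar> \<le> c3 \<Longrightarrow> s \<in> {m} \<Longrightarrow> f s + k * (e s) > 0" by auto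
  have "\<exists>c>0. \<forall>k. \<bar>k\<bar> \<le> c \<longrightarrow> (\<forall>s\<in>{a..m1}. f' s + k * (e' s) > 0)"
    by (rule compact_pos_perturbation) (use f' order in \<open>auto intro!: continuous_on_minus sub\<close>)
  then obtain c4 where c4: "c4 > 0"
    and P4: "\<And>k s. \<bar>k\<bar> \<le> c4 \<Longrightarrow> s \<in> {a..m1} \<Longrightarrow> f' s + k * (e' s) > 0" by auto
  have "\<exists>c>0. \<forall>k. \<bar>k\<bar> \<le> c \<longrightarrow> (\<forall>s\<in>{m2..b}. - f' s + k * (- e' s) > 0)"
    by (rule compact_pos_perturbation) (use f' order in \<open>auto intro!: continuous_on_minus sub\<close>)
  then obtain c5 where c5: "c5 > 0"
    and P5: "\<And>k s. \<bar>k\<bar> \<le> c5 \<Longrightarrow> s \<in> {m2..b} \<Longrightarrow> - f' s + k * (- e' s) > 0" by auto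
  have "\<exists>c>0. \<forall>k. \<bar>k\<bar> \<le> c \<longrightarrow> (\<forall>s\<in>{m1..m2}. - F s + k * (- E s) > 0)"
    by (rule compact_pos_perturbation) (use Fneg order in \<open>auto intro!: continuous_on_minus sub\<close>)
  then obtain c6 where c6: "c6 > 0"
    and P6: "\<And>k s. \<bar>k\<bar> \<le> c6 \<Longrightarrow> s \<in> {m1..m2} \<Longrightarrow> - F s + k * (- E s) > 0" by auto
  define c where "c = Min {c1, c2, c3, c4, c5, c6}"
  have "c > 0" using c1 c2 c3 c4 c5 c6 by (simp add: c_def)
  moreover have "\<exists>s0. peaked a b s0 (\<lambda>s. f' s + k * e' s)" if k: "\<bar>k\<bar> \<le> c" for k
  proof -
    define D where "D s = s * (f' s + k * e' s)" for s
    have D: "(D has_real_derivative F s + k * E s) (at s)" for s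
      unfolding D_def using DERIV_add[OF F DERIV_cmult[OF E, of k]] by (simp add: algebra_simps)
    have dec: "D t < D s" if "m1 \<le> s" "s < t" "t \<le> m2" for s t
    proof (rule DERIV_neg_imp_decreasing[OF that(2)])
      fix x assume "s \<le> x" "x \<le> t"
      then show "\<exists>y. (D has_real_derivative y) (at x) \<and> y < 0"
        using D[of x] P6[of k x] k that by (intro exI[of _ "F x + k * E x"]) (auto simp: c_def)
    qed
    have left: "f' s + k * e' s > 0" if "a \<le> s" "s \<le> m1" for s
      using P4[of k s] k that by (simp add: c_def)
    have right: "f' s + k * e' s < 0" if "m2 \<le> s" "s \<le> b" for s
      using P5[of k s] k that by (simp add: c_def)
    have "D m1 > 0" using left[of m1] order by (simp add: D_def)
    moreover have "D m2 < 0" using right[of m2] order by (simp add: D_def mult_pos_neg)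
    moreover have "continuous_on {m1..m2} D"
      using D by (meson DERIV_continuous continuous_at_imp_continuous_on)
    ultimately obtain s0 where s0: "m1 \<le> s0" "s0 \<le> m2" "D s0 = 0"
      using IVT2'[of D m2 0 m1] order by auto
    have "s0 \<noteq> m1" "s0 \<noteq> m2" using \<open>D m1 > 0\<close> \<open>D m2 < 0\<close> s0 by auto
    have "f' s + k * e' s > 0" if "a \<le> s" "s < s0" for s
    proof (cases "s \<le> m1")
      case False
      then have "D s > 0" using dec[of s s0] s0 that by simp
      then show ?thesis unfolding D_def using that order by (simp add: zero_less_mult_iff)
    qed (use left that in auto)
    moreover have "f' s + k * e' s < 0" if "s0 < s" "s \<le> b" for s
    proof (cases "s \<ge> m2")
      case False
      then have "D s < 0" using dec[of s0 s] s0 that by simp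
      then show ?thesis unfolding D_def using that order s0 by (simp add: mult_less_0_iff)
    qed (use right that in auto)
    moreover have "f' s0 + k * e' s0 = 0" using s0 order by (auto simp: D_def)
    ultimately show ?thesis
      unfolding peaked_def using s0 order \<open>s0 \<noteq> m1\<close> \<open>s0 \<noteq> m2\<close> by (intro exI[of _ s0]) auto
  qed
  moreover have "f a + k * e a < 0 \<and> f b + k * e b < 0 \<and> f m + k * e m > 0" if "\<bar>k\<bar> \<le> c" for k
    using P1[of k a] P2[of k b] P3[of k m] that by (simp add: c_def)
  ultimately show ?thesis by blast
qed

section \<open>The first two zeros of \<open>J_0\<close>\<close>

lemma first_zero:
  fixes g :: "real \<Rightarrow> real"
  assumes "continuous_on {p..x} g" "g p > 0" "g x \<le> 0" "p \<le> x"
  obtains z where "p < z" "z \<le> x" "g z = 0" "\<And>s. p \<le> s \<Longrightarrow> s < z \<Longrightarrow> g s > 0"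
proof -
  define Z where "Z = {s \<in> {p..x}. g s = 0}"
  have "compact Z" unfolding Z_def
    using continuous_closed_preimage_constant[OF assms(1)] by (auto simp: compact_eq_bounded_closed intro: bounded_subset[of "{p..x}"])
  moreover have Z: "Z \<noteq> {}" unfolding Z_def using IVT2'[of g x 0 p] assms by auto
  ultimately obtain z where z: "z \<in> Z" "\<And>s. s \<in> Z \<Longrightarrow> z \<le> s"
    using compact_attains_inf[of Z] by blast
  have pos: "g s > 0" if s: "p \<le> s" "s < z" for s
  proof (rule ccontr)
    assume "\<not> g s > 0"
    moreover have "continuous_on {p..s} g"
      by (rule continuous_on_subset[OF assms(1)]) (use z(1) s in \<open>auto simp: Z_def\<close>)
    ultimately obtain y where "p \<le> y" "y \<le> s" "g y = 0"
      using IVT2'[of g s 0 p] assms(2) s by auto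
    then show False using z(1) z(2)[of y] s by (auto simp: Z_def)
  qed
  have "z \<noteq> p" using z(1) assms(2) by (auto simp: Z_def)
  with z(1) pos show thesis by (intro that[of z]) (auto simp: Z_def)
qed

lemma bessel_cont: "continuous_on S (bessel N)"
  using bessel_deriv by (meson DERIV_continuous continuous_at_imp_continuous_on)

lemma bessel_01: "((\<lambda>s. s * bessel 1 s) has_real_derivative bessel 0 s) (at s)"
  using DERIV_minus[OF bessel_0_second_ode[of s]] by simp

lemma bessel_0_deriv: "(bessel 0 has_real_derivative - bessel 1 s) (at s)"
  using bessel_deriv[of 0 s] by simp

text \<open>Both zeros come from \<open>no_positive_solution\<close>, applied to
  \<open>bessel 0\<close> and, beyond z1, to its negative. Between them (s \<open>bessel 1\<close>
  s)' = \<open>bessel 0\<close> s is negative, so s \<open>bessel 1\<close> s is strictly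
  decreasing; its zero m, found by Rolle's theorem, therefore determines the sign of
  \<open>bessel 1\<close> on both sides.\<close>

lemma bessel_0_negative_interval:
  obtains z1 m z2 where "0 < z1" "z1 < m" "m < z2" "bessel 0 z1 = 0" "bessel 0 z2 = 0"
    "\<And>s. z1 < s \<Longrightarrow> s < z2 \<Longrightarrow> bessel 0 s < 0"
    "\<And>s. z1 \<le> s \<Longrightarrow> s < m \<Longrightarrow> bessel 1 s > 0" "\<And>s. m < s \<Longrightarrow> s \<le> z2 \<Longrightarrow> bessel 1 s < 0"
proof -
  obtain x where "x > 0" "bessel 0 x \<le> 0"
    using no_positive_solution[of 0 "bessel 0" "\<lambda>s. - bessel 1 s"] bessel_0_second_ode bessel_0_deriv by force
  then obtain z1 where z1: "0 < z1" "z1 \<le> x" "bessel 0 z1 = 0" "\<And>s. 0 \<le> s \<Longrightarrow> s < z1 \<Longrightarrow> bessel 0 s > 0"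
    using first_zero[of 0 x "bessel 0", OF bessel_cont] bessel_0[of 0] by (metis fact_0 div_by_1 less_imp_le zero_less_one)
  \<comment> \<open>The zero z1 is simple: s \<open>bessel 1\<close> s starts from 0 and increases
    while \<open>bessel 0\<close> is positive.\<close>
  have "0 * bessel 1 0 < z1 * bessel 1 z1"
  proof (rule DERIV_pos_imp_increasing_open[OF z1(1)])
    show "\<exists>y. ((\<lambda>s. s * bessel 1 s) has_real_derivative y) (at x) \<and> y > 0" if "0 < x" "x < z1" for x
      using bessel_01[of x] z1(4)[of x] that by auto
  qed (intro continuous_intros bessel_cont)
  then have pos1: "bessel 1 z1 > 0" using z1(1) by (simp add: zero_less_mult_iff)
  then have "- bessel 1 z1 < 0" by simp
  then obtain d where d: "d > 0" "\<And>h. h > 0 \<Longrightarrow> h < d \<Longrightarrow> bessel 0 (z1 + h) < bessel 0 z1"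
    using DERIV_neg_dec_right[OF bessel_0_deriv] by blast
  \<comment> \<open>\<open>bessel 0\<close> vanishes at z1, so the search for the next zero starts
    at a point slightly beyond, where it is already negative.\<close>
  define p where "p = z1 + d / 2"
  have p: "z1 < p" and neg_p: "\<And>s. z1 < s \<Longrightarrow> s \<le> p \<Longrightarrow> bessel 0 s < 0"
    using d(1) d(2)[of "s - z1" for s] z1(3) by (auto simp: p_def field_simps)
  obtain x where "x > p" "- bessel 0 x \<le> 0"
  proof (rule ccontr)
    assume neg: "\<not> thesis"
    show False
    proof (rule no_positive_solution[of p "\<lambda>s. - bessel 0 s" "\<lambda>s. bessel 1 s"])
      show "((\<lambda>s. - bessel 0 s) has_real_derivative bessel 1 s) (at s)" for s
        using DERIV_minus[OF bessel_0_deriv[of s]] by simp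
      show "((\<lambda>s. s * bessel 1 s) has_real_derivative - (- bessel 0 s)) (at s)" for s
        using bessel_01[of s] by simp
    qed (use neg that p z1 in force)+
  qed
  moreover have "continuous_on {p..x} (\<lambda>s. - bessel 0 s)" by (intro continuous_intros bessel_cont)
  moreover have "- bessel 0 p > 0" using neg_p[of p] p by simp
  ultimately obtain z2 where z2': "p < z2" "z2 \<le> x" "- bessel 0 z2 = 0" "\<And>s. p \<le> s \<Longrightarrow> s < z2 \<Longrightarrow> - bessel 0 s > 0"
    using first_zero[of p x "\<lambda>s. - bessel 0 s"] by (metis less_imp_le)
  then have z2: "p < z2" "bessel 0 z2 = 0" "\<And>s. p \<le> s \<Longrightarrow> s < z2 \<Longrightarrow> bessel 0 s < 0" by auto
  have neg: "bessel 0 s < 0" if "z1 < s" "s < z2" for s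
    using neg_p[of s] z2(3)[of s] that by fastforce
  have "\<exists>m>z1. m < z2 \<and> DERIV (bessel 0) m :> 0"
    by (rule Rolle) (use z1 z2 p bessel_0_deriv in \<open>auto intro: bessel_cont simp: real_differentiable_def\<close>)
  then obtain m where m: "z1 < m" "m < z2" "- bessel 1 m = 0"
    using DERIV_unique[OF bessel_0_deriv] by blast
  have dec: "t * bessel 1 t < s * bessel 1 s" if "z1 \<le> s" "s < t" "t \<le> z2" for s t
  proof (rule DERIV_neg_imp_decreasing_open[OF that(2)])
    show "\<exists>y. ((\<lambda>s. s * bessel 1 s) has_real_derivative y) (at x) \<and> y < 0" if "s < x" "x < t" for x
      using bessel_01[of x] neg[of x] that \<open>z1 \<le> s\<close> \<open>t \<le> z2\<close> by auto
  qed (intro continuous_intros bessel_cont)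
  have "bessel 1 s > 0" if "z1 \<le> s" "s < m" for s
    using dec[of s m] that m z1(1) by (simp add: zero_less_mult_iff)
  moreover have "bessel 1 s < 0" if "m < s" "s \<le> z2" for s
    using dec[of m s] that m z1(1) by (simp add: mult_less_0_iff)
  ultimately show thesis using that[of z1 m z2] z1 z2 m neg by blast
qed

text \<open>As a function of s = r^2 this is J_N(2 r) for N = 2 M.\<close>

definition angular :: "nat \<Rightarrow> real \<Rightarrow> real" where
  "angular M s = s ^ M * bessel (2 * M) s"

definition angular' :: "nat \<Rightarrow> real \<Rightarrow> real" where
  "angular' M s = real M * s ^ (M - 1) * bessel (2 * M) s - s ^ M * bessel (Suc (2 * M)) s"

lemma angular_deriv: "(angular M has_real_derivative angular' M s) (at s)"
  unfolding angular_def[abs_def] angular'_def by (auto intro!: derivative_eq_intros)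

text \<open>The order of choices matters: a and b depend on \<open>bessel 0\<close> alone, then M is
  chosen large for b, and c is chosen small for M.\<close>

lemma bessel_profiles:
  obtains M a b m c where "n \<le> 2 * M" "M \<ge> 1" "0 < a" "a < m" "m < b" "b < real (Suc (2 * M))" "c > 0"
    "\<And>k. \<bar>k\<bar> \<le> c \<Longrightarrow> - bessel 0 a + k * angular M a < 0" "\<And>k. \<bar>k\<bar> \<le> c \<Longrightarrow> - bessel 0 b + k * angular M b < 0"
    "\<And>k. \<bar>k\<bar> \<le> c \<Longrightarrow> - bessel 0 m + k * angular M m > 0"
    "\<And>k. \<bar>k\<bar> \<le> c \<Longrightarrow> \<exists>s0. peaked a b s0 (\<lambda>s. bessel 1 s + k * angular' M s)"
proof (rule bessel_0_negative_interval)
  fix z1 m z2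
  assume z: "0 < z1" "z1 < m" "m < z2" "bessel 0 z1 = 0" "bessel 0 z2 = 0"
    and neg: "\<And>s. z1 < s \<Longrightarrow> s < z2 \<Longrightarrow> bessel 0 s < 0"
    and left: "\<And>s. z1 \<le> s \<Longrightarrow> s < m \<Longrightarrow> bessel 1 s > 0" and right: "\<And>s. m < s \<Longrightarrow> s \<le> z2 \<Longrightarrow> bessel 1 s < 0"
  have cont1: "(bessel 1 \<longlongrightarrow> bessel 1 s) (nhds s)" for s
    using DERIV_isCont[OF bessel_deriv[of 1 s]] tendsto_at_iff_tendsto_nhds unfolding isCont_def by blast
  have "\<forall>\<^sub>F s in nhds z1. bessel 1 s > 0" "\<forall>\<^sub>F s in nhds z2. bessel 1 s < 0"
    using order_tendstoD[OF cont1] left[of z1] right[of z2] z by auto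
  then obtain d1 d2 where d1: "d1 > 0" "\<And>s. dist s z1 < d1 \<Longrightarrow> bessel 1 s > 0"
    and d2: "d2 > 0" "\<And>s. dist s z2 < d2 \<Longrightarrow> bessel 1 s < 0"
    unfolding eventually_nhds_metric by blast
  \<comment> \<open>The interval is enlarged slightly beyond both zeros, so that -
    \<open>bessel 0\<close> is negative at its ends while \<open>bessel 1\<close> keeps the signs it
    has at z1 and z2. The bound z1 / 2 keeps a positive.\<close>
  define a where "a = max (z1 / 2) (z1 - d1 / 2)"
  define b where "b = z2 + d2 / 2"
  have a: "0 < a" "a < z1" "\<And>s. a \<le> s \<Longrightarrow> s \<le> z1 \<Longrightarrow> bessel 1 s > 0"
    using z d1(1) d1(2)[of s for s] by (auto simp: a_def dist_real_def max_def split: if_splits)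
  have b: "z2 < b" "\<And>s. z2 \<le> s \<Longrightarrow> s \<le> b \<Longrightarrow> bessel 1 s < 0"
    using d2(1) d2(2)[of s for s] by (auto simp: b_def dist_real_def)
  have "bessel 0 z1 < bessel 0 a"
    by (rule DERIV_neg_imp_decreasing[OF a(2)]) (use a(3) bessel_0_deriv in \<open>force intro: exI[of _ "- bessel 1 _"]\<close>)
  have "bessel 0 z2 < bessel 0 b"
    by (rule DERIV_pos_imp_increasing[OF b(1)]) (use b(2) bessel_0_deriv in \<open>force intro: exI[of _ "- bessel 1 _"]\<close>)
  \<comment> \<open>The ceiling puts b below 2 M + 1, the range in which
    \<open>bessel (2 * M)\<close> is known to be positive; n provides enough sectors, and the last
    summand gives M \<ge> 1.\<close>
  define M where "M = nat \<lceil>b\<rceil> + n + 1"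
  have M: "n \<le> 2 * M" "M \<ge> 1" "b < real (Suc (2 * M))" using real_nat_ceiling_ge[of b] by (auto simp: M_def)
  define E where "E s = real M * (real M * s ^ (M - 1) * bessel (2 * M) s - s ^ M * bessel (Suc (2 * M)) s)
     - (real (Suc M) * s ^ M * bessel (Suc (2 * M)) s - s ^ Suc M * bessel (Suc (Suc (2 * M))) s)" for s
  have E: "((\<lambda>s. s * angular' M s) has_real_derivative E s) (at s)" for s
  proof -
    have "(\<lambda>s. s * angular' M s) = (\<lambda>s. real M * (s ^ M * bessel (2 * M) s) - s ^ Suc M * bessel (Suc (2 * M)) s)"
      using M(2) by (auto simp: fun_eq_iff angular'_def algebra_simps power_eq_if[of _ M])
    then show ?thesis unfolding E_def
      by (auto intro!: derivative_eq_intros simp: algebra_simps simp del: power_Suc)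
  qed
  have "\<exists>c>0. \<forall>k. \<bar>k\<bar> \<le> c \<longrightarrow> - bessel 0 a + k * angular M a < 0 \<and> - bessel 0 b + k * angular M b < 0 \<and>
      - bessel 0 m + k * angular M m > 0 \<and> (\<exists>s0. peaked a b s0 (\<lambda>s. bessel 1 s + k * angular' M s))"
  proof (rule peaked_perturbation[OF a(1) _ _ _ _ bessel_01 E, of "(z1 + m) / 2" m "(m + z2) / 2" b])
    show "continuous_on {a..b} (angular' M)" "continuous_on {a..b} E"
      unfolding angular'_def E_def by (intro continuous_intros bessel_cont)+
    show "bessel 1 s > 0" if "a \<le> s" "s \<le> (z1 + m) / 2" for s
      using a(3)[of s] left[of s] that z by (cases "s \<le> z1") auto
    show "bessel 1 s < 0" if "(m + z2) / 2 \<le> s" "s \<le> b" for s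
      using b(2)[of s] right[of s] that z by (cases "z2 \<le> s") auto
    show "bessel 0 s < 0" if "(z1 + m) / 2 \<le> s" "s \<le> (m + z2) / 2" for s
      using neg[of s] that z by auto
    show "- bessel 0 m > 0" using neg[of m] z by auto
  qed (use a b z bessel_cont \<open>bessel 0 z1 < bessel 0 a\<close> \<open>bessel 0 z2 < bessel 0 b\<close> in auto)
  then obtain c where "c > 0" "\<And>k. \<bar>k\<bar> \<le> c \<Longrightarrow> - bessel 0 a + k * angular M a < 0 \<and> - bessel 0 b + k * angular M b < 0 \<and>
      - bessel 0 m + k * angular M m > 0 \<and> (\<exists>s0. peaked a b s0 (\<lambda>s. bessel 1 s + k * angular' M s))"
    by blast
  then show thesis using that[of M a m b c] M a b z by simp
qed

section \<open>One-dimensional flows\<close>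

text \<open>
  Separation of variables: the solution is the inverse of the antiderivative \<open>T\<close> of \<open>1 / f\<close>,
  which tends to \<open>- \<infinity>\<close> at \<open>p\<close> by the linear bound on \<open>f\<close>.
\<close>

lemma flow_from_fixed_point:
  fixes f :: "real \<Rightarrow> real"
  assumes order: "p < q" "q < q'"
    and cont: "\<And>x. p < x \<Longrightarrow> x < q' \<Longrightarrow> isCont f x"
    and pos: "\<And>x. p < x \<Longrightarrow> x < q' \<Longrightarrow> f x > 0"
    and bound: "\<And>x. p < x \<Longrightarrow> x \<le> q \<Longrightarrow> f x \<le> K * (x - p)"
  obtains \<rho> where "\<rho> 0 = q" "\<And>t. t \<le> 0 \<Longrightarrow> p < \<rho> t \<and> \<rho> t \<le> q"
    "\<And>t. t \<le> 0 \<Longrightarrow> (\<rho> has_real_derivative f (\<rho> t)) (at t)" "(\<rho> \<longlongrightarrow> p) at_bot"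
proof -
  have "\<exists>F. \<forall>x. ereal p < x \<longrightarrow> x < ereal q' \<longrightarrow> (F has_vector_derivative (1 / f x)) (at x)"
    by (rule einterval_antiderivative) (use order cont pos in \<open>auto intro!: continuous_intros simp: less_imp_neq dest: pos\<close>)
  then obtain T0 where T0: "\<And>x. p < x \<Longrightarrow> x < q' \<Longrightarrow> (T0 has_real_derivative 1 / f x) (at x)"
    by (auto simp: has_real_derivative_iff_has_vector_derivative)
  define T where "T x = T0 x - T0 q" for x
  have T: "(T has_real_derivative 1 / f x) (at x)" if "p < x" "x < q'" for x
    unfolding T_def using DERIV_diff[OF T0[OF that] DERIV_const[of "T0 q"]] by simp
  have Tq: "T q = 0" by (simp add: T_def)
  have mono: "T x < T y" if "p < x" "x < y" "y < q'" for x y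
  proof (rule DERIV_pos_imp_increasing[OF that(2)])
    fix z assume "x \<le> z" "z \<le> y"
    then show "\<exists>d. (T has_real_derivative d) (at z) \<and> d > 0"
      using T[of z] pos[of z] that by (intro exI[of _ "1 / f z"]) auto
  qed
  have mono': "x < y" if "T x < T y" "p < x" "x < q'" "p < y" "y < q'" for x y
    using mono[of y x] that by (cases x y rule: linorder_cases) auto
  have inj: "x = y" if "T x = T y" "p < x" "x < q'" "p < y" "y < q'" for x y
    using mono[of x y] mono[of y x] that by (cases x y rule: linorder_cases) auto
  have contT: "isCont T x" if "p < x" "x < q'" for x using T[OF that] by (rule DERIV_isCont)
  have K: "K > 0" using bound[of q] pos[of q] order by (smt (verit) zero_less_mult_iff)
  \<comment> \<open>The linear bound on f makes T' = 1/f at least 1/(K (x - p)); integrating from x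
    to q bounds T by a logarithm that tends to minus infinity at p.\<close>
  have lower: "K * T x \<le> ln ((x - p) / (q - p))" if "p < x" "x \<le> q" for x
  proof -
    have "K * T x - ln (x - p) \<le> K * T q - ln (q - p)"
    proof (rule DERIV_nonneg_imp_nondecreasing[OF that(2)])
      fix z assume z: "x \<le> z" "z \<le> q"
      have "1 / (z - p) \<le> K * (1 / f z)"
        using bound[of z] pos[of z] z that order by (simp add: field_simps)
      moreover have "((\<lambda>z. K * T z - ln (z - p)) has_real_derivative K * (1 / f z) - 1 / (z - p)) (at z)"
        using T[of z] z that order by (auto intro!: derivative_eq_intros)
      ultimately show "\<exists>d. ((\<lambda>z. K * T z - ln (z - p)) has_real_derivative d) (at z) \<and> 0 \<le> d"
        by (intro exI) auto
    qed
    then show ?thesis using Tq that order by (simp add: ln_div)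
  qed
  have surj: "\<exists>x. p < x \<and> x < q' \<and> T x = t" if tq: "t < T q''" "q \<le> q''" "q'' < q'" for t q''
  proof -
    \<comment> \<open>At this point the logarithmic bound gives T x0 \<le> min t 0, so x0 is a left
      end for the intermediate value theorem.\<close>
    define x0 where "x0 = p + (q - p) * exp (min t 0 * K)"
    have "exp (min t 0 * K) \<le> 1" using K by (simp add: mult_nonpos_nonneg)
    then have "(q - p) * exp (min t 0 * K) \<le> (q - p) * 1" using order by (intro mult_left_mono) auto
    then have "p + (q - p) * exp (min t 0 * K) \<le> p + (q - p) * 1" by (rule add_left_mono)
    then have "x0 \<le> q" unfolding x0_def by (rule order_trans) simp
    moreover have "p < x0" using order by (simp add: x0_def)
    ultimately have x0: "p < x0" "x0 \<le> q" by auto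
    have "K * T x0 \<le> K * min t 0" using lower[OF x0] order by (simp add: x0_def mult.commute)
    then have "T x0 \<le> t" using K by simp
    moreover have "continuous_on {x0..q''} T"
      using contT x0 that by (intro continuous_at_imp_continuous_on) auto
    ultimately obtain x where "x0 \<le> x" "x \<le> q''" "T x = t"
      using IVT'[of T x0 t q''] tq x0 by auto
    then show ?thesis using x0 tq by (intro exI[of _ x]) auto
  qed
  \<comment> \<open>Going beyond q defines \<rho> on a neighbourhood of time 0, so that it has a
    two-sided derivative there too.\<close>
  define q'' where "q'' = (q + q') / 2"
  have q'': "q < q''" "q'' < q'" using order by (auto simp: q''_def)
  then have Tq'': "T q'' > 0" using mono[of q q''] order Tq by simp
  define \<rho> where "\<rho> t = (SOME x. p < x \<and> x < q' \<and> T x = t)" for t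
  have \<rho>: "p < \<rho> t \<and> \<rho> t < q' \<and> T (\<rho> t) = t" if "t < T q''" for t
    unfolding \<rho>_def by (rule someI_ex) (use surj[OF that] q'' in auto)
  have \<rho>T: "\<rho> (T x) = x" if "p < x" "x \<le> q''" for x
  proof (cases "x = q''")
    case False
    then have "T x < T q''" using mono[of x q''] that q'' by simp
    then show ?thesis using \<rho>[of "T x"] inj[of "\<rho> (T x)" x] that q'' by auto
  next
    case True
    have "p < \<rho> (T x) \<and> \<rho> (T x) < q' \<and> T (\<rho> (T x)) = T x"
      unfolding \<rho>_def by (rule someI_ex) (use that q'' in auto)
    then show ?thesis using inj[of "\<rho> (T x)" x] that q'' by auto
  qed
  show thesis
  proof
    show "\<rho> 0 = q" using \<rho>T[of q] Tq order q'' by simp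
    show le: "p < \<rho> t \<and> \<rho> t \<le> q" if "t \<le> 0" for t
      using \<rho>[of t] mono[of q "\<rho> t"] that Tq Tq'' order by (cases "\<rho> t \<le> q") auto
    show "(\<rho> has_real_derivative f (\<rho> t)) (at t)" if "t \<le> 0" for t
    proof -
      note r = \<rho>[of t] le[OF that]
      define x1 where "x1 = (p + \<rho> t) / 2"
      have x1: "p < x1" "x1 < \<rho> t" "\<rho> t < q''" using r q'' that Tq'' by (auto simp: x1_def)
      have "isCont \<rho> (T (\<rho> t))"
        by (rule isCont_inverse_function2[of x1 _ q'']) (use x1 q'' \<rho>T contT in auto)
      then have "(\<rho> has_real_derivative inverse (1 / f (\<rho> t))) (at t)"
        using DERIV_inverse_function[where f = T and g = \<rho> and x = t and D = "1 / f (\<rho> t)" and a = "t - 1" and b = "T q''"] T[of "\<rho> t"] \<rho> r pos[of "\<rho> t"] that Tq''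
        by auto
      then show ?thesis by simp
    qed
    show "(\<rho> \<longlongrightarrow> p) at_bot"
    proof (rule order_tendstoI)
      fix a assume "a < p"
      show "\<forall>\<^sub>F t in at_bot. a < \<rho> t"
        using eventually_le_at_bot[of "0::real"] by (rule eventually_mono) (use le \<open>a < p\<close> in force)
    next
      fix a assume "p < a"
      define y where "y = min a q"
      have y: "p < y" "y \<le> q" "y \<le> a" using \<open>p < a\<close> order by (auto simp: y_def)
      show "\<forall>\<^sub>F t in at_bot. \<rho> t < a"
        using eventually_le_at_bot[of "min 0 (T y - 1)"]
      proof (rule eventually_mono)
        fix t assume t: "t \<le> min 0 (T y - 1)"
        then have "\<rho> t < y" using \<rho>[of t] mono'[of "\<rho> t" y] y order Tq'' by auto
        then show "\<rho> t < a" using y by simp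
      qed
    qed
  qed
qed

text \<open>The case q < p is reduced to q > p by the reflection x to -x; for q = p the solution is
  constant, as the bound forces f p = 0.\<close>

lemma flow_from_fixed_point_both_sides:
  fixes f :: "real \<Rightarrow> real"
  assumes p: "l < p" "p < h" and q: "l < q" "q < h"
    and cont: "\<And>x. isCont f x"
    and neg: "\<And>x. l < x \<Longrightarrow> x < p \<Longrightarrow> f x < 0" and pos: "\<And>x. p < x \<Longrightarrow> x < h \<Longrightarrow> f x > 0"
    and bound: "\<And>x. l \<le> x \<Longrightarrow> x \<le> h \<Longrightarrow> \<bar>f x\<bar> \<le> K * \<bar>x - p\<bar>"
  obtains \<rho> where "\<rho> 0 = q" "\<And>t. t \<le> 0 \<Longrightarrow> \<rho> t \<in> closed_segment p q"
    "\<And>t. t \<le> 0 \<Longrightarrow> (\<rho> has_real_derivative f (\<rho> t)) (at t)" "(\<rho> \<longlongrightarrow> p) at_bot"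
proof -
  consider "p < q" | "q < p" | "q = p" by linarith
  then show thesis
  proof cases
    case 1
    have "f x \<le> K * (x - p)" if "p < x" "x \<le> q" for x
      using bound[of x] that p q by simp
    then obtain \<rho> where "\<rho> 0 = q" "\<And>t. t \<le> 0 \<Longrightarrow> p < \<rho> t \<and> \<rho> t \<le> q"
      "\<And>t. t \<le> 0 \<Longrightarrow> (\<rho> has_real_derivative f (\<rho> t)) (at t)" "(\<rho> \<longlongrightarrow> p) at_bot"
      using flow_from_fixed_point[OF 1 q(2) cont pos] by blast
    then show thesis using 1 that[of \<rho>] by (auto simp: closed_segment_eq_real_ivl less_imp_le)
  next
    case 2
    have contr: "isCont (\<lambda>x. - f (- x)) x" for x
      using isCont_o2[OF isCont_minus[OF continuous_ident] cont] by (intro isCont_minus)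
    have b: "- f (- x) \<le> K * (x - - p)" if "- p < x" "x \<le> - q" for x
    proof -
      have "\<bar>f (- x)\<bar> \<le> K * \<bar>- x - p\<bar>" using that p q by (intro bound) auto
      moreover have "\<bar>- x - p\<bar> = x - - p" using that by simp
      ultimately show ?thesis by (simp only: abs_le_iff)
    qed
    have ps: "- f (- x) > 0" if "- p < x" "x < - l" for x using neg[of "- x"] that by simp
    obtain \<rho> where \<rho>: "\<rho> 0 = - q" "\<And>t. t \<le> 0 \<Longrightarrow> - p < \<rho> t \<and> \<rho> t \<le> - q"
      "\<And>t. t \<le> 0 \<Longrightarrow> (\<rho> has_real_derivative - f (- \<rho> t)) (at t)" "(\<rho> \<longlongrightarrow> - p) at_bot"
      using flow_from_fixed_point[of "- p" "- q" "- l" "\<lambda>x. - f (- x)" K] 2 q contr ps b by auto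
    show thesis
    proof (rule that[of "\<lambda>t. - \<rho> t"])
      show "((\<lambda>t. - \<rho> t) has_real_derivative f (- \<rho> t)) (at t)" if "t \<le> 0" for t
        using DERIV_minus[OF \<rho>(3)[OF that]] by simp
      show "((\<lambda>t. - \<rho> t) \<longlongrightarrow> p) at_bot" using tendsto_minus[OF \<rho>(4)] by simp
      show "- \<rho> t \<in> closed_segment p q" if "t \<le> 0" for t
        using \<rho>(2)[OF that] 2 by (auto simp: closed_segment_eq_real_ivl)
    qed (simp add: \<rho>(1))
  next
    case 3
    have "f p = 0" using bound[of p] p by simp
    then show thesis using that[of "\<lambda>_. p"] 3 by simp
  qed
qed

section \<open>Absolutely convergent power series in two variables\<close>

text \<open>\<open>B\<close> bounds the weighted sum of the absolute values of the coefficients at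
  radius \<open>r\<close>, a submultiplicative norm. The explicit bound is what permits composition
  with an entire function of one variable.\<close>

definition series_bound :: "real \<Rightarrow> real^2 \<Rightarrow> real \<Rightarrow> (real^2 \<Rightarrow> real) \<Rightarrow> bool" where
  "series_bound r p B f \<longleftrightarrow> (\<exists>a :: nat \<times> nat \<Rightarrow> real.
     (\<lambda>(i, j). \<bar>a (i, j)\<bar> * r ^ (i + j)) summable_on UNIV \<and>
     (\<Sum>\<^sub>\<infinity>(i, j). \<bar>a (i, j)\<bar> * r ^ (i + j)) \<le> B \<and>
     (\<forall>x\<in>ball p r. ((\<lambda>(i, j). a (i, j) * (x $ 1 - p $ 1) ^ i * (x $ 2 - p $ 2) ^ j) has_sum f x) UNIV))"

abbreviation (input) monomial :: "real \<Rightarrow> real^2 \<Rightarrow> real^2 \<Rightarrow> nat \<times> nat \<Rightarrow> real" where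
  "monomial c p x q \<equiv> c * (x $ 1 - p $ 1) ^ fst q * (x $ 2 - p $ 2) ^ snd q"

abbreviation (input) weight :: "real \<Rightarrow> real \<Rightarrow> nat \<times> nat \<Rightarrow> real" where
  "weight c r q \<equiv> \<bar>c\<bar> * r ^ (fst q + snd q)"

text \<open>Products and compositions first appear as series over larger index types, in which an
  exponent pair may occur many times. Summing over the fibres of the exponent map d turns such a
  series into a power series without increasing the norm.\<close>

lemma series_bound_regroup:
  fixes c :: "'w \<Rightarrow> real" and d :: "'w \<Rightarrow> nat \<times> nat"
  assumes "r > 0"
    and abs: "(\<lambda>w. weight (c w) r (d w)) summable_on UNIV"
    and B: "(\<Sum>\<^sub>\<infinity>w. weight (c w) r (d w)) \<le> B"
    and sum: "\<And>x. x \<in> ball p r \<Longrightarrow>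
      ((\<lambda>w. monomial (c w) p x (d w)) has_sum f x) UNIV"
  shows "series_bound r p B f"
proof -
  define F where "F q = {w. d w = q}" for q
  define a where "a q = (\<Sum>\<^sub>\<infinity>w\<in>F q. c w)" for q
  have bij: "bij_betw snd (Sigma UNIV F) (UNIV :: 'w set)"
    by (rule bij_betwI[where g = "\<lambda>w. (d w, w)"]) (auto simp: F_def)
  have regroup: "(g has_sum S) UNIV \<longleftrightarrow> ((\<lambda>(q, w). g w) has_sum S) (Sigma UNIV F)" for g :: "'w \<Rightarrow> real" and S
    using has_sum_reindex_bij_betw[OF bij, of g S] by (simp add: case_prod_unfold)
  have absF: "(\<lambda>w. \<bar>c w\<bar>) summable_on F q" for q
  proof -
    have "(\<lambda>w. weight (c w) r (d w)) summable_on F q"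
      using abs by (rule summable_on_subset_banach) auto
    then have "(\<lambda>w. weight (c w) r q) summable_on F q"
      by (rule summable_on_cong[THEN iffD1, rotated]) (simp add: F_def)
    then show ?thesis using assms(1) by (simp add: summable_on_cmult_left')
  qed
  have cF: "(c has_sum a q) (F q)" for q
    unfolding a_def using absF[of q]
    by (intro has_sum_infsum abs_summable_summable[of c "F q"]) (simp only: real_norm_def)
  have "((\<lambda>w. weight (c w) r (d w)) has_sum (\<Sum>\<^sub>\<infinity>w. weight (c w) r (d w))) UNIV"
    using abs by (rule has_sum_infsum)
  then have "((\<lambda>(q, w). weight (c w) r (d w)) has_sum (\<Sum>\<^sub>\<infinity>w. weight (c w) r (d w))) (Sigma UNIV F)"
    unfolding regroup .
  moreover have "((\<lambda>w. weight (c w) r (d w)) has_sum (\<Sum>\<^sub>\<infinity>w\<in>F q. \<bar>c w\<bar>) * r ^ (fst q + snd q)) (F q)" for q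
  proof (rule has_sum_cong[THEN iffD1])
    show "((\<lambda>w. weight (c w) r q) has_sum (\<Sum>\<^sub>\<infinity>w\<in>F q. \<bar>c w\<bar>) * r ^ (fst q + snd q)) (F q)"
      by (intro has_sum_cmult_left has_sum_infsum absF)
  qed (simp add: F_def)
  ultimately have maj: "((\<lambda>q. (\<Sum>\<^sub>\<infinity>w\<in>F q. \<bar>c w\<bar>) * r ^ (fst q + snd q)) has_sum
      (\<Sum>\<^sub>\<infinity>w. weight (c w) r (d w))) UNIV"
    by (intro has_sum_SigmaD[where B = F]) auto
  have a_le: "weight (a q) r q \<le> (\<Sum>\<^sub>\<infinity>w\<in>F q. \<bar>c w\<bar>) * r ^ (fst q + snd q)" for q
    using norm_infsum_bound[of c "F q"] absF[of q] assms(1)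
    by (intro mult_right_mono) (auto simp: a_def)
  have sma: "(\<lambda>q. weight (a q) r q) summable_on UNIV"
    by (rule summable_on_comparison_test[OF has_sum_imp_summable[OF maj]]) (use a_le assms(1) in auto)
  moreover have "(\<Sum>\<^sub>\<infinity>q. weight (a q) r q) \<le> B"
  proof -
    have "(\<Sum>\<^sub>\<infinity>q. weight (a q) r q) \<le> (\<Sum>\<^sub>\<infinity>w. weight (c w) r (d w))"
      by (rule has_sum_mono[OF has_sum_infsum[OF sma] maj a_le])
    then show ?thesis using B by simp
  qed
  moreover have "((\<lambda>q. monomial (a q) p x q) has_sum f x) UNIV"
    if x: "x \<in> ball p r" for x
  proof (rule has_sum_SigmaD[where B = F])
    show "((\<lambda>(q, w). monomial (c w) p x (d w)) has_sum f x) (Sigma UNIV F)"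
      using sum[OF x] unfolding regroup .
    fix q
    have "((\<lambda>w. monomial (c w) p x q) has_sum
        monomial (a q) p x q) (F q)"
      by (intro has_sum_cmult_left cF)
    then show "((\<lambda>w. case (q, w) of (q, w) \<Rightarrow> monomial (c w) p x (d w)) has_sum
        monomial (a q) p x q) (F q)"
      by (rule has_sum_cong[THEN iffD1, rotated]) (simp add: F_def)
  qed
  ultimately show ?thesis
    unfolding series_bound_def by (intro exI[of _ a]) (simp add: case_prod_unfold)
qed

lemma series_boundE:
  assumes "series_bound r p B f"
  obtains a :: "nat \<times> nat \<Rightarrow> real" where "(\<lambda>q. weight (a q) r q) summable_on UNIV"
    "(\<Sum>\<^sub>\<infinity>q. weight (a q) r q) \<le> B"
    "\<And>x. x \<in> ball p r \<Longrightarrow> ((\<lambda>q. monomial (a q) p x q) has_sum f x) UNIV"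
  using assms unfolding series_bound_def by (auto simp: case_prod_unfold)

lemma series_bound_monomial:
  assumes "r > 0"
  shows "series_bound r p (\<bar>c\<bar> * r ^ (i + j)) (\<lambda>x. c * (x $ 1 - p $ 1) ^ i * (x $ 2 - p $ 2) ^ j)"
  by (rule series_bound_regroup[where c = "\<lambda>_::unit. c" and d = "\<lambda>_. (i, j)"])
    (use assms has_sum_finite[of "UNIV :: unit set"] in \<open>auto simp: UNIV_unit\<close>)

lemma series_bound_const: "r > 0 \<Longrightarrow> series_bound r p \<bar>c\<bar> (\<lambda>x. c)"
  using series_bound_monomial[of r p c 0 0] by simp

lemma series_bound_add:
  assumes "r > 0" "series_bound r p A f" "series_bound r p B g"
  shows "series_bound r p (A + B) (\<lambda>x. f x + g x)"
proof -
  obtain a where a: "(\<lambda>q. weight (a q) r q) summable_on UNIV"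
    "(\<Sum>\<^sub>\<infinity>q. weight (a q) r q) \<le> A"
    "\<And>x. x \<in> ball p r \<Longrightarrow> ((\<lambda>q. monomial (a q) p x q) has_sum f x) UNIV"
    by (rule series_boundE[OF assms(2)]) (rule that)
  obtain b where b: "(\<lambda>q. weight (b q) r q) summable_on UNIV"
    "(\<Sum>\<^sub>\<infinity>q. weight (b q) r q) \<le> B"
    "\<And>x. x \<in> ball p r \<Longrightarrow> ((\<lambda>q. monomial (b q) p x q) has_sum g x) UNIV"
    by (rule series_boundE[OF assms(3)]) (rule that)
  have le: "weight (a q + b q) r q \<le> weight (a q) r q + weight (b q) r q" for q
    unfolding distrib_right[symmetric] using assms(1) by (intro mult_right_mono) auto
  have s_saddle: "(\<lambda>q. weight (a q) r q + weight (b q) r q) summable_on UNIV"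
    using a(1) b(1) by (rule summable_on_add)
  have sm': "(\<lambda>q. weight (a q + b q) r q) summable_on UNIV"
    by (rule summable_on_comparison_test[OF s_saddle]) (use le assms(1) in auto)
  show ?thesis
  proof (rule series_bound_regroup[where c = "\<lambda>q. a q + b q" and d = "\<lambda>q. q", OF assms(1) sm'])
    show "(\<Sum>\<^sub>\<infinity>q. weight (a q + b q) r q) \<le> A + B"
      using infsum_mono[OF sm' s_saddle le] infsum_add[OF a(1) b(1)] a(2) b(2) by simp
    show "((\<lambda>q. monomial (a q + b q) p x q) has_sum f x + g x) UNIV"
      if "x \<in> ball p r" for x
      using has_sum_add[OF a(3)[OF that] b(3)[OF that]] by (simp add: distrib_right)
  qed
qed

text \<open>The product of the two absolutely convergent series is a series over pairs of indices;
  regrouping by the sum of exponents gives the Cauchy product.\<close>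

lemma series_bound_mult:
  assumes "r > 0" "series_bound r p A f" "series_bound r p B g"
  shows "series_bound r p (A * B) (\<lambda>x. f x * g x)"
proof -
  obtain a where a: "(\<lambda>q. weight (a q) r q) summable_on UNIV"
    "(\<Sum>\<^sub>\<infinity>q. weight (a q) r q) \<le> A"
    "\<And>x. x \<in> ball p r \<Longrightarrow> ((\<lambda>q. monomial (a q) p x q) has_sum f x) UNIV"
    by (rule series_boundE[OF assms(2)]) (rule that)
  obtain b where b: "(\<lambda>q. weight (b q) r q) summable_on UNIV"
    "(\<Sum>\<^sub>\<infinity>q. weight (b q) r q) \<le> B"
    "\<And>x. x \<in> ball p r \<Longrightarrow> ((\<lambda>q. monomial (b q) p x q) has_sum g x) UNIV"
    by (rule series_boundE[OF assms(3)]) (rule that)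
  define c where "c w = a (fst w) * b (snd w)" for w
  define d where "d w = (fst (fst w) + fst (snd w) :: nat, snd (fst w) + snd (snd w) :: nat)" for w
  have prod: "((\<lambda>(v, w). F v * G w) has_sum S * T) UNIV"
    if "(F has_sum S) UNIV" "(G has_sum T) UNIV" for F G :: "nat \<times> nat \<Rightarrow> real" and S T
  proof -
    have abs: "(\<lambda>v. \<bar>F v\<bar>) summable_on UNIV" "(\<lambda>v. \<bar>G v\<bar>) summable_on UNIV"
      using that[THEN has_sum_imp_summable] summable_on_iff_abs_summable_on_real[of F UNIV]
        summable_on_iff_abs_summable_on_real[of G UNIV]
      by (simp_all only: real_norm_def)
    have "(\<lambda>w. norm (case w of (v, w) \<Rightarrow> F v * G w)) summable_on (UNIV \<times> UNIV)"
    proof (rule summable_on_SigmaI)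
      show "((\<lambda>w. norm (case (v, w) of (v, w) \<Rightarrow> F v * G w)) has_sum \<bar>F v\<bar> * (\<Sum>\<^sub>\<infinity>w. \<bar>G w\<bar>)) UNIV" for v
        using has_sum_cmult_right[OF has_sum_infsum[OF abs(2)], of "\<bar>F v\<bar>"] by (simp add: abs_mult)
      show "(\<lambda>v. \<bar>F v\<bar> * (\<Sum>\<^sub>\<infinity>w. \<bar>G w\<bar>)) summable_on UNIV"
        by (intro summable_on_cmult_left abs(1))
    qed simp
    then have "(\<lambda>(v, w). F v * G w) summable_on (UNIV \<times> UNIV)" by (rule abs_summable_summable)
    then have "((\<lambda>(v, w). F v * G w) has_sum S * T) (UNIV \<times> UNIV)"
      by (rule has_sum_SigmaI[where g = "\<lambda>v. F v * T", rotated 2])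
        (use has_sum_cmult_right[OF that(2)] has_sum_cmult_left[OF that(1)] in auto)
    then show ?thesis by simp
  qed
  have eq: "weight (c w) r (d w) =
      (\<bar>a (fst w)\<bar> * r ^ (fst (fst w) + snd (fst w))) * (\<bar>b (snd w)\<bar> * r ^ (fst (snd w) + snd (snd w)))" for w
    by (simp add: c_def d_def abs_mult power_add)
  have hs: "((\<lambda>w. weight (c w) r (d w)) has_sum
      (\<Sum>\<^sub>\<infinity>q. weight (a q) r q) * (\<Sum>\<^sub>\<infinity>q. weight (b q) r q)) UNIV"
    unfolding eq using prod[OF has_sum_infsum[OF a(1)] has_sum_infsum[OF b(1)]]
    by (simp add: case_prod_unfold)
  show ?thesis
  proof (rule series_bound_regroup[where c = c and d = d, OF assms(1) has_sum_imp_summable[OF hs]])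
    have "0 \<le> (\<Sum>\<^sub>\<infinity>q. weight (b q) r q)" "0 \<le> (\<Sum>\<^sub>\<infinity>q. weight (a q) r q)"
      using assms(1) by (auto intro!: infsum_nonneg)
    then show "(\<Sum>\<^sub>\<infinity>w. weight (c w) r (d w)) \<le> A * B"
      unfolding infsumI[OF hs] using a(2) b(2) by (intro mult_mono) auto
    fix x assume x: "x \<in> ball p r"
    have "((\<lambda>(v, w). (a v * (x $ 1 - p $ 1) ^ fst v * (x $ 2 - p $ 2) ^ snd v) *
         (monomial (b w) p x w)) has_sum f x * g x) UNIV"
      by (rule prod[OF a(3)[OF x] b(3)[OF x]])
    then show "((\<lambda>w. monomial (c w) p x (d w)) has_sum f x * g x) UNIV"
      by (rule has_sum_cong[THEN iffD1, rotated]) (simp add: c_def d_def power_add case_prod_unfold)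
  qed
qed

lemma series_bound_power:
  assumes "r > 0" "series_bound r p A f"
  shows "series_bound r p (A ^ k) (\<lambda>x. f x ^ k)"
proof (induction k)
  case 0
  then show ?case using series_bound_const[OF assms(1), of p 1] by simp
next
  case (Suc k)
  then show ?case using series_bound_mult[OF assms Suc] by simp
qed

text \<open>A series of norm at most \<open>A ^ k\<close> is chosen for each power of f. Weighted
  with \<open>h k\<close>, they form an absolutely convergent series over triples of indices, which
  is then regrouped.\<close>

lemma series_bound_compose:
  assumes "r > 0" and f: "series_bound r p A f" and "A \<ge> 0"
    and h: "summable (\<lambda>k. \<bar>h k\<bar> * A ^ k)"
  shows "series_bound r p (\<Sum>k. \<bar>h k\<bar> * A ^ k) (\<lambda>x. \<Sum>k. h k * f x ^ k)"
proof -
  define P where "P k a \<longleftrightarrow> (\<lambda>q. weight (a q) r q) summable_on UNIV \<and>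
      (\<Sum>\<^sub>\<infinity>q. weight (a q) r q) \<le> A ^ k \<and>
      (\<forall>x\<in>ball p r. ((\<lambda>q. monomial (a q) p x q) has_sum f x ^ k) UNIV)"
    for k and a :: "nat \<times> nat \<Rightarrow> real"
  have "\<forall>k. \<exists>a. P k a"
    using series_bound_power[OF assms(1) f] unfolding series_bound_def P_def by (simp add: case_prod_unfold)
  then obtain a where P: "\<forall>k. P k (a k)" using choice[of P] by blast
  have a: "(\<lambda>q. weight (a k q) r q) summable_on UNIV"
    "(\<Sum>\<^sub>\<infinity>q. weight (a k q) r q) \<le> A ^ k"
    "x \<in> ball p r \<Longrightarrow> ((\<lambda>q. monomial (a k q) p x q) has_sum f x ^ k) UNIV" for k x
    using P[rule_format, of k] unfolding P_def by auto
  define S where "S k = (\<Sum>\<^sub>\<infinity>q. weight (a k q) r q)" for k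
  have S: "((\<lambda>q. weight (a k q) r q) has_sum S k) UNIV" "S k \<le> A ^ k" "0 \<le> S k" for k
    unfolding S_def using a(1,2) assms(1) by (auto intro!: infsum_nonneg)
  define c where "c w = h (fst w) * a (fst w) (snd w)" for w
  define d where "d w = (snd w :: nat \<times> nat)" for w :: "nat \<times> nat \<times> nat"
  have hA: "((\<lambda>k. \<bar>h k\<bar> * A ^ k) has_sum (\<Sum>k. \<bar>h k\<bar> * A ^ k)) UNIV"
    by (rule norm_summable_imp_has_sum) (use h assms(3) in \<open>auto simp: abs_mult summable_sums\<close>)
  have hS: "(\<lambda>k. \<bar>h k\<bar> * S k) summable_on UNIV"
    by (rule summable_on_comparison_test[OF has_sum_imp_summable[OF hA]]) (use S in \<open>auto intro: mult_left_mono\<close>)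
  have inner: "((\<lambda>q. \<bar>c (k, q)\<bar> * r ^ (fst (d (k, q)) + snd (d (k, q)))) has_sum \<bar>h k\<bar> * S k) UNIV" for k
    using has_sum_cmult_right[OF S(1)[of k], of "\<bar>h k\<bar>"] by (simp add: c_def d_def abs_mult mult.assoc)
  have "(\<lambda>w. weight (c w) r (d w)) summable_on Sigma UNIV (\<lambda>_. UNIV)"
    by (rule summable_on_SigmaI[OF inner hS]) (use assms(1) in auto)
  then have s_saddle: "(\<lambda>w. weight (c w) r (d w)) summable_on UNIV" by simp
  have "((\<lambda>k. \<bar>h k\<bar> * S k) has_sum (\<Sum>\<^sub>\<infinity>w. weight (c w) r (d w))) UNIV"
    using has_sum_infsum[OF s_saddle]
    by (intro has_sum_SigmaD[where B = "\<lambda>_. UNIV" and f = "\<lambda>w. weight (c w) r (d w)", OF _ inner]) simp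
  then have B: "(\<Sum>\<^sub>\<infinity>w. weight (c w) r (d w)) \<le> (\<Sum>k. \<bar>h k\<bar> * A ^ k)"
    by (rule has_sum_mono[OF _ hA]) (use S in \<open>auto intro: mult_left_mono\<close>)
  show ?thesis
  proof (rule series_bound_regroup[where c = c and d = d, OF assms(1) s_saddle B])
    fix x assume x: "x \<in> ball p r"
    let ?g = "\<lambda>w. monomial (c w) p x (d w)"
    have le: "\<bar>x $ i - p $ i\<bar> \<le> r" for i
      using component_le_norm_cart[of "x - p" i] x by (simp add: dist_norm norm_minus_commute)
    have "?g summable_on UNIV"
    proof (rule Infinite_Sum.abs_summable_summable, rule summable_on_comparison_test[OF s_saddle])
      show "norm (?g w) \<le> weight (c w) r (d w)" for w
        unfolding real_norm_def abs_mult power_abs power_add mult.assoc using assms(1) le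
        by (auto intro!: mult_mono power_mono)
    qed simp
    moreover have "((\<lambda>q. ?g (k, q)) has_sum h k * f x ^ k) UNIV" for k
      using has_sum_cmult_right[OF a(3)[OF x, of k], of "h k"] by (simp add: c_def d_def mult.assoc)
    \<comment> \<open>The values of f are bounded by the norm of its series, so the outer series
      converges at every value of f.\<close>
    moreover have fx: "\<bar>f x\<bar> \<le> A"
    proof -
      have "norm (f x ^ 1) \<le> S 1"
      proof (rule norm_infsum_le)
        show "((\<lambda>q. monomial (a 1 q) p x q) has_sum f x ^ 1) UNIV"
          by (rule a(3)[OF x])
        show "((\<lambda>q. weight (a 1 q) r q) has_sum S 1) UNIV" by (rule S)
        show "norm (monomial (a 1 q) p x q) \<le> weight (a 1 q) r q" for q
          unfolding real_norm_def abs_mult power_abs power_add mult.assoc using assms(1) le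
          by (auto intro!: mult_mono power_mono)
      qed
      then show ?thesis using S(2)[of 1] by simp
    qed
    moreover have "((\<lambda>k. h k * f x ^ k) has_sum (\<Sum>k. h k * f x ^ k)) UNIV"
    proof -
      have n: "summable (\<lambda>k. norm (h k * f x ^ k))"
        by (rule summable_comparison_test'[OF h])
          (use fx in \<open>auto simp: abs_mult power_abs intro!: mult_left_mono power_mono\<close>)
      show ?thesis by (rule norm_summable_imp_has_sum[OF n summable_sums[OF summable_norm_cancel[OF n]]])
    qed
    ultimately have "(?g has_sum (\<Sum>k. h k * f x ^ k)) (Sigma UNIV (\<lambda>_. UNIV))"
      by (intro has_sum_SigmaI[where g = "\<lambda>k. h k * f x ^ k"]) simp_all
    then show "(?g has_sum (\<Sum>k. h k * f x ^ k)) UNIV" by simp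
  qed
qed

lemma series_bound_imp_real_analytic:
  assumes "r > 0" "\<And>p. \<exists>B. series_bound r p B f"
  shows "real_analytic_on f S"
  unfolding real_analytic_on_def
proof
  fix p assume "p \<in> S"
  obtain B where "series_bound r p B f" using assms(2) by blast
  then obtain a where "\<And>x. x \<in> ball p r \<Longrightarrow> ((\<lambda>q. monomial (a q) p x q) has_sum f x) UNIV"
    by (rule series_boundE) blast
  then show "\<exists>r>0. \<exists>a. \<forall>x\<in>ball p r. ((\<lambda>(i, j). a i j * (x $ 1 - p $ 1) ^ i * (x $ 2 - p $ 2) ^ j) has_sum f x) UNIV"
    using assms(1) by (intro exI[of _ r] conjI exI[of _ "\<lambda>i j. a (i, j)"]) (auto simp: case_prod_unfold)
qed

section \<open>The eigenfunction\<close>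

definition to_complex :: "real^2 \<Rightarrow> complex" where
  "to_complex x = Complex (x $ 1) (x $ 2)"

definition norm_sq :: "real^2 \<Rightarrow> real" where
  "norm_sq x = (x $ 1)\<^sup>2 + (x $ 2)\<^sup>2"

text \<open>With \<open>im_pow\<close>, these are the harmonic polynomials r^N cos(N \<theta>) and
  r^N sin(N \<theta>).\<close>

definition re_pow :: "nat \<Rightarrow> real^2 \<Rightarrow> real" where
  "re_pow N x = Re (to_complex x ^ N)"

definition im_pow :: "nat \<Rightarrow> real^2 \<Rightarrow> real" where
  "im_pow N x = Im (to_complex x ^ N)"

text \<open>By the Cauchy-Riemann equations, the complex conjugate of N z^(N-1). For N = 0 the
  truncated exponent does no harm, since the factor \<open>real N\<close> is 0.\<close>

definition grad_re_pow :: "nat \<Rightarrow> real^2 \<Rightarrow> real^2" where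
  "grad_re_pow N x = vector [real N * re_pow (N - 1) x, - real N * im_pow (N - 1) x]"

definition grad_im_pow :: "nat \<Rightarrow> real^2 \<Rightarrow> real^2" where
  "grad_im_pow N x = vector [real N * im_pow (N - 1) x, real N * re_pow (N - 1) x]"

lemma inner_2: "x \<bullet> y = x $ 1 * y $ 1 + x $ 2 * y $ 2" for x y :: "real^2"
  by (simp add: inner_vec_def sum_2)

lemma norm_sq_norm: "norm_sq x = (norm x)\<^sup>2"
  unfolding power2_norm_eq_inner by (simp add: norm_sq_def inner_2 power2_eq_square)

lemma norm_sq_to_complex: "norm_sq x = (cmod (to_complex x))\<^sup>2"
  by (simp add: norm_sq_def to_complex_def cmod_power2)

lemma norm_sq_inner: "x \<bullet> x = norm_sq x"
  by (simp add: norm_sq_norm power2_norm_eq_inner)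

lemma re_pow_Suc: "re_pow (Suc N) x = x $ 1 * re_pow N x - x $ 2 * im_pow N x"
  and im_pow_Suc: "im_pow (Suc N) x = x $ 1 * im_pow N x + x $ 2 * re_pow N x"
  by (simp_all add: re_pow_def im_pow_def to_complex_def)

lemma re_pow_im_pow_norm_sq: "(re_pow N x)\<^sup>2 + (im_pow N x)\<^sup>2 = norm_sq x ^ N"
proof -
  have "(re_pow N x)\<^sup>2 + (im_pow N x)\<^sup>2 = (cmod (to_complex x ^ N))\<^sup>2" by (simp add: re_pow_def im_pow_def cmod_power2)
  also have "\<dots> = norm_sq x ^ N" by (simp add: norm_sq_to_complex norm_power power_mult[symmetric] mult.commute)
  finally show ?thesis .
qed

lemma GDERIV_norm_sq: "GDERIV norm_sq x :> 2 *\<^sub>R x"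
proof -
  have eq: "norm_sq = (\<lambda>x. x \<bullet> x)" by (simp add: fun_eq_iff norm_sq_inner)
  show ?thesis unfolding eq gderiv_def
    by (auto intro!: derivative_eq_intros simp: inner_commute)
qed

lemma to_complex_has_derivative: "(to_complex has_derivative to_complex) (at x)"
proof -
  have "linear to_complex" by (rule linearI) (auto simp: to_complex_def complex_eq_iff)
  then show ?thesis by (intro bounded_linear_imp_has_derivative) (simp add: linear_conv_bounded_linear)
qed

lemma to_complex_power_has_derivative:
  "((\<lambda>x. to_complex x ^ N) has_derivative (\<lambda>h. of_nat N * to_complex x ^ (N - 1) * to_complex h)) (at x)"
  using has_derivative_power[OF to_complex_has_derivative[of x], of N] by (simp add: ac_simps)

lemma GDERIV_re_pow: "GDERIV (re_pow N) x :> grad_re_pow N x"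
proof -
  have "((\<lambda>x. Re (to_complex x ^ N)) has_derivative (\<lambda>h. Re (of_nat N * to_complex x ^ (N - 1) * to_complex h))) (at x)"
    by (rule bounded_linear.has_derivative[OF bounded_linear_Re to_complex_power_has_derivative])
  moreover have "(\<lambda>h. Re (of_nat N * to_complex x ^ (N - 1) * to_complex h)) = (\<lambda>h. h \<bullet> grad_re_pow N x)"
    by (auto simp: fun_eq_iff inner_2 grad_re_pow_def re_pow_def im_pow_def to_complex_def algebra_simps)
  ultimately show ?thesis unfolding gderiv_def re_pow_def[abs_def] by simp
qed

lemma GDERIV_im_pow: "GDERIV (im_pow N) x :> grad_im_pow N x"
proof -
  have "((\<lambda>x. Im (to_complex x ^ N)) has_derivative (\<lambda>h. Im (of_nat N * to_complex x ^ (N - 1) * to_complex h))) (at x)"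
    by (rule bounded_linear.has_derivative[OF bounded_linear_Im to_complex_power_has_derivative])
  moreover have "(\<lambda>h. Im (of_nat N * to_complex x ^ (N - 1) * to_complex h)) = (\<lambda>h. h \<bullet> grad_im_pow N x)"
    by (auto simp: fun_eq_iff inner_2 grad_im_pow_def re_pow_def im_pow_def to_complex_def algebra_simps)
  ultimately show ?thesis unfolding gderiv_def im_pow_def[abs_def] by simp
qed

lemma grad_re_pow_Euler: "x \<bullet> grad_re_pow N x = real N * re_pow N x"
  by (cases N) (simp_all add: inner_2 grad_re_pow_def re_pow_Suc algebra_simps)

text \<open>The left-hand side is the derivative in the angle \<theta>.\<close>

lemma grad_re_pow_rot: "x $ 1 * grad_re_pow N x $ 2 - x $ 2 * grad_re_pow N x $ 1 = - real N * im_pow N x"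
  by (cases N) (simp_all add: grad_re_pow_def im_pow_Suc algebra_simps)

lemma grad_re_pow_grad_re_pow: "grad_re_pow N x \<bullet> grad_re_pow N x = (real N)\<^sup>2 * norm_sq x ^ (N - 1)"
  by (simp add: inner_2 grad_re_pow_def re_pow_im_pow_norm_sq[symmetric] power2_eq_square algebra_simps)

lemma grad_im_pow_grad_im_pow: "grad_im_pow N x \<bullet> grad_im_pow N x = (real N)\<^sup>2 * norm_sq x ^ (N - 1)"
  by (simp add: inner_2 grad_im_pow_def re_pow_im_pow_norm_sq[symmetric] power2_eq_square algebra_simps)

section \<open>The eigenfunction, its gradient and its Laplacian\<close>

lemma GDERIV_bessel_norm_sq: "GDERIV (\<lambda>x. bessel N (norm_sq x)) x :> (- 2 * bessel (Suc N) (norm_sq x)) *\<^sub>R x"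
  using GDERIV_DERIV_compose[OF GDERIV_norm_sq bessel_deriv[of N "norm_sq x"]] by (simp add: mult.commute)

definition wave :: "nat \<Rightarrow> real \<Rightarrow> real^2 \<Rightarrow> real" where
  "wave N c x = c * (re_pow N x * bessel N (norm_sq x)) - bessel 0 (norm_sq x)"

text \<open>Half the coefficient of \<open>x\<close> in the gradient, which comes from
  differentiating the Bessel factors; the polynomial factor contributes a further radial component
  through \<open>grad_re_pow\<close>.\<close>

definition wave_radial :: "nat \<Rightarrow> real \<Rightarrow> real^2 \<Rightarrow> real" where
  "wave_radial N c x = bessel 1 (norm_sq x) - c * (re_pow N x * bessel (Suc N) (norm_sq x))"

definition grad_wave :: "nat \<Rightarrow> real \<Rightarrow> real^2 \<Rightarrow> real^2" where
  "grad_wave N c x = (2 * wave_radial N c x) *\<^sub>R x + (c * bessel N (norm_sq x)) *\<^sub>R grad_re_pow N x"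

lemma GDERIV_cmult: "GDERIV f x :> D \<Longrightarrow> GDERIV (\<lambda>x. c * f x) x :> c *\<^sub>R D" for c :: real
  using GDERIV_mult[OF GDERIV_const[of c x]] by simp

lemma GDERIV_wave: "GDERIV (wave N c) x :> grad_wave N c x"
proof -
  have "GDERIV (\<lambda>x. c * (re_pow N x * bessel N (norm_sq x)) - bessel 0 (norm_sq x)) x :>
     c *\<^sub>R (re_pow N x *\<^sub>R ((- 2 * bessel (Suc N) (norm_sq x)) *\<^sub>R x) + bessel N (norm_sq x) *\<^sub>R grad_re_pow N x)
       - (- 2 * bessel (Suc 0) (norm_sq x)) *\<^sub>R x"
    by (intro GDERIV_diff GDERIV_cmult GDERIV_mult GDERIV_re_pow GDERIV_bessel_norm_sq)
  moreover have "c *\<^sub>R (re_pow N x *\<^sub>R ((- 2 * bessel (Suc N) (norm_sq x)) *\<^sub>R x) + bessel N (norm_sq x) *\<^sub>R grad_re_pow N x)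
       - (- 2 * bessel (Suc 0) (norm_sq x)) *\<^sub>R x = grad_wave N c x"
    by (simp add: grad_wave_def wave_radial_def vec_eq_iff algebra_simps)
  ultimately show ?thesis unfolding wave_def[abs_def] by simp
qed

lemma grad_wave: "grad (wave N c) x = grad_wave N c x"
  using GDERIV_wave by (rule grad_eqI)

lemma C_k_norm_sq: "C_k k norm_sq"
  unfolding norm_sq_def[abs_def] power2_eq_square by (intro C_k_add C_k_mult C_k_coord)

lemma C_k_re_pow_im_pow: "C_k k (re_pow N) \<and> C_k k (im_pow N)"
proof (induction N)
  case 0
  have "re_pow 0 = (\<lambda>x. 1)" "im_pow 0 = (\<lambda>x. 0)" by (simp_all add: fun_eq_iff re_pow_def im_pow_def)
  then show ?case by (simp add: C_k_const)
next
  case (Suc N)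
  have "re_pow (Suc N) = (\<lambda>x. x $ 1 * re_pow N x + - 1 * (x $ 2 * im_pow N x))" 
    "im_pow (Suc N) = (\<lambda>x. x $ 1 * im_pow N x + x $ 2 * re_pow N x)"
    by (simp_all add: fun_eq_iff re_pow_Suc im_pow_Suc)
  then show ?case using Suc by (simp only:) (intro conjI C_k_add C_k_mult C_k_coord C_k_const; simp)
qed

lemma C_k_bessel: 
  assumes "C_k k f"
  shows "C_k k (\<lambda>x. bessel N (f x))"
proof -
  define \<psi> where "\<psi> j s = (- 1) ^ j * bessel (N + j) s" for j s
  have "(\<psi> j has_real_derivative \<psi> (Suc j) t) (at t)" for j t
    unfolding \<psi>_def[abs_def] by (auto intro!: derivative_eq_intros)
  then have "C_k k (\<lambda>x. \<psi> 0 (f x))" using assms by (rule C_k_compose)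
  then show ?thesis by (simp add: \<psi>_def)
qed

lemma C_k_wave: "C_k k (wave N c)"
proof -
  have "wave N c = (\<lambda>x. c * (re_pow N x * bessel N (norm_sq x)) + - 1 * bessel 0 (norm_sq x))"
    by (simp add: fun_eq_iff wave_def)
  then show ?thesis
    using C_k_re_pow_im_pow[of k N] by (simp only:) (intro C_k_add C_k_mult C_k_const C_k_bessel C_k_norm_sq; simp)
qed

text \<open>The second derivatives of the harmonic polynomial cancel, Euler's relation evaluates the
  mixed terms, and what remains is \<open>bessel_ode\<close> for the orders 0 and N.\<close>

lemma Laplace_wave: "(\<Sum>i\<in>UNIV. grad (\<lambda>y. grad (wave N c) y $ i) x $ i) = - 4 * wave N c x"
proof -
  define s where "s = norm_sq x"
  define gA where "gA = (c * re_pow N x * 2 * bessel (Suc (Suc N)) s - 2 * bessel 2 s) *\<^sub>R x - (c * bessel (Suc N) s) *\<^sub>R grad_re_pow N x"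
  have gA: "GDERIV (wave_radial N c) x :> gA"
  proof -
    have "GDERIV (\<lambda>x. bessel 1 (norm_sq x) - c * (re_pow N x * bessel (Suc N) (norm_sq x))) x :>
       (- 2 * bessel (Suc 1) (norm_sq x)) *\<^sub>R x
        - c *\<^sub>R (re_pow N x *\<^sub>R ((- 2 * bessel (Suc (Suc N)) (norm_sq x)) *\<^sub>R x) + bessel (Suc N) (norm_sq x) *\<^sub>R grad_re_pow N x)"
      by (intro GDERIV_diff GDERIV_cmult GDERIV_mult GDERIV_re_pow GDERIV_bessel_norm_sq)
    moreover have "(- 2 * bessel (Suc 1) (norm_sq x)) *\<^sub>R x
        - c *\<^sub>R (re_pow N x *\<^sub>R ((- 2 * bessel (Suc (Suc N)) (norm_sq x)) *\<^sub>R x) + bessel (Suc N) (norm_sq x) *\<^sub>R grad_re_pow N x) = gA"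
      by (simp add: gA_def s_def vec_eq_iff algebra_simps numeral_2_eq_2)
    ultimately show ?thesis unfolding wave_radial_def[abs_def] by simp
  qed
  have coord: "GDERIV (\<lambda>y. y $ i) x :> axis i 1" for i :: 2 and x :: "real^2"
    unfolding gderiv_def by (simp add: inner_axis bounded_linear_imp_has_derivative bounded_linear_vec_nth)
  have main: "grad (\<lambda>y. grad (wave N c) y $ i) x = 2 *\<^sub>R (wave_radial N c x *\<^sub>R axis i 1 + x $ i *\<^sub>R gA)
      + c *\<^sub>R (bessel N s *\<^sub>R H + grad_re_pow N x $ i *\<^sub>R ((- 2 * bessel (Suc N) s) *\<^sub>R x))"
    if H: "GDERIV (\<lambda>y. grad_re_pow N y $ i) x :> H" for i H
  proof (rule grad_eqI)
    have "(\<lambda>y. grad (wave N c) y $ i) = (\<lambda>y. 2 * (wave_radial N c y * y $ i) + c * (bessel N (norm_sq y) * grad_re_pow N y $ i))"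
      by (simp add: fun_eq_iff grad_wave grad_wave_def)
    moreover have "GDERIV (\<lambda>y. 2 * (wave_radial N c y * y $ i) + c * (bessel N (norm_sq y) * grad_re_pow N y $ i)) x :>
       2 *\<^sub>R (wave_radial N c x *\<^sub>R axis i 1 + x $ i *\<^sub>R gA)
      + c *\<^sub>R (bessel N s *\<^sub>R H + grad_re_pow N x $ i *\<^sub>R ((- 2 * bessel (Suc N) s) *\<^sub>R x))"
      unfolding s_def by (intro GDERIV_add GDERIV_cmult GDERIV_mult gA coord H GDERIV_bessel_norm_sq)
    ultimately show "GDERIV (\<lambda>y. grad (wave N c) y $ i) x :> 2 *\<^sub>R (wave_radial N c x *\<^sub>R axis i 1 + x $ i *\<^sub>R gA)
      + c *\<^sub>R (bessel N s *\<^sub>R H + grad_re_pow N x $ i *\<^sub>R ((- 2 * bessel (Suc N) s) *\<^sub>R x))" by simp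
  qed
  have H1: "GDERIV (\<lambda>y. grad_re_pow N y $ 1) x :> real N *\<^sub>R grad_re_pow (N - 1) x"
    using GDERIV_cmult[OF GDERIV_re_pow, of "real N" "N - 1" x] by (simp add: grad_re_pow_def)
  have H2: "GDERIV (\<lambda>y. grad_re_pow N y $ 2) x :> (- real N) *\<^sub>R grad_im_pow (N - 1) x"
    using GDERIV_cmult[OF GDERIV_im_pow, of "- real N" "N - 1" x] by (simp add: grad_re_pow_def)
  define E where "E = x $ 1 * grad_re_pow N x $ 1 + x $ 2 * grad_re_pow N x $ 2"
  have E: "E = real N * re_pow N x" using grad_re_pow_Euler[of x N] by (simp add: E_def inner_2)
  have s: "s = x $ 1 * x $ 1 + x $ 2 * x $ 2" by (simp add: s_def norm_sq_def power2_eq_square)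
  have "(\<Sum>i\<in>UNIV. grad (\<lambda>y. grad (wave N c) y $ i) x $ i)
    = 4 * wave_radial N c x + 2 * (c * re_pow N x * 2 * bessel (Suc (Suc N)) s - 2 * bessel 2 s) * s
      - 4 * c * bessel (Suc N) s * E"
    unfolding sum_2 main[OF H1] main[OF H2] gA_def E_def s
    by (simp add: axis_def grad_re_pow_def[of "N - Suc 0"] grad_im_pow_def[of "N - Suc 0"] algebra_simps)
  also have "\<dots> = 4 * (bessel 1 s - s * bessel 2 s) + 4 * (c * re_pow N x) *
      (s * bessel (Suc (Suc N)) s - real (Suc N) * bessel (Suc N) s)"
    unfolding E by (simp add: wave_radial_def s_def[symmetric] algebra_simps)
  also have "\<dots> = 4 * bessel 0 s + 4 * (c * re_pow N x) * (- bessel N s)"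
  proof -
    have "bessel 1 s - s * bessel 2 s = bessel 0 s" using bessel_ode[of s 0] by (simp add: numeral_2_eq_2)
    moreover have "s * bessel (Suc (Suc N)) s - real (Suc N) * bessel (Suc N) s = - bessel N s"
      using bessel_ode[of s N] by linarith
    ultimately show ?thesis by simp
  qed
  also have "\<dots> = - 4 * wave N c x" by (simp add: wave_def s_def algebra_simps)
  finally show ?thesis .
qed

text \<open>The function is built from polynomials and entire series, so the expansion at any point
  converges in a ball of radius 1. Nonnegative bounds are carried along because composition requires
  them.\<close>

lemma real_analytic_wave: "real_analytic_on (wave N c) S"
proof (rule series_bound_imp_real_analytic)
  fix p :: "real^2"
  have one: "(1::real) > 0" by simp
  have x1: "\<exists>B\<ge>0. series_bound 1 p B (\<lambda>x. x $ 1)" and x2: "\<exists>B\<ge>0. series_bound 1 p B (\<lambda>x. x $ 2)"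
    using series_bound_add[OF one series_bound_monomial[OF one, of p 1 1 0] series_bound_const[OF one, of p "p $ 1"]]
      series_bound_add[OF one series_bound_monomial[OF one, of p 1 0 1] series_bound_const[OF one, of p "p $ 2"]]
    by (auto intro!: exI[of _ "1 + \<bar>_\<bar>"])
  have const: "\<exists>B\<ge>0. series_bound 1 p B (\<lambda>x. c)" for c using series_bound_const[OF one, of p c] by (intro exI[of _ "\<bar>c\<bar>"]) auto
  have mult: "\<exists>B\<ge>0. series_bound 1 p B (\<lambda>x. f x * g x)" if "\<exists>B\<ge>0. series_bound 1 p B f" "\<exists>B\<ge>0. series_bound 1 p B g" for f g
    using that series_bound_mult[OF one] by (meson mult_nonneg_nonneg)
  have add: "\<exists>B\<ge>0. series_bound 1 p B (\<lambda>x. f x + g x)" if "\<exists>B\<ge>0. series_bound 1 p B f" "\<exists>B\<ge>0. series_bound 1 p B g" for f g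
    using that series_bound_add[OF one] by (meson add_nonneg_nonneg)
  have diff: "\<exists>B\<ge>0. series_bound 1 p B (\<lambda>x. f x - g x)" if "\<exists>B\<ge>0. series_bound 1 p B f" "\<exists>B\<ge>0. series_bound 1 p B g" for f g
    using add[OF that(1) mult[OF const[of "- 1"] that(2)]] by simp
  have norm_sq: "\<exists>B\<ge>0. series_bound 1 p B norm_sq"
    unfolding norm_sq_def[abs_def] power2_eq_square by (intro add mult x1 x2)
  have bessel: "\<exists>B\<ge>0. series_bound 1 p B (\<lambda>x. bessel n (norm_sq x))" for n
  proof -
    obtain A where A: "A \<ge> 0" "series_bound 1 p A norm_sq" using norm_sq by blast
    have s_saddle: "summable (\<lambda>k. \<bar>(- 1) ^ k / (fact k * fact (n + k))\<bar> * A ^ k)"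
    proof (rule summable_comparison_test')
      show "summable (\<lambda>k. A ^ k / fact k)"
        using summable_exp[of A] by (simp add: divide_inverse mult.commute)
      show "norm (\<bar>(- 1) ^ k / (fact k * fact (n + k))\<bar> * A ^ k) \<le> A ^ k / fact k" for k
        using mult_right_mono[OF bessel_coeff_bound[of k n], of "A ^ k"] A(1) by (simp add: abs_mult)
    qed
    from series_bound_compose[OF one A(2,1) s_saddle]
    have "series_bound 1 p (\<Sum>k. \<bar>(- 1) ^ k / (fact k * fact (n + k))\<bar> * A ^ k) (\<lambda>x. bessel n (norm_sq x))"
      unfolding bessel_def .
    moreover have "0 \<le> (\<Sum>k. \<bar>(- 1) ^ k / (fact k * fact (n + k))\<bar> * A ^ k)"
      using A(1) by (intro suminf_nonneg s_saddle) auto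
    ultimately show ?thesis by blast
  qed
  have hPQ: "(\<exists>B\<ge>0. series_bound 1 p B (re_pow n)) \<and> (\<exists>B\<ge>0. series_bound 1 p B (im_pow n))" for n
  proof (induction n)
    case 0
    have "re_pow 0 = (\<lambda>x. 1)" "im_pow 0 = (\<lambda>x. 0)" by (simp_all add: fun_eq_iff re_pow_def im_pow_def)
    then show ?case by (simp only:) (intro conjI const)
  next
    case (Suc n)
    have "re_pow (Suc n) = (\<lambda>x. x $ 1 * re_pow n x - x $ 2 * im_pow n x)"
      "im_pow (Suc n) = (\<lambda>x. x $ 1 * im_pow n x + x $ 2 * re_pow n x)"
      by (simp_all add: fun_eq_iff re_pow_Suc im_pow_Suc)
    then show ?case
      using conjunct1[OF Suc] conjunct2[OF Suc] by (simp only:) (intro conjI add diff mult x1 x2)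
  qed
  have "\<exists>B\<ge>0. series_bound 1 p B (wave N c)"
    unfolding wave_def[abs_def] by (intro diff mult const bessel conjunct1[OF hPQ])
  then show "\<exists>B. series_bound 1 p B (wave N c)" by blast
qed simp

section \<open>Gradient curves\<close>

text \<open>\<open>V\<close> is a Lyapunov function: its derivative along the flow of -
  \<open>grad u\<close> is -(gV . \<open>grad u\<close>). The time set is general so that forward
  and backward half-lines are both covered.\<close>

lemma mono_along_gradient_curve:
  assumes \<gamma>: "gradient_curve \<Omega> u T \<gamma>" and T: "{s..t} \<subseteq> T" "s \<le> t"
    and V: "\<And>y. y \<in> closure \<Omega> \<Longrightarrow> GDERIV V y :> gV y" "\<And>y. y \<in> closure \<Omega> \<Longrightarrow> 0 \<le> gV y \<bullet> grad u y"
  shows "V (\<gamma> t) \<le> V (\<gamma> s)"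
proof -
  have mem: "\<gamma> x \<in> closure \<Omega>" and D: "(\<gamma> has_vector_derivative - grad u (\<gamma> x)) (at x within T)" if "x \<in> {s..t}" for x
    using \<gamma> T that unfolding gradient_curve_def by auto
  have DV: "((\<lambda>x. V (\<gamma> x)) has_real_derivative - (gV (\<gamma> x) \<bullet> grad u (\<gamma> x))) (at x within {s..t})" if "x \<in> {s..t}" for x
  proof -
    have "(\<gamma> has_derivative (\<lambda>h. h *\<^sub>R - grad u (\<gamma> x))) (at x within {s..t})"
      using has_vector_derivative_within_subset[OF D[OF that] T(1)] by (simp add: has_vector_derivative_def)
    from has_derivative_compose[OF this V(1)[OF mem[OF that], unfolded gderiv_def]]
    show ?thesis unfolding has_field_derivative_def
      by (rule back_subst[of "\<lambda>f. (_ has_derivative f) _"]) (simp add: fun_eq_iff inner_commute)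
  qed
  show ?thesis
  proof (rule DERIV_nonpos_imp_decreasing_open[OF T(2)])
    show "continuous_on {s..t} (\<lambda>x. V (\<gamma> x))"
      unfolding continuous_on_eq_continuous_within using DV DERIV_continuous by blast
    fix x assume x: "s < x" "x < t"
    then have "((\<lambda>x. V (\<gamma> x)) has_real_derivative - (gV (\<gamma> x) \<bullet> grad u (\<gamma> x))) (at x)"
      using DV[of x] by (simp add: at_within_Icc_at)
    then show "\<exists>y. ((\<lambda>x. V (\<gamma> x)) has_real_derivative y) (at x) \<and> y \<le> 0"
      using V(2)[OF mem[of x]] x by (intro exI conjI) auto
  qed
qed

lemma stable_set_ge:
  assumes "x \<in> stable_set \<Omega> u r" and u: "\<And>y. GDERIV u y :> grad u y"
  shows "u r \<le> u x"
proof -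
  obtain \<gamma> where \<gamma>: "\<gamma> 0 = x" "gradient_curve \<Omega> u {0..} \<gamma>" "(\<gamma> \<longlongrightarrow> r) at_top"
    using assms(1) unfolding stable_set_def by blast
  have "isCont u r" using u[of r] has_derivative_continuous unfolding gderiv_def by blast
  then have "((\<lambda>t. u (\<gamma> t)) \<longlongrightarrow> u r) at_top" using \<gamma>(3) isCont_tendsto_compose by blast
  moreover have "\<forall>\<^sub>F t in at_top. u (\<gamma> t) \<le> u x"
    using eventually_ge_at_top[of 0]
  proof (rule eventually_mono)
    fix t :: real assume "0 \<le> t"
    then show "u (\<gamma> t) \<le> u x"
      using mono_along_gradient_curve[OF \<gamma>(2), of 0 t u "grad u"] u \<gamma>(1) by auto
  qed
  ultimately show ?thesis by (rule tendsto_upperbound) simp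
qed

text \<open>Along the curve \<open>V\<close> starts, in the limit of time minus infinity, from
  \<open>V r\<close> and does not increase until it reaches \<open>x\<close>.\<close>

lemma unstable_set_le:
  assumes "x \<in> unstable_set \<Omega> u r" and cont: "isCont V r"
    and V: "\<And>y. y \<in> closure \<Omega> \<Longrightarrow> GDERIV V y :> gV y" "\<And>y. y \<in> closure \<Omega> \<Longrightarrow> 0 \<le> gV y \<bullet> grad u y"
  shows "V x \<le> V r"
proof -
  obtain \<gamma> where \<gamma>: "\<gamma> 0 = x" "gradient_curve \<Omega> u {..0} \<gamma>" "(\<gamma> \<longlongrightarrow> r) at_bot"
    using assms(1) unfolding unstable_set_def by blast
  have "((\<lambda>t. V (\<gamma> t)) \<longlongrightarrow> V r) at_bot" using \<gamma>(3) cont isCont_tendsto_compose by blast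
  moreover have "\<forall>\<^sub>F t in at_bot. V x \<le> V (\<gamma> t)"
    using eventually_le_at_bot[of 0]
  proof (rule eventually_mono)
    fix t :: real assume "t \<le> 0"
    then show "V x \<le> V (\<gamma> t)"
      using mono_along_gradient_curve[OF \<gamma>(2), of t 0 V gV] V \<gamma>(1) by auto
  qed
  ultimately show ?thesis by (rule tendsto_lowerbound) simp
qed

section \<open>The eigenfunction in polar coordinates\<close>

lemma to_complex_scaleR: "to_complex (t *\<^sub>R x) = of_real t * to_complex x"
  by (simp add: to_complex_def complex_eq_iff)

lemma re_pow_scaleR: "re_pow N (t *\<^sub>R x) = t ^ N * re_pow N x"
proof -
  have "re_pow N (t *\<^sub>R x) = Re (of_real (t ^ N) * to_complex x ^ N)"
    by (simp only: re_pow_def to_complex_scaleR power_mult_distrib of_real_power)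
  then show ?thesis by (simp add: re_pow_def del: of_real_power)
qed

lemma norm_sq_scaleR: "norm_sq (t *\<^sub>R x) = t\<^sup>2 * norm_sq x"
  by (simp add: norm_sq_norm power_mult_distrib)

lemma norm_sq_nonneg: "norm_sq x \<ge> 0"
  by (simp add: norm_sq_norm)

text \<open>cos(N \<theta>) for N = 2 M, without reference to an angle; r^N is
  \<open>norm_sq x ^ M\<close> since N is even.\<close>

definition cos_angle :: "nat \<Rightarrow> real^2 \<Rightarrow> real" where
  "cos_angle M x = re_pow (2 * M) x / norm_sq x ^ M"

text \<open>The values of the eigenfunction along a ray as a function of s = r^2, with k = c cos(N
  \<theta>) constant on the ray.\<close>

definition profile :: "nat \<Rightarrow> real \<Rightarrow> real \<Rightarrow> real" where
  "profile M k s = - bessel 0 s + k * angular M s"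

definition profile' :: "nat \<Rightarrow> real \<Rightarrow> real \<Rightarrow> real" where
  "profile' M k s = bessel 1 s + k * angular' M s"

definition ray :: "real^2 \<Rightarrow> real \<Rightarrow> real^2" where
  "ray x \<sigma> = sqrt (\<sigma> / norm_sq x) *\<^sub>R x"

lemma profile_deriv: "(profile M k has_real_derivative profile' M k s) (at s)"
  unfolding profile_def[abs_def] profile'_def
  using DERIV_add[OF DERIV_minus[OF bessel_0_deriv[of s]] DERIV_cmult[OF angular_deriv[of M s], of k]] by simp

lemma re_pow_cos_angle: "norm_sq x > 0 \<Longrightarrow> re_pow (2 * M) x = cos_angle M x * norm_sq x ^ M"
  by (simp add: cos_angle_def)

lemma cos_angle_bound: "\<bar>cos_angle M x\<bar> \<le> 1"
proof -
  have "(re_pow (2 * M) x)\<^sup>2 \<le> (norm_sq x ^ M)\<^sup>2"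
    using re_pow_im_pow_norm_sq[of "2 * M" x] by (simp add: power_mult[symmetric] mult.commute) (metis zero_le_power2 le_add_same_cancel1)
  then have "\<bar>re_pow (2 * M) x\<bar> \<le> norm_sq x ^ M"
    using norm_sq_nonneg by (simp add: abs_le_square_iff[symmetric])
  then show ?thesis using norm_sq_nonneg[of x] by (cases "norm_sq x = 0"; cases M) (auto simp: cos_angle_def field_simps)
qed

lemma cos_angle_cases:
  assumes "norm_sq x > 0" "im_pow (2 * M) x = 0"
  shows "cos_angle M x = 1 \<or> cos_angle M x = - 1"
proof -
  have "(re_pow (2 * M) x)\<^sup>2 = (norm_sq x ^ M)\<^sup>2"
    using re_pow_im_pow_norm_sq[of "2 * M" x] assms(2) by (simp add: power_mult[symmetric] mult.commute)
  then have "re_pow (2 * M) x = norm_sq x ^ M \<or> re_pow (2 * M) x = - (norm_sq x ^ M)" by (simp add: power2_eq_iff)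
  then show ?thesis using assms(1) by (auto simp: cos_angle_def)
qed

lemma cos_angle_im_pow:
  assumes "norm_sq x > 0" "cos_angle M x = 1 \<or> cos_angle M x = - 1"
  shows "im_pow (2 * M) x = 0"
proof -
  have "(re_pow (2 * M) x)\<^sup>2 = (norm_sq x ^ M)\<^sup>2" using re_pow_cos_angle[OF assms(1), of M] assms(2) by auto
  then show ?thesis using re_pow_im_pow_norm_sq[of "2 * M" x] by (simp add: power_mult[symmetric] mult.commute)
qed

lemma wave_profile: "norm_sq x > 0 \<Longrightarrow> wave (2 * M) c x = profile M (c * cos_angle M x) (norm_sq x)"
  by (simp add: wave_def profile_def angular_def re_pow_cos_angle[of x M])

lemma ray_props:
  assumes "norm_sq x > 0" "\<sigma> > 0"
  shows "norm_sq (ray x \<sigma>) = \<sigma>" "cos_angle M (ray x \<sigma>) = cos_angle M x"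
    "wave (2 * M) c (ray x \<sigma>) = profile M (c * cos_angle M x) \<sigma>"
proof -
  show r: "norm_sq (ray x \<sigma>) = \<sigma>" using assms by (simp add: ray_def norm_sq_scaleR)
  have "sqrt (\<sigma> / norm_sq x) ^ (2 * M) = (\<sigma> / norm_sq x) ^ M" using assms by (simp add: power_mult)
  then have "re_pow (2 * M) (ray x \<sigma>) = (\<sigma> / norm_sq x) ^ M * re_pow (2 * M) x"
    by (simp add: ray_def re_pow_scaleR)
  then show k: "cos_angle M (ray x \<sigma>) = cos_angle M x"
    unfolding cos_angle_def r using assms by (simp add: power_divide)
  show "wave (2 * M) c (ray x \<sigma>) = profile M (c * cos_angle M x) \<sigma>"
    using wave_profile[of "ray x \<sigma>"] r k assms(2) by simp
qed

lemma ray_self: "norm_sq x > 0 \<Longrightarrow> ray x (norm_sq x) = x"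
  by (simp add: ray_def)

text \<open>Pairing with x is the operator r d/dr, which equals 2 s d/ds for s = r^2.\<close>

lemma grad_wave_radial:
  assumes "norm_sq x > 0" "M \<ge> 1"
  shows "x \<bullet> grad_wave (2 * M) c x = 2 * norm_sq x * profile' M (c * cos_angle M x) (norm_sq x)"
proof -
  define s where "s = norm_sq x"
  have p: "s ^ M = s * s ^ (M - 1)" using assms(2) by (simp add: power_eq_if)
  have "x \<bullet> grad_wave (2 * M) c x = 2 * wave_radial (2 * M) c x * s + c * bessel (2 * M) s * (real (2 * M) * re_pow (2 * M) x)"
    by (simp add: grad_wave_def inner_add_right norm_sq_inner grad_re_pow_Euler s_def)
  also have "\<dots> = 2 * s * profile' M (c * cos_angle M x) s"
    unfolding wave_radial_def s_def[symmetric] re_pow_cos_angle[OF assms(1), folded s_def] profile'_def angular'_def p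
    by (simp add: algebra_simps)
  finally show ?thesis by (simp add: s_def)
qed

text \<open>The angular derivative sees only the factor cos(N \<theta>).\<close>

lemma grad_wave_rot: "x $ 1 * grad_wave N c x $ 2 - x $ 2 * grad_wave N c x $ 1 = - c * real N * bessel N (norm_sq x) * im_pow N x"
proof -
  have "x $ 1 * grad_wave N c x $ 2 - x $ 2 * grad_wave N c x $ 1
    = c * bessel N (norm_sq x) * (x $ 1 * grad_re_pow N x $ 2 - x $ 2 * grad_re_pow N x $ 1)"
    by (simp add: grad_wave_def algebra_simps)
  then show ?thesis unfolding grad_re_pow_rot by simp
qed

text \<open>Where sin(N \<theta>) = 0 the angular derivative vanishes, so the gradient is radial and
  its radial component determines it. The rays with cos(N \<theta>) = 1 or -1 are thus invariant
  under the flow.\<close>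

lemma grad_wave_on_ray:
  assumes "norm_sq x > 0" "M \<ge> 1" "im_pow (2 * M) x = 0"
  shows "grad_wave (2 * M) c x = (2 * profile' M (c * cos_angle M x) (norm_sq x)) *\<^sub>R x"
proof -
  define g where "g = grad_wave (2 * M) c x"
  define p where "p = profile' M (c * cos_angle M x) (norm_sq x)"
  have 1: "x $ 1 * g $ 1 + x $ 2 * g $ 2 = 2 * norm_sq x * p"
    using grad_wave_radial[OF assms(1,2), of c] by (simp add: g_def p_def inner_2)
  have 2: "x $ 1 * g $ 2 - x $ 2 * g $ 1 = 0"
    using grad_wave_rot[of x "2 * M" c] assms(3) by (simp add: g_def)
  have s: "norm_sq x = x $ 1 * x $ 1 + x $ 2 * x $ 2" by (simp add: norm_sq_def power2_eq_square)
  have "norm_sq x * g $ 1 = x $ 1 * (2 * norm_sq x * p)" "norm_sq x * g $ 2 = x $ 2 * (2 * norm_sq x * p)"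
    unfolding 1[symmetric] using 2 unfolding s by algebra+
  then have "g $ 1 = 2 * p * x $ 1" "g $ 2 = 2 * p * x $ 2" using assms(1) by auto
  then show ?thesis by (simp add: g_def[symmetric] p_def[symmetric] vec_eq_iff forall_2)
qed

definition grad_cos_angle :: "nat \<Rightarrow> real^2 \<Rightarrow> real^2" where
  "grad_cos_angle M x = (1 / norm_sq x ^ M) *\<^sub>R grad_re_pow (2 * M) x - (2 * real M * re_pow (2 * M) x / norm_sq x ^ Suc M) *\<^sub>R x"

lemma GDERIV_cos_angle:
  assumes "norm_sq x > 0" "M \<ge> 1"
  shows "GDERIV (cos_angle M) x :> grad_cos_angle M x"
proof -
  have "((\<lambda>s. inverse (s ^ M)) has_real_derivative - real M / norm_sq x ^ Suc M) (at (norm_sq x))"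
  proof -
    have "((\<lambda>s. inverse (s ^ M)) has_real_derivative
        - (inverse (norm_sq x ^ M) * (real M * norm_sq x ^ (M - 1)) * inverse (norm_sq x ^ M))) (at (norm_sq x))"
      using assms(1) by (auto intro!: derivative_eq_intros)
    moreover have "norm_sq x ^ M = norm_sq x * norm_sq x ^ (M - 1)" using assms(2) by (simp add: power_eq_if)
    moreover have "inverse (s * q) * (n * q) * inverse (s * q) = n / (s * (s * q))" if "s > 0" "q > 0" for s q n :: real
      using that by (simp add: field_simps)
    ultimately show ?thesis using assms(1) by simp
  qed
  from GDERIV_mult[OF GDERIV_re_pow GDERIV_DERIV_compose[OF GDERIV_norm_sq this], of "2 * M"]
  have "GDERIV (\<lambda>x. re_pow (2 * M) x * inverse (norm_sq x ^ M)) x :>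
     re_pow (2 * M) x *\<^sub>R ((- real M / norm_sq x ^ Suc M) *\<^sub>R 2 *\<^sub>R x) + inverse (norm_sq x ^ M) *\<^sub>R grad_re_pow (2 * M) x" .
  then show ?thesis
    unfolding cos_angle_def[abs_def] grad_cos_angle_def
    by (simp add: divide_inverse algebra_simps del: power_Suc)
qed

text \<open>Along the flow only the angular part of the gradient moves \<open>cos_angle\<close>; it is the gradient
  of \<open>c * re_pow * bessel\<close>, so that the sign is that of \<open>c\<close>.\<close>

lemma grad_cos_angle_grad_wave_nonneg:
  assumes "norm_sq x > 0" "M \<ge> 1" "c \<ge> 0" "bessel (2 * M) (norm_sq x) \<ge> 0"
  shows "0 \<le> grad_cos_angle M x \<bullet> grad_wave (2 * M) c x"
proof -
  define s P A B where "s = norm_sq x" and "P = re_pow (2 * M) x" and "A = wave_radial (2 * M) c x" and "B = c * bessel (2 * M) (norm_sq x)"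
  define e where "e = s ^ (2 * M - 1)"
  have s: "s > 0" using assms(1) by (simp add: s_def)
  have es: "s * e = s ^ (2 * M)"
    using assms(2) by (simp add: e_def power_Suc[symmetric] del: power_Suc)
  have "grad_cos_angle M x \<bullet> grad_wave (2 * M) c x =
     (1 / s ^ M) * (2 * A * (2 * real M * P) + B * ((2 * real M)\<^sup>2 * e))
      - (2 * real M * P / s ^ Suc M) * (2 * A * s + B * (2 * real M * P))"
    unfolding grad_cos_angle_def grad_wave_def s_def P_def A_def B_def e_def
    by (simp only: inner_diff_left inner_add_right inner_scaleR_left inner_scaleR_right grad_re_pow_grad_re_pow grad_re_pow_Euler
        norm_sq_inner[of x] inner_commute[of "grad_re_pow _ _" x]) (simp add: algebra_simps)
  \<comment> \<open>The radial coefficient A drops out, because \<open>cos_angle\<close> is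
    homogeneous of degree 0.\<close>
  also have "\<dots> = B * (2 * real M)\<^sup>2 / s ^ Suc M * (s * e - P\<^sup>2)"
    using s by (simp add: field_simps power2_eq_square)
  also have "s * e - P\<^sup>2 = (im_pow (2 * M) x)\<^sup>2"
    using re_pow_im_pow_norm_sq[of "2 * M" x, folded s_def P_def] es by linarith
  also have "B * (2 * real M)\<^sup>2 / s ^ Suc M * (im_pow (2 * M) x)\<^sup>2 \<ge> 0"
    using s assms(3,4) by (simp add: B_def)
  finally show ?thesis .
qed

section \<open>Saddles\<close>

lemma peaked_strict:
  assumes "peaked a b s0 (profile' M k)"
  shows "\<And>s t. a \<le> s \<Longrightarrow> s < t \<Longrightarrow> t \<le> s0 \<Longrightarrow> profile M k s < profile M k t"
    and "\<And>s t. s0 \<le> s \<Longrightarrow> s < t \<Longrightarrow> t \<le> b \<Longrightarrow> profile M k t < profile M k s"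
proof -
  have cont: "continuous_on {s..t} (profile M k)" for s t
    using profile_deriv by (meson DERIV_continuous_on has_field_derivative_at_within)
  show "profile M k s < profile M k t" if "a \<le> s" "s < t" "t \<le> s0" for s t
    by (rule DERIV_pos_imp_increasing_open[OF that(2) _ cont])
      (use assms that profile_deriv[of M k] in \<open>force simp: peaked_def\<close>)
  show "profile M k t < profile M k s" if "s0 \<le> s" "s < t" "t \<le> b" for s t
    by (rule DERIV_neg_imp_decreasing_open[OF that(2) _ cont])
      (use assms that profile_deriv[of M k] in \<open>force simp: peaked_def\<close>)
qed

lemma peaked_max:
  assumes "peaked a b s0 (profile' M k)" "a \<le> s" "s \<le> b" "s \<noteq> s0"
  shows "profile M k s < profile M k s0"
  using peaked_strict[OF assms(1)] assms by (cases s s0 rule: linorder_cases) (auto simp: peaked_def)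

lemma peaked_segment:
  assumes "peaked a b s0 (profile' M k)" "a \<le> s" "s \<le> b" "a \<le> t" "t \<le> b" "\<sigma> \<in> closed_segment s t"
    and pos: "profile M k s > 0" "profile M k t > 0"
  shows "profile M k \<sigma> > 0"
proof -
  have *: "profile M k \<sigma> > 0" if "s \<le> \<sigma>" "\<sigma> \<le> t" "a \<le> s" "t \<le> b" "profile M k s > 0" "profile M k t > 0" for s t
  proof (cases "\<sigma> \<le> s0")
    case True
    then show ?thesis using peaked_strict(1)[OF assms(1), of s \<sigma>] that by (cases "s = \<sigma>") auto
  next
    case False
    then show ?thesis using peaked_strict(2)[OF assms(1), of \<sigma> t] that by (cases "\<sigma> = t") auto
  qed
  show ?thesis
    using *[of s t] *[of t s] assms by (auto simp: closed_segment_eq_real_ivl split: if_splits)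
qed

text \<open>Everything is required for all |k| \<le> c since k = c cos(N \<theta>) runs through this
  range. The bound on b makes \<open>bessel (2 * M)\<close> positive throughout the annulus.\<close>

locale annulus =
  fixes M :: nat and a b m c :: real
  assumes M: "M \<ge> 1" and ord: "0 < a" "a < m" "m < b" "b < real (Suc (2 * M))" and c: "c > 0"
    and bd: "\<And>k. \<bar>k\<bar> \<le> c \<Longrightarrow> profile M k a < 0" "\<And>k. \<bar>k\<bar> \<le> c \<Longrightarrow> profile M k b < 0"
    and mid: "\<And>k. \<bar>k\<bar> \<le> c \<Longrightarrow> profile M k m > 0"
    and peak: "\<And>k. \<bar>k\<bar> \<le> c \<Longrightarrow> \<exists>s0. peaked a b s0 (profile' M k)"
begin

definition u :: "real^2 \<Rightarrow> real" where "u = wave (2 * M) c"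

text \<open>The two circles s = a and s = b, on which \<open>u\<close> is negative, separate this
  set from the rest of the region where \<open>u\<close> is positive.\<close>

definition \<Omega> :: "(real^2) set" where
  "\<Omega> = {x. a < norm_sq x} \<inter> {x. norm_sq x < b} \<inter> {x. 0 < u x}"

definition s_max :: real where "s_max = (SOME s. peaked a b s (profile' M c))"
definition s_saddle :: real where "s_saddle = (SOME s. peaked a b s (profile' M (- c)))"

lemma s_max: "peaked a b s_max (profile' M c)"
  unfolding s_max_def by (rule someI_ex) (use peak[of c] c in auto)

lemma s_saddle: "peaked a b s_saddle (profile' M (- c))"
  unfolding s_saddle_def by (rule someI_ex) (use peak[of "- c"] c in auto)

lemma amplitude_le: "\<bar>c * cos_angle M x\<bar> \<le> c"
  using mult_left_mono[OF cos_angle_bound[of M x], of c] c by (simp add: abs_mult)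

lemma grad_u: "grad u x = grad_wave (2 * M) c x"
  unfolding u_def by (rule grad_wave)

lemma GDERIV_u: "GDERIV u x :> grad u x"
  unfolding grad_u unfolding u_def by (rule GDERIV_wave)

lemma u_profile: "norm_sq x > 0 \<Longrightarrow> u x = profile M (c * cos_angle M x) (norm_sq x)"
  unfolding u_def by (rule wave_profile)

lemma cont_u: "continuous_on S u"
  unfolding u_def using C_k_wave C_k_continuous by blast

lemma cont_norm_sq: "continuous_on S norm_sq"
  using C_k_norm_sq C_k_continuous by blast

lemma cont_re_pow: "continuous_on S (re_pow n)"
  using C_k_re_pow_im_pow C_k_continuous by blast

section \<open>The domain\<close>

lemma bessel_pos': "0 < s \<Longrightarrow> s \<le> b \<Longrightarrow> bessel (2 * M) s > 0"
  using ord by (intro bessel_pos) auto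

lemma angular_pos: "0 < s \<Longrightarrow> s \<le> b \<Longrightarrow> angular M s > 0"
  using bessel_pos' by (simp add: angular_def)

lemma open_\<Omega>: "open \<Omega>"
  unfolding \<Omega>_def by (intro open_Int open_Collect_less cont_u cont_norm_sq continuous_on_const)

lemma \<Omega>D: "x \<in> \<Omega> \<Longrightarrow> a < norm_sq x" "x \<in> \<Omega> \<Longrightarrow> norm_sq x < b" "x \<in> \<Omega> \<Longrightarrow> norm_sq x > 0" "x \<in> \<Omega> \<Longrightarrow> u x > 0"
  using ord by (auto simp: \<Omega>_def)

lemma closure_\<Omega>: 
  assumes "x \<in> closure \<Omega>"
  shows "a \<le> norm_sq x" "norm_sq x \<le> b" "u x \<ge> 0" "norm_sq x > 0"
proof -
  have "closed ({x. a \<le> norm_sq x} \<inter> {x. norm_sq x \<le> b} \<inter> {x. 0 \<le> u x})"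
    by (intro closed_Int closed_Collect_le cont_u cont_norm_sq continuous_on_const)
  moreover have "\<Omega> \<subseteq> {x. a \<le> norm_sq x} \<inter> {x. norm_sq x \<le> b} \<inter> {x. 0 \<le> u x}"
    by (auto simp: \<Omega>_def)
  ultimately have "closure \<Omega> \<subseteq> {x. a \<le> norm_sq x} \<inter> {x. norm_sq x \<le> b} \<inter> {x. 0 \<le> u x}"
    by (rule closure_minimal[rotated])
  then show "a \<le> norm_sq x" "norm_sq x \<le> b" "u x \<ge> 0" "norm_sq x > 0" using assms ord by auto
qed

text \<open>All profiles are negative at a and b, whereas \<open>u\<close> is nonnegative on the
  closure. So only the condition on \<open>u\<close> can fail at a boundary point, and
  \<open>u\<close> vanishes there.\<close>

lemma closure_\<Omega>_strict:
  assumes "x \<in> closure \<Omega>"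
  shows "a < norm_sq x" "norm_sq x < b"
proof -
  note * = closure_\<Omega>[OF assms]
  have "norm_sq x \<noteq> a" "norm_sq x \<noteq> b" using * u_profile[of x] bd[OF amplitude_le[of x]] by auto
  then show "a < norm_sq x" "norm_sq x < b" using * by auto
qed

lemma frontier_\<Omega>: "x \<in> frontier \<Omega> \<Longrightarrow> u x = 0"
proof -
  assume "x \<in> frontier \<Omega>"
  then have "x \<in> closure \<Omega>" "x \<notin> \<Omega>" using open_\<Omega> by (auto simp: frontier_def interior_open)
  then show ?thesis using closure_\<Omega>(3)[of x] closure_\<Omega>_strict[of x] by (auto simp: \<Omega>_def)
qed

lemma bounded_\<Omega>: "bounded \<Omega>"
proof -
  have "\<Omega> \<subseteq> ball 0 (sqrt b)"
    by (auto simp: \<Omega>_def norm_sq_norm) (metis abs_norm_cancel real_sqrt_abs real_sqrt_less_iff)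
  then show ?thesis using bounded_ball bounded_subset by blast
qed

lemma ray_in_\<Omega>:
  assumes "norm_sq x > 0" "a < \<sigma>" "\<sigma> < b" "profile M (c * cos_angle M x) \<sigma> > 0"
  shows "ray x \<sigma> \<in> \<Omega>"
  using ray_props(1)[of x \<sigma>] ray_props(3)[of x \<sigma> M c] assms ord by (simp add: \<Omega>_def u_def)

lemma ray_segment:
  assumes "norm_sq x > 0" "a < \<sigma>" "\<sigma> < b" "a < s" "s < b" "t \<in> closed_segment s \<sigma>"
    "profile M (c * cos_angle M x) \<sigma> > 0" "profile M (c * cos_angle M x) s > 0"
  shows "ray x t \<in> \<Omega>"
proof (rule ray_in_\<Omega>[OF assms(1)])
  show "a < t" "t < b" using assms by (auto simp: closed_segment_eq_real_ivl split: if_splits)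
  show "profile M (c * cos_angle M x) t > 0"
    using peak[OF amplitude_le[of x]] peaked_segment[OF _ _ _ _ _ assms(6)] assms by fastforce
qed

text \<open>The circle s = m lies in the domain, and each point is joined to it inside the domain
  along its own ray.\<close>

lemma connected_\<Omega>: "connected \<Omega>"
proof -
  define C where "C = {x. norm_sq x = m}"
  have m: "m > 0" using ord by simp
  have "C = sphere 0 (sqrt m)"
    using m by (auto simp: C_def norm_sq_norm real_sqrt_unique)
  then have "connected C" using connected_sphere[of "0 :: real^2" "sqrt m"] by simp
  have "C \<subseteq> \<Omega>" using mid[OF amplitude_le] ord m u_profile by (auto simp: C_def \<Omega>_def)
  define R where "R x = ray x ` closed_segment (norm_sq x) m" for x
  have R: "connected (C \<union> R x)" "R x \<subseteq> \<Omega>" "x \<in> R x" if "x \<in> \<Omega>" for x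
  proof -
    note x = \<Omega>D[OF that]
    show "R x \<subseteq> \<Omega>"
      using ray_segment[of x m "norm_sq x"] x mid[OF amplitude_le[of x]] ord u_profile[of x] by (auto simp: R_def)
    show "x \<in> R x" unfolding R_def using ray_self[OF x(3)] by (metis ends_in_segment(1) imageI)
    have "connected (R x)" unfolding R_def
      by (intro connected_continuous_image connected_segment) (use x(3) in \<open>auto simp: ray_def intro!: continuous_intros\<close>)
    moreover have "ray x m \<in> C \<inter> R x"
      using ray_props(1)[OF x(3) m] by (auto simp: C_def R_def)
    ultimately show "connected (C \<union> R x)" using \<open>connected C\<close> by (intro connected_Un) auto
  qed
  have "C \<noteq> {}"
  proof -
    have "norm_sq (vector [sqrt m, 0]) = m" using m by (simp add: norm_sq_def)
    then show ?thesis by (auto simp: C_def)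
  qed
  have "\<Omega> = \<Union> ((\<lambda>x. C \<union> R x) ` \<Omega>)" using R(2,3) \<open>C \<subseteq> \<Omega>\<close> by blast
  moreover have "connected (\<Union> ((\<lambda>x. C \<union> R x) ` \<Omega>))"
    by (rule connected_Union) (use R(1) \<open>C \<noteq> {}\<close> in auto)
  ultimately show ?thesis by simp
qed

lemma \<Omega>_nonempty: "\<Omega> \<noteq> {}"
proof -
  have m: "m > 0" using ord by simp
  have "norm_sq (vector [1, 0]) > 0" by (simp add: norm_sq_def)
  from ray_in_\<Omega>[OF this, of m] show ?thesis using mid[OF amplitude_le] ord by blast
qed

lemma bounded_domain_\<Omega>: "bounded_domain \<Omega>"
  unfolding bounded_domain_def using open_\<Omega> connected_\<Omega> \<Omega>_nonempty bounded_\<Omega> by blast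

lemma first_u: "first_dirichlet_eigenfunction \<Omega> u"
proof (rule positive_solution_is_first_eigenfunction[where \<mu> = 4])
  show "C_k k u" for k unfolding u_def by (rule C_k_wave)
  show "(\<Sum>i\<in>UNIV. grad (\<lambda>y. grad u y $ i) x $ i) = - 4 * u x" for x
    unfolding u_def by (rule Laplace_wave)
qed (use open_\<Omega> bounded_\<Omega> \<Omega>_nonempty \<Omega>D(4) frontier_\<Omega> in auto)

text \<open>The angular derivative forces sin(N \<theta>) = 0 because \<open>bessel (2 * M)\<close>
  is positive; the radial derivative then places the point at the peak of the profile for k = c or k
  = -c.\<close>

lemma critical_cos_angle:
  assumes "x \<in> closure \<Omega>" "grad u x = 0"
  shows "cos_angle M x = 1 \<and> norm_sq x = s_max \<or> cos_angle M x = - 1 \<and> norm_sq x = s_saddle"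
proof -
  note x = closure_\<Omega>[OF assms(1)]
  have "c * real (2 * M) * bessel (2 * M) (norm_sq x) * im_pow (2 * M) x = 0"
    using grad_wave_rot[of x "2 * M" c] assms(2) by (simp add: grad_u)
  then have "im_pow (2 * M) x = 0" using c M bessel_pos'[of "norm_sq x"] x by simp
  then have k: "cos_angle M x = 1 \<or> cos_angle M x = - 1" using cos_angle_cases x by blast
  have "profile' M (c * cos_angle M x) (norm_sq x) = 0"
    using grad_wave_radial[OF x(4) M, of c] assms(2) x by (simp add: grad_u)
  moreover have "s = s0" if "peaked a b s0 (profile' M k)" "profile' M k s = 0" "a \<le> s" "s \<le> b" for s s0 k
    using that by (cases s s0 rule: linorder_cases) (auto simp: peaked_def)
  ultimately show ?thesis using k s_max s_saddle x by auto
qed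

text \<open>The rays have empty interior: otherwise \<open>im_pow\<close> would vanish near x, but
  its gradient has a nonzero norm away from the origin.\<close>

lemma cos_angle_const_false:
  assumes "open T" "x \<in> T" "norm_sq x > 0" "\<And>y. y \<in> T \<Longrightarrow> cos_angle M y = - 1"
  shows False
proof -
  have "open (T \<inter> {y. 0 < norm_sq y})"
    using assms(1) by (intro open_Int open_Collect_less continuous_on_const cont_norm_sq)
  then have "\<forall>\<^sub>F y in nhds x. y \<in> T \<inter> {y. 0 < norm_sq y}"
    using assms by (intro eventually_nhds_in_open) auto
  then have "\<forall>\<^sub>F y in nhds x. im_pow (2 * M) y = 0"
    by (rule eventually_mono) (use cos_angle_im_pow assms(4) in blast)
  then have "GDERIV (im_pow (2 * M)) x :> 0" by (rule GDERIV_transfer[OF GDERIV_const])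
  then have "grad_im_pow (2 * M) x = 0" using GDERIV_im_pow grad_eqI by metis
  then show False using grad_im_pow_grad_im_pow[of "2 * M" x] assms(3) M by simp
qed

text \<open>On each circle in the annulus the rays with cos(N \<theta>) = -1 carry the strict
  minimum of \<open>u\<close>.\<close>

lemma u_rotate: 
  assumes "norm_sq x > 0" "norm_sq x \<le> b"
    and "cos_angle M x \<noteq> - 1"
  shows "u x > profile M (- c) (norm_sq x)"
proof -
  have eq: "u x - profile M (- c) (norm_sq x) = c * angular M (norm_sq x) * (cos_angle M x + 1)"
    using u_profile[OF assms(1)] by (simp add: profile_def algebra_simps)
  have "cos_angle M x + 1 > 0" using cos_angle_bound[of M x] assms(3) by linarith
  then have "c * angular M (norm_sq x) * (cos_angle M x + 1) > 0" using c angular_pos[OF assms(1,2)] by simp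
  then show ?thesis using eq by linarith
qed

text \<open>A critical point with cos(N \<theta>) = 1 maximises both the amplitude and the profile,
  so it is a local maximum. At the points with cos(N \<theta>) = -1, \<open>u\<close> is larger
  nearby on the same circle and smaller nearby on the same ray.\<close>

lemma saddle_iff: "x \<in> saddles \<Omega> u \<longleftrightarrow> x \<in> closure \<Omega> \<and> cos_angle M x = - 1 \<and> norm_sq x = s_saddle"
proof
  assume x: "x \<in> saddles \<Omega> u"
  then have cl: "x \<in> closure \<Omega>" and cr: "x \<in> critical_points \<Omega> u" and g: "grad u x = 0"
    and nmax: "x \<notin> maxima \<Omega> u"
    by (auto simp: saddles_def critical_points_def)
  have "\<not> (cos_angle M x = 1 \<and> norm_sq x = s_max)"
  proof
    assume k: "cos_angle M x = 1 \<and> norm_sq x = s_max"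
    have "open ({y. a < norm_sq y} \<inter> {y. norm_sq y < b})"
      by (intro open_Int open_Collect_less continuous_on_const cont_norm_sq)
    then have "\<forall>\<^sub>F y in nhds x. y \<in> {y. a < norm_sq y} \<inter> {y. norm_sq y < b}"
      using closure_\<Omega>_strict[OF cl] by (intro eventually_nhds_in_open) auto
    then have "\<forall>\<^sub>F y in nhds x. u y \<le> u x"
    proof (rule eventually_mono)
      fix y assume "y \<in> {y. a < norm_sq y} \<inter> {y. norm_sq y < b}"
      then have y: "norm_sq y > 0" "a \<le> norm_sq y" "norm_sq y \<le> b" using ord by auto
      have "u y = profile M (c * cos_angle M y) (norm_sq y)" by (rule u_profile[OF y(1)])
      also have "\<dots> \<le> profile M c (norm_sq y)"
        using amplitude_le[of y] angular_pos[OF y(1,3)] by (auto simp: profile_def intro!: mult_right_mono)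
      also have "\<dots> \<le> profile M c s_max" using peaked_max[OF s_max y(2,3)] by (cases "norm_sq y = s_max") auto
      also have "\<dots> = u x" using u_profile[OF closure_\<Omega>(4)[OF cl]] k by simp
      finally show "u y \<le> u x" .
    qed
    then show False using nmax cr by (simp add: maxima_def)
  qed
  then show "x \<in> closure \<Omega> \<and> cos_angle M x = - 1 \<and> norm_sq x = s_saddle" using critical_cos_angle[OF cl g] cl by blast
next
  assume x: "x \<in> closure \<Omega> \<and> cos_angle M x = - 1 \<and> norm_sq x = s_saddle"
  then have r: "norm_sq x > 0" and ux: "u x = profile M (- c) s_saddle"
    using closure_\<Omega>(4)[of x] u_profile[of x] by auto
  have "profile' M (- c) s_saddle = 0" using s_saddle by (simp add: peaked_def)
  then have "grad u x = 0"
    using grad_wave_on_ray[OF r M cos_angle_im_pow[OF r], of c] x by (simp add: grad_u)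
  then have cr: "x \<in> critical_points \<Omega> u" using x by (simp add: critical_points_def)
  have "\<not> (\<forall>\<^sub>F y in nhds x. u y \<le> u x)"
  proof
    assume "\<forall>\<^sub>F y in nhds x. u y \<le> u x"
    then obtain T where T: "open T" "x \<in> T" "\<And>y. y \<in> T \<Longrightarrow> u y \<le> u x" unfolding eventually_nhds by blast
    \<comment> \<open>Nearby points are projected to the circle s = s_saddle. If \<open>u\<close>
      had a maximum at x, all nearby directions would satisfy cos(N \<theta>) = -1.\<close>
    define T' where "T' = (\<lambda>y. ray y s_saddle) -` T \<inter> {y. 0 < norm_sq y}"
    have smp: "s_saddle > 0" using s_saddle ord by (simp add: peaked_def)
    have "continuous_on {y. 0 < norm_sq y} (\<lambda>y. ray y s_saddle)"
      unfolding ray_def by (intro continuous_intros cont_norm_sq) auto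
    moreover have op: "open {y. 0 < norm_sq y}" by (intro open_Collect_less continuous_on_const cont_norm_sq)
    ultimately have "open T'" unfolding T'_def using T(1) by (metis continuous_on_open_vimage)
    moreover have "x \<in> T'" using T(2) ray_self[OF r] x r by (auto simp: T'_def)
    moreover have "cos_angle M y = - 1" if "y \<in> T'" for y
    proof (rule ccontr)
      assume "cos_angle M y \<noteq> - 1"
      have y: "norm_sq y > 0" "ray y s_saddle \<in> T" using that by (auto simp: T'_def)
      have "u (ray y s_saddle) > profile M (- c) s_saddle"
        using u_rotate[of "ray y s_saddle"] ray_props(1,2)[OF y(1) smp] \<open>cos_angle M y \<noteq> - 1\<close> smp s_saddle
        by (auto simp: peaked_def)
      then show False using T(3)[OF y(2)] ux by simp
    qed
    ultimately show False using cos_angle_const_false r by blast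
  qed
  moreover have "\<not> (\<forall>\<^sub>F y in nhds x. u x \<le> u y)"
  proof
    assume "\<forall>\<^sub>F y in nhds x. u x \<le> u y"
    \<comment> \<open>Moving outwards on the ray, the profile falls strictly after its peak, which
      contradicts a local minimum.\<close>
    moreover have "((\<lambda>\<sigma>. ray x \<sigma>) \<longlongrightarrow> ray x s_saddle) (at_right s_saddle)"
      unfolding ray_def using r by (intro tendsto_intros) auto
    then have "((\<lambda>\<sigma>. ray x \<sigma>) \<longlongrightarrow> x) (at_right s_saddle)" using ray_self[OF r] x by simp
    ultimately have "\<forall>\<^sub>F \<sigma> in at_right s_saddle. u x \<le> u (ray x \<sigma>)"
      by (rule eventually_compose_filterlim)
    moreover have "\<forall>\<^sub>F \<sigma> in at_right s_saddle. \<sigma> \<in> {s_saddle<..<b}"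
      using s_saddle by (intro eventually_at_right_real) (simp add: peaked_def)
    ultimately have "\<forall>\<^sub>F \<sigma> in at_right s_saddle. u x \<le> u (ray x \<sigma>) \<and> \<sigma> \<in> {s_saddle<..<b}"
      by (rule eventually_conj)
    from eventually_happens'[OF _ this] obtain \<sigma> where \<sigma>: "u x \<le> u (ray x \<sigma>)" "s_saddle < \<sigma>" "\<sigma> < b"
      by auto
    have "\<sigma> > 0" using \<sigma> s_saddle ord by (simp add: peaked_def)
    then have "u (ray x \<sigma>) = profile M (- c) \<sigma>"
      using ray_props(3)[OF r, of \<sigma> M c] x by (simp add: u_def)
    then show False using \<sigma> peaked_strict(2)[OF s_saddle, of s_saddle \<sigma>] ux by simp
  qed
  ultimately show "x \<in> saddles \<Omega> u" using cr by (simp add: saddles_def maxima_def minima_def)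
qed

definition u_saddle :: real where "u_saddle = profile M (- c) s_saddle"

lemma u_saddle_pos: "u_saddle > 0"
  using mid[of "- c"] c peaked_max[OF s_saddle, of m] ord unfolding u_saddle_def by (cases "m = s_saddle") auto

lemma saddle_u:
  assumes "r \<in> saddles \<Omega> u"
  shows "u r = u_saddle"
  using assms closure_\<Omega>(4)[of r] u_profile[of r] unfolding saddle_iff u_saddle_def by auto

text \<open>cos(N \<theta>) does not increase along the flow, and a curve emanating from a saddle
  starts at its least possible value -1.\<close>

lemma unstable_cos_angle:
  assumes r: "r \<in> saddles \<Omega> u" and x: "x \<in> unstable_set \<Omega> u r"
  shows "cos_angle M x = - 1"
proof -
  have k: "cos_angle M r = - 1" "norm_sq r > 0" using r closure_\<Omega>(4)[of r] unfolding saddle_iff by auto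
  have "cos_angle M x \<le> cos_angle M r"
  proof (rule unstable_set_le[OF x])
    show "isCont (cos_angle M) r"
      using GDERIV_cos_angle[OF k(2) M] has_derivative_continuous unfolding gderiv_def by blast
    show "GDERIV (cos_angle M) y :> grad_cos_angle M y" if "y \<in> closure \<Omega>" for y
      using GDERIV_cos_angle closure_\<Omega>(4)[OF that] M by blast
    show "0 \<le> grad_cos_angle M y \<bullet> grad u y" if "y \<in> closure \<Omega>" for y
      unfolding grad_u using closure_\<Omega>[OF that] bessel_pos'[of "norm_sq y"] M c
      by (intro grad_cos_angle_grad_wave_nonneg) auto
  qed
  then show ?thesis using cos_angle_bound[of M x] k by simp
qed

text \<open>\<open>u\<close> decreases along the flow, so the stable set of a saddle lies at or
  above the saddle level. Below it only the unstable set remains, and that is contained in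
  rays.\<close>

lemma line_below_u_saddle:
  assumes "r \<in> saddles \<Omega> u" "x \<in> stable_set \<Omega> u r \<union> unstable_set \<Omega> u r" "u x < u_saddle"
  shows "cos_angle M x = - 1"
  using assms stable_set_ge[OF _ GDERIV_u, of x \<Omega> r] saddle_u unstable_cos_angle by fastforce

end

section \<open>Neumann domains\<close>

lemma angular'_has_continuous_derivative:
  obtains G where "continuous_on UNIV G" "\<And>s. (angular' M has_real_derivative G s) (at s)"
proof
  define G where "G s = real M * (real (M - 1) * s ^ (M - 1 - 1) * bessel (2 * M) s - s ^ (M - 1) * bessel (Suc (2 * M)) s)
     - (real M * s ^ (M - 1) * bessel (Suc (2 * M)) s - s ^ M * bessel (Suc (Suc (2 * M))) s)" for s
  show "continuous_on UNIV G" unfolding G_def by (intro continuous_intros bessel_cont)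
  show "(angular' M has_real_derivative G s) (at s)" for s
    unfolding angular'_def[abs_def] G_def by (auto intro!: derivative_eq_intros simp: algebra_simps)
qed

lemma Lipschitz_at_zero:
  fixes F F' :: "real \<Rightarrow> real"
  assumes "\<And>x. (F has_real_derivative F' x) (at x)" "continuous_on UNIV F'" "F p = 0" "l \<le> p" "p \<le> h"
  obtains K where "\<And>x. l \<le> x \<Longrightarrow> x \<le> h \<Longrightarrow> \<bar>F x\<bar> \<le> K * \<bar>x - p\<bar>"
proof -
  have "bounded (F' ` {l..h})"
    by (intro compact_imp_bounded compact_continuous_image continuous_on_subset[OF assms(2)]) auto
  then obtain K where K: "\<And>x. x \<in> {l..h} \<Longrightarrow> \<bar>F' x\<bar> \<le> K"
    unfolding bounded_iff real_norm_def by blast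
  have "norm (F x - F p) \<le> K * norm (x - p)" if "l \<le> x" "x \<le> h" for x
    by (rule field_differentiable_bound[of "{l..h}" F F'])
      (use assms K that in \<open>auto intro: has_field_derivative_at_within\<close>)
  then show thesis using that[of K] assms(3) by simp
qed

context annulus
begin

text \<open>The flow on a ray with cos(N \<theta>) = -1: at distance \<rho> from the origin, -
  \<open>grad u\<close> is \<open>F \<rho>\<close> times the unit vector of the ray.\<close>

definition F :: "real \<Rightarrow> real" where
  "F \<rho> = - (2 * \<rho> * profile' M (- c) (\<rho>\<^sup>2))"

lemma F_deriv:
  obtains F' where "\<And>x. (F has_real_derivative F' x) (at x)" "continuous_on UNIV F'"
proof -
  obtain G where G: "continuous_on UNIV G" "\<And>s. (angular' M has_real_derivative G s) (at s)"
    using angular'_has_continuous_derivative[of M] by blast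
  define F' where "F' x = - (2 * profile' M (- c) (x\<^sup>2) + 2 * x * (- bessel 2 (x\<^sup>2) * (2 * x) + - c * (G (x\<^sup>2) * (2 * x))))" for x
  have d2: "((\<lambda>x. x\<^sup>2) has_real_derivative 2 * x) (at x)" for x :: real
    by (auto intro!: derivative_eq_intros)
  have b: "((\<lambda>x. bessel 1 (x\<^sup>2)) has_real_derivative - bessel 2 (x\<^sup>2) * (2 * x)) (at x)" for x
    using DERIV_chain2[OF bessel_deriv[of 1 "x\<^sup>2"] d2] by (simp add: numeral_2_eq_2)
  have g: "((\<lambda>x. angular' M (x\<^sup>2)) has_real_derivative G (x\<^sup>2) * (2 * x)) (at x)" for x
    using DERIV_chain2[OF G(2)[of "x\<^sup>2"] d2] .
  have "(F has_real_derivative F' x) (at x)" for x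
    using DERIV_minus[OF DERIV_mult[OF DERIV_cmult_Id[of 2] DERIV_add[OF b DERIV_cmult[OF g, of "- c"]], of x]]
    unfolding F_def[abs_def] F'_def profile'_def by (simp add: algebra_simps)
  moreover have "continuous_on UNIV F'"
  proof -
    have sq: "continuous_on UNIV (\<lambda>x :: real. x\<^sup>2)" by (intro continuous_intros)
    have "continuous_on UNIV (angular' M)"
      unfolding angular'_def[abs_def] by (intro continuous_intros bessel_cont)
    note comp = continuous_on_compose2[OF this sq subset_UNIV] continuous_on_compose2[OF G(1) sq subset_UNIV]
      continuous_on_compose2[OF bessel_cont sq subset_UNIV]
    show ?thesis unfolding F'_def profile'_def by (intro continuous_intros comp)
  qed
  ultimately show thesis by (rule that)
qed

text \<open>The sign pattern of \<open>profile'\<close> makes the root of s_saddle a repelling fixed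
  point of the flow on the ray, so the backward solution from x tends to the saddle. It stays in the
  domain because the positive part of a peaked profile is an interval.\<close>

lemma ray_in_unstable_set:
  assumes x: "x \<in> \<Omega>" "cos_angle M x = - 1"
  shows "ray x s_saddle \<in> saddles \<Omega> u" "x \<in> unstable_set \<Omega> u (ray x s_saddle)"
proof -
  note xO = \<Omega>D[OF x(1)]
  have s_saddle': "a < s_saddle" "s_saddle < b" "s_saddle > 0" using s_saddle ord by (auto simp: peaked_def)
  have pos: "profile M (c * cos_angle M x) s_saddle > 0" "profile M (c * cos_angle M x) (norm_sq x) > 0"
    using u_saddle_pos x xO u_profile[of x] by (auto simp: u_saddle_def)
  have in\<Omega>: "ray x t \<in> \<Omega>" if "t \<in> closed_segment (norm_sq x) s_saddle" for t
    by (rule ray_segment[OF xO(3) s_saddle'(1,2) xO(1,2) that pos])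
  have "ray x s_saddle \<in> \<Omega>" by (rule in\<Omega>) simp
  then show "ray x s_saddle \<in> saddles \<Omega> u"
    unfolding saddle_iff using ray_props(1)[OF xO(3) s_saddle'(3)] ray_props(2)[OF xO(3) s_saddle'(3), of M] x(2) closure_subset by auto
  define e where "e = (1 / sqrt (norm_sq x)) *\<^sub>R x"
  have ray: "\<rho> *\<^sub>R e = ray x (\<rho>\<^sup>2)" if "\<rho> \<ge> 0" for \<rho>
    using that by (simp add: e_def ray_def real_sqrt_divide)
  obtain F' where F': "\<And>x. (F has_real_derivative F' x) (at x)" "continuous_on UNIV F'"
    by (rule F_deriv) (rule that)
  define p q where "p = sqrt s_saddle" and "q = sqrt (norm_sq x)"
  have order: "sqrt a < p" "p < sqrt b" "sqrt a < q" "q < sqrt b" "p > 0" "q > 0"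
    using s_saddle' xO by (auto simp: p_def q_def)
  have "F p = 0" using s_saddle s_saddle' by (simp add: F_def p_def peaked_def)
  then obtain K where K: "\<And>y. sqrt a \<le> y \<Longrightarrow> y \<le> sqrt b \<Longrightarrow> \<bar>F y\<bar> \<le> K * \<bar>y - p\<bar>"
    using Lipschitz_at_zero[OF F', of p "sqrt a" "sqrt b"] order by auto
  have sq: "s < y\<^sup>2" if "sqrt s < y" "s > 0" for s y
    using that by (metis less_eq_real_def linorder_not_le real_sqrt_gt_zero real_sqrt_le_iff real_sqrt_unique order.strict_trans)
  have sq': "y\<^sup>2 < s" if "y < sqrt s" "y > 0" for s y
    using that by (metis less_eq_real_def linorder_not_le real_le_lsqrt real_sqrt_gt_zero real_sqrt_le_iff real_sqrt_unique)
  have neg: "F y < 0" if "sqrt a < y" "y < p" for y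
  proof -
    have "y > 0" using that ord real_sqrt_gt_zero[of a] by linarith
    then have "profile' M (- c) (y\<^sup>2) > 0"
      using s_saddle sq[of a y] sq'[of y s_saddle] that ord by (auto simp: peaked_def p_def)
    then show ?thesis using \<open>y > 0\<close> by (simp add: F_def)
  qed
  have pos': "F y > 0" if "p < y" "y < sqrt b" for y
  proof -
    have "y > 0" using that order by linarith
    then have "profile' M (- c) (y\<^sup>2) < 0"
      using s_saddle sq[of s_saddle y] sq'[of y b] that s_saddle' by (auto simp: peaked_def p_def)
    then show ?thesis using \<open>y > 0\<close> by (simp add: F_def mult_pos_neg)
  qed
  have "isCont F y" for y using F'(1) by (rule DERIV_isCont)
  then obtain \<rho> where \<rho>: "\<rho> 0 = q" "\<And>t. t \<le> 0 \<Longrightarrow> \<rho> t \<in> closed_segment p q"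
    "\<And>t. t \<le> 0 \<Longrightarrow> (\<rho> has_real_derivative F (\<rho> t)) (at t)" "(\<rho> \<longlongrightarrow> p) at_bot"
    using flow_from_fixed_point_both_sides[OF order(1-4), of F K] neg pos' K by blast
  define \<gamma> where "\<gamma> t = \<rho> t *\<^sub>R e" for t
  have "\<gamma> 0 = x" using xO(3) by (simp add: \<gamma>_def \<rho>(1) e_def q_def)
  moreover have "(\<gamma> \<longlongrightarrow> ray x s_saddle) at_bot"
  proof -
    have "(\<gamma> \<longlongrightarrow> p *\<^sub>R e) at_bot" unfolding \<gamma>_def by (intro tendsto_intros \<rho>(4))
    then show ?thesis using ray[of p] order s_saddle' by (simp add: p_def)
  qed
  moreover have "gradient_curve \<Omega> u {..0} \<gamma>"
    unfolding gradient_curve_def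
  proof
    fix t :: real assume "t \<in> {..0}"
    then have t: "t \<le> 0" by simp
    have \<rho>t: "\<rho> t > 0" using \<rho>(2)[OF t] order by (auto simp: closed_segment_eq_real_ivl split: if_splits)
    have \<gamma>t: "\<gamma> t = ray x ((\<rho> t)\<^sup>2)" unfolding \<gamma>_def by (rule ray) (use \<rho>t in simp)
    have "(\<rho> t)\<^sup>2 \<in> closed_segment (norm_sq x) s_saddle"
    proof -
      have "p\<^sup>2 = s_saddle" "q\<^sup>2 = norm_sq x" using s_saddle' xO by (auto simp: p_def q_def)
      moreover have "p \<le> \<rho> t \<and> \<rho> t \<le> q \<or> q \<le> \<rho> t \<and> \<rho> t \<le> p"
        using \<rho>(2)[OF t] by (auto simp: closed_segment_eq_real_ivl split: if_splits)
      then have "p\<^sup>2 \<le> (\<rho> t)\<^sup>2 \<and> (\<rho> t)\<^sup>2 \<le> q\<^sup>2 \<or> q\<^sup>2 \<le> (\<rho> t)\<^sup>2 \<and> (\<rho> t)\<^sup>2 \<le> p\<^sup>2"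
        using order \<rho>t by (auto intro!: power_mono)
      ultimately show ?thesis by (auto simp: closed_segment_eq_real_ivl)
    qed
    then have "\<gamma> t \<in> \<Omega>" unfolding \<gamma>t by (rule in\<Omega>)
    have r2: "(\<rho> t)\<^sup>2 > 0" using \<rho>t by simp
    have k: "norm_sq (\<gamma> t) = (\<rho> t)\<^sup>2" "cos_angle M (\<gamma> t) = - 1"
      unfolding \<gamma>t using ray_props(1)[OF xO(3) r2] ray_props(2)[OF xO(3) r2, of M] x(2) by auto
    have r: "norm_sq (\<gamma> t) > 0" using k r2 by simp
    have "- grad u (\<gamma> t) = F (\<rho> t) *\<^sub>R e"
      unfolding grad_u grad_wave_on_ray[OF r M cos_angle_im_pow[OF r disjI2[OF k(2)]]] k F_def by (simp add: \<gamma>_def)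
    moreover have "(\<gamma> has_vector_derivative F (\<rho> t) *\<^sub>R e) (at t within {..0})"
      using has_vector_derivative_scaleR[OF has_field_derivative_at_within[OF \<rho>(3)[OF t]] has_vector_derivative_const[of e]]
      unfolding \<gamma>_def[abs_def] by simp
    ultimately show "\<gamma> t \<in> closure \<Omega> \<and> (\<gamma> has_vector_derivative - grad u (\<gamma> t)) (at t within {..0})"
      using \<open>\<gamma> t \<in> \<Omega>\<close> closure_subset by auto
  qed
  ultimately show "x \<in> unstable_set \<Omega> u (ray x s_saddle)"
    using x(1) closure_subset unfolding unstable_set_def by blast
qed

text \<open>The saddle on the ray is itself a critical point. Any other point x of the ray lies in
  L(r) and strictly below the saddle level; near x the set L(r) is contained in rays, so x is not
  interior to L(r).\<close>

lemma ray_subset_neumann_line_set: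
  assumes x: "x \<in> \<Omega>" "cos_angle M x = - 1"
  shows "x \<in> neumann_line_set \<Omega> u"
proof (cases "norm_sq x = s_saddle")
  case True
  then have "x \<in> saddles \<Omega> u" unfolding saddle_iff using x closure_subset by blast
  then show ?thesis by (simp add: neumann_line_set_def saddles_def)
next
  case False
  note xO = \<Omega>D[OF x(1)]
  define r where "r = ray x s_saddle"
  define L where "L = stable_set \<Omega> u r \<union> unstable_set \<Omega> u r"
  have r: "r \<in> saddles \<Omega> u" and "x \<in> L" using ray_in_unstable_set[OF x] by (auto simp: r_def L_def)
  have ux: "u x < u_saddle" unfolding u_saddle_def using u_profile[OF xO(3)] x(2) peaked_max[OF s_saddle, of "norm_sq x"] False xO by auto
  have "x \<notin> interior L"
  proof
    assume "x \<in> interior L"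
    define T where "T = interior L \<inter> {y. u y < u_saddle}"
    have "open T" unfolding T_def by (intro open_Int open_interior open_Collect_less cont_u continuous_on_const)
    moreover have "x \<in> T" using \<open>x \<in> interior L\<close> ux by (simp add: T_def)
    moreover have "cos_angle M y = - 1" if "y \<in> T" for y
      using line_below_u_saddle[OF r, of y] that interior_subset[of L] by (auto simp: T_def L_def)
    ultimately show False using cos_angle_const_false xO(3) by blast
  qed
  then have "x \<in> frontier L" using \<open>x \<in> L\<close> closure_subset by (auto simp: frontier_def)
  moreover have "x \<notin> frontier \<Omega>" using x(1) open_\<Omega> by (simp add: frontier_def interior_open)
  ultimately have "x \<in> (\<Union>r\<in>saddles \<Omega> u. frontier (stable_set \<Omega> u r \<union> unstable_set \<Omega> u r)) - frontier \<Omega>"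
    using r unfolding L_def by blast
  then show ?thesis unfolding neumann_line_set_def by (intro UnI1 subsetD[OF closure_subset])
qed

text \<open>The point has an open neighbourhood disjoint from every L(r), hence from their frontiers
  and from the closure of the union of these.\<close>

lemma not_in_neumann_line_set:
  assumes x: "x \<in> \<Omega>" "cos_angle M x \<noteq> - 1" "u x < u_saddle" "grad u x \<noteq> 0"
  shows "x \<notin> neumann_line_set \<Omega> u"
proof -
  \<comment> \<open>The last condition is \<open>cos_angle\<close> \<noteq> -1 multiplied by a power
    of \<open>norm_sq\<close>, so that it is visibly open on the whole plane.\<close>
  define V where "V = \<Omega> \<inter> {y. u y < u_saddle} \<inter> {y. re_pow (2 * M) y + norm_sq y ^ M \<noteq> 0}"
  have "open V" unfolding V_def
    by (intro open_Int open_\<Omega> open_Collect_less open_Collect_neq cont_u continuous_on_const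
        continuous_on_add continuous_on_power cont_re_pow cont_norm_sq)
  have "x \<in> V"
  proof -
    have "re_pow (2 * M) x + norm_sq x ^ M \<noteq> 0"
    proof
      assume "re_pow (2 * M) x + norm_sq x ^ M = 0"
      then have "re_pow (2 * M) x = - (norm_sq x ^ M)" by simp
      then show False using x(2) \<Omega>D(3)[OF x(1)] by (simp add: cos_angle_def)
    qed
    then show ?thesis using x by (simp add: V_def)
  qed
  have "V \<inter> frontier (stable_set \<Omega> u r \<union> unstable_set \<Omega> u r) = {}" if "r \<in> saddles \<Omega> u" for r
  proof -
    have "cos_angle M y = - 1 \<Longrightarrow> y \<notin> V" for y
      using re_pow_cos_angle[of y M] \<Omega>D(3)[of y] by (auto simp: V_def)
    then have "V \<inter> (stable_set \<Omega> u r \<union> unstable_set \<Omega> u r) = {}"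
      using line_below_u_saddle[OF that] by (auto simp: V_def)
    then have "V \<inter> closure (stable_set \<Omega> u r \<union> unstable_set \<Omega> u r) = {}"
      using open_Int_closure_eq_empty[OF \<open>open V\<close>] by blast
    then show ?thesis by (auto simp: frontier_def)
  qed
  then have "V \<inter> ((\<Union>r\<in>saddles \<Omega> u. frontier (stable_set \<Omega> u r \<union> unstable_set \<Omega> u r)) - frontier \<Omega>) = {}"
    by blast
  then have "V \<inter> closure ((\<Union>r\<in>saddles \<Omega> u. frontier (stable_set \<Omega> u r \<union> unstable_set \<Omega> u r)) - frontier \<Omega>) = {}"
    using open_Int_closure_eq_empty[OF \<open>open V\<close>] by blast
  then show ?thesis using \<open>x \<in> V\<close> x(4) by (auto simp: neumann_line_set_def critical_points_def)
qed

text \<open>The value identifies the sector, between two consecutive rays with cos(N \<theta>) = -1,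
  that contains the point.\<close>

definition root_map :: "real^2 \<Rightarrow> complex" where
  "root_map y = to_complex y / exp (Ln (to_complex y ^ (2 * M)) / of_nat (2 * M))"

text \<open>
  Off the rays \<open>cos_angle = - 1\<close> the principal root of \<open>z ^ (2 * M)\<close> is continuous, so \<open>root_map\<close>,
  whose values are roots of unity, is locally constant.
\<close>

lemma root_map_constant:
  assumes S: "connected S" "S \<subseteq> \<Omega> - neumann_line_set \<Omega> u" and y: "y \<in> S" "y' \<in> S"
  shows "root_map y = root_map y'"
proof -
  have cut: "to_complex z ^ (2 * M) \<notin> \<real>\<^sub>\<le>\<^sub>0" if "z \<in> S" for z
  proof
    assume "to_complex z ^ (2 * M) \<in> \<real>\<^sub>\<le>\<^sub>0"
    then have h: "re_pow (2 * M) z \<le> 0" "im_pow (2 * M) z = 0"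
      by (auto simp: complex_nonpos_Reals_iff re_pow_def im_pow_def)
    have z: "z \<in> \<Omega>" "z \<notin> neumann_line_set \<Omega> u" using S(2) that by auto
    have "norm_sq z ^ M > 0" using \<Omega>D(3)[OF z(1)] by simp
    then have "cos_angle M z \<le> 0" using h(1) by (simp add: cos_angle_def divide_le_0_iff)
    then have "cos_angle M z = - 1" using cos_angle_cases[OF \<Omega>D(3)[OF z(1)] h(2)] by auto
    then show False using ray_subset_neumann_line_set z by blast
  qed
  have cont_cz: "continuous_on S to_complex"
    by (intro continuous_at_imp_continuous_on ballI has_derivative_continuous[OF to_complex_has_derivative])
  have "root_map constant_on S"
  proof (rule continuous_finite_range_constant[OF S(1)])
    show "continuous_on S root_map"
      unfolding root_map_def using M cut by (intro continuous_intros cont_cz) auto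
    have "root_map z ^ (2 * M) = 1" if "z \<in> S" for z
    proof -
      have "(0 :: complex) \<in> \<real>\<^sub>\<le>\<^sub>0" by (simp add: complex_nonpos_Reals_iff)
      then have nz: "to_complex z ^ (2 * M) \<noteq> 0" using cut[OF that] by metis
      have "exp (Ln (to_complex z ^ (2 * M)) / of_nat (2 * M)) ^ (2 * M) = exp (Ln (to_complex z ^ (2 * M)))"
        using M by (intro exp_divide_power_eq) simp
      then show ?thesis using nz by (simp only: root_map_def power_divide exp_Ln) simp
    qed
    then have "root_map ` S \<subseteq> {w. w ^ (2 * M) = 1}" by blast
    moreover have "finite {w :: complex. w ^ (2 * M) = 1}" using M by (intro finite_nth_roots) simp
    ultimately show "finite (root_map ` S)" by (rule finite_subset)
  qed
  then show ?thesis using y unfolding constant_on_def by metis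
qed

text \<open>One point is taken in the middle of each sector, and \<open>root_map\<close> tells their
  components apart. The alternative of infinitely many components is kept because
  \<open>card\<close> is 0 on infinite sets.\<close>

lemma neumann_domains_ge:
  "infinite (neumann_domains \<Omega> u) \<or> 2 * M \<le> card (neumann_domains \<Omega> u)"
proof -
  have s_max': "a < s_max" "s_max < b" "s_max > 0" using s_max ord by (auto simp: peaked_def)
  \<comment> \<open>A positive level below both the saddles and the maxima. It is attained outside
    s_max on the rays with cos(N \<theta>) = 1, where the radial derivative is nonzero, so the
    points found there are noncritical and off the line set.\<close>
  define v where "v = min u_saddle (profile M c s_max) / 2"
  have "profile M c s_max > 0" using mid[of c] c peaked_max[OF s_max, of m] ord by (cases "m = s_max") auto
  then have v: "0 < v" "v < u_saddle" "v < profile M c s_max" using u_saddle_pos by (auto simp: v_def)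
  moreover have "profile M c b < 0" using bd(2)[of c] c by simp
  moreover have "continuous_on {s_max..b} (profile M c)"
    using profile_deriv by (meson DERIV_continuous_on has_field_derivative_at_within)
  ultimately obtain \<sigma> where \<sigma>: "s_max \<le> \<sigma>" "\<sigma> \<le> b" "profile M c \<sigma> = v"
    using IVT2'[of "profile M c" b v s_max] s_max' by auto
  have "\<sigma> \<noteq> s_max" "\<sigma> \<noteq> b" using \<sigma> v \<open>profile M c b < 0\<close> by auto
  then have \<sigma>': "s_max < \<sigma>" "\<sigma> < b" "0 < \<sigma>" using \<sigma> s_max' by auto
  define pt where "pt w = (vector [sqrt \<sigma> * Re w, sqrt \<sigma> * Im w] :: real^2)" for w
  define W where "W = {w :: complex. w ^ (2 * M) = 1}"
  have to_complex: "to_complex (pt w) = of_real (sqrt \<sigma>) * w" for w by (simp add: to_complex_def pt_def complex_eq_iff)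
  have pt: "pt w \<in> \<Omega> - neumann_line_set \<Omega> u" "to_complex (pt w) ^ (2 * M) = of_real (\<sigma> ^ M)" if "w \<in> W" for w
  proof -
    have w: "w ^ (2 * M) = 1" using that by (simp add: W_def)
    then have "cmod w = 1" using M power_eq_1_iff by fastforce
    then have r: "norm_sq (pt w) = \<sigma>" using \<sigma>'(3) by (simp add: norm_sq_to_complex to_complex norm_mult power_mult_distrib)
    have "to_complex (pt w) ^ (2 * M) = of_real (sqrt \<sigma> ^ (2 * M))"
      unfolding to_complex power_mult_distrib w by simp
    also have "sqrt \<sigma> ^ (2 * M) = \<sigma> ^ M" using \<sigma>'(3) by (simp add: power_mult)
    finally show p: "to_complex (pt w) ^ (2 * M) = of_real (\<sigma> ^ M)" .
    have "re_pow (2 * M) (pt w) = \<sigma> ^ M" unfolding re_pow_def p by (rule Re_complex_of_real)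
    then have k: "cos_angle M (pt w) = 1" unfolding cos_angle_def r using \<sigma>'(3) by simp
    have upt: "u (pt w) = v" using u_profile[of "pt w"] r k \<sigma>' \<sigma> by simp
    then have "pt w \<in> \<Omega>" using r \<sigma>' s_max' v by (simp add: \<Omega>_def)
    moreover have "grad u (pt w) \<noteq> 0"
    proof
      assume "grad u (pt w) = 0"
      then have "profile' M c \<sigma> = 0" using grad_wave_radial[of "pt w" M c] r k \<sigma>' M by (simp add: grad_u)
      moreover have "profile' M c \<sigma> < 0" using s_max \<sigma>' by (simp add: peaked_def)
      ultimately show False by simp
    qed
    ultimately show "pt w \<in> \<Omega> - neumann_line_set \<Omega> u"
      using not_in_neumann_line_set[of "pt w"] k upt v by simp
  qed
  define comp where "comp w = connected_component_set (\<Omega> - neumann_line_set \<Omega> u) (pt w)" for w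
  have "inj_on comp W"
  proof (rule inj_onI)
    fix w w' assume w: "w \<in> W" "w' \<in> W" "comp w = comp w'"
    have "pt w' \<in> comp w'" unfolding comp_def using pt(1)[OF w(2)] by (simp add: connected_component_refl)
    then have "pt w' \<in> comp w" using w(3) by simp
    then obtain S where S: "connected S" "S \<subseteq> \<Omega> - neumann_line_set \<Omega> u" "pt w \<in> S" "pt w' \<in> S"
      unfolding comp_def connected_component_def by blast
    \<comment> \<open>The points \<open>pt z\<close> all have the same power of exponent 2 M, hence
      the same principal root, so \<open>root_map\<close> multiplies each root of unity by one
      nonzero constant.\<close>
    define k where "k = of_real (sqrt \<sigma>) / exp (Ln (of_real (\<sigma> ^ M)) / of_nat (2 * M) :: complex)"
    have "k \<noteq> 0" using \<sigma>'(3) by (simp add: k_def)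
    have "root_map (pt z) = k * z" if "z \<in> W" for z
      unfolding root_map_def pt(2)[OF that] unfolding to_complex k_def by simp
    then have "k * w = k * w'" using root_map_constant[OF S] w by simp
    then show "w = w'" using \<open>k \<noteq> 0\<close> by simp
  qed
  moreover have "comp ` W \<subseteq> neumann_domains \<Omega> u"
    unfolding neumann_domains_def components_def comp_def using pt(1) by blast
  moreover have "card W = 2 * M" unfolding W_def using M by (intro card_nth_roots) auto
  ultimately show ?thesis using card_inj_on_le by metis
qed

end

theorem mainTheorem1:
  fixes n :: nat
  shows "\<exists>(\<Omega> :: (real^2) set) (\<Omega>' :: (real^2) set) (u :: real^2 \<Rightarrow> real).
    bounded_domain \<Omega> \<and>
    first_dirichlet_eigenfunction \<Omega> u \<and>
    open \<Omega>' \<and> closure \<Omega> \<subseteq> \<Omega>' \<and> real_analytic_on u \<Omega>' \<and>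
    (\<forall>x\<in>frontier \<Omega>. u x = 0) \<and>
    (infinite (neumann_domains \<Omega> u) \<or> n \<le> card (neumann_domains \<Omega> u))"
proof (rule bessel_profiles[of n])
  fix M a b m c
  assume *: "n \<le> 2 * M" "1 \<le> M" "0 < a" "a < m" "m < b" "b < real (Suc (2 * M))" "0 < c"
    "\<And>k. \<bar>k\<bar> \<le> c \<Longrightarrow> - bessel 0 a + k * angular M a < 0" "\<And>k. \<bar>k\<bar> \<le> c \<Longrightarrow> - bessel 0 b + k * angular M b < 0"
    "\<And>k. \<bar>k\<bar> \<le> c \<Longrightarrow> 0 < - bessel 0 m + k * angular M m"
    "\<And>k. \<bar>k\<bar> \<le> c \<Longrightarrow> \<exists>s0. peaked a b s0 (\<lambda>s. bessel 1 s + k * angular' M s)"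
  interpret annulus M a b m c
    by unfold_locales (use * in \<open>simp_all add: profile_def profile'_def[abs_def]\<close>)
  have "real_analytic_on u UNIV" unfolding u_def by (rule real_analytic_wave)
  then show ?thesis
    using bounded_domain_\<Omega> first_u frontier_\<Omega> neumann_domains_ge *(1)
    by (intro exI[of _ \<Omega>] exI[of _ UNIV] exI[of _ u]) auto
qed

end
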